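(* Let $\Gamma_1$ and $\Gamma_2$ be metrized graphs, and let $\Gamma_1\cup\Gamma_2$ be a metrized graph that is their union along two distinct points $p,q$, so that $\Gamma_1\cap\Gamma_2=\{p,q\}$. Let $r_1,r_2$ be the resistance functions of $\Gamma_1,\Gamma_2$. Then $$\tau(\Gamma_1\cup\Gamma_2)=\tau(\Gamma_1)+\tau(\Gamma_2)-\frac{r_1(p,q)+r_2(p,q)}{6}+\frac{A_{p,q,\Gamma_1}+A_{p,q,\Gamma_2}}{r_1(p,q)+r_2(p,q)}.$$
   Context: A metrized graph is a finite connected graph (multiple edges and self-loops allowed) in which each edge is identified with a closed interval of positive length. Regard it as a resistive circuit with segment resistance equal to length; $r(x,y)$ is effective resistance, and $j_z(x,y)$ is the potential at $x$ when unit current enters at $y$ and exits at $z$, with potential $0$ at $z$. For a metrized graph $G$ and $p,q\in G$, $A_{p,q,G}=\int_G j_x(p,q)\big(\frac{d}{dx}j_p(x,q)\big)^2dx$ (voltage function of $G$, $dx$ arclength, $d/dx$ along edges). The tau constant is $\tau(G)=\frac14\int_G\big(\frac{\partial}{\partial x}r(x,y)\big)^2dx$ (independent of $y$). *)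

theory Defs
  imports "HOL-Analysis.Analysis"
begin

text \<open>
  A metrized graph is given by its vertices and its edges, where the edge \<open>e\<close> is identified with the
  closed interval \<open>[0, elen e]\<close> through the map \<open>emap e\<close>.  Vertices are points of the ambient type, so
  multiple edges, self-loops and vertices of valence two are all allowed.  The points of the graph
  include the inner points of the edges.
\<close>

record ('a, 'e) mgraph =
  verts :: "'a set"
  edges :: "'e set"
  elen :: "'e \<Rightarrow> real"
  emap :: "'e \<Rightarrow> real \<Rightarrow> 'a"

definition pts :: "('a, 'e) mgraph \<Rightarrow> 'a set" where
  "pts G = verts G \<union> (\<Union>e\<in>edges G. emap G e ` {0..elen G e})"

definition adjacent :: "('a, 'e) mgraph \<Rightarrow> ('a \<times> 'a) set" where
  "adjacent G = {(emap G e 0, emap G e (elen G e)) | e. e \<in> edges G}"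

definition metrized_graph :: "('a, 'e) mgraph \<Rightarrow> bool" where
  "metrized_graph G \<longleftrightarrow>
     finite (verts G) \<and> verts G \<noteq> {} \<and> finite (edges G) \<and>
     (\<forall>e\<in>edges G. 0 < elen G e \<and> emap G e 0 \<in> verts G \<and> emap G e (elen G e) \<in> verts G \<and>
        inj_on (emap G e) {0<..<elen G e} \<and>
        emap G e ` {0<..<elen G e} \<inter> verts G = {}) \<and>
     (\<forall>e\<in>edges G. \<forall>e'\<in>edges G. e \<noteq> e' \<longrightarrow>
        emap G e ` {0<..<elen G e} \<inter> emap G e' ` {0<..<elen G e'} = {}) \<and>
     (\<forall>u\<in>verts G. \<forall>v\<in>verts G. (u, v) \<in> (adjacent G \<union> (adjacent G)\<inverse>)\<^sup>*)"

text \<open>Affine on the closed pieces between consecutive break points, hence continuous.\<close>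

definition piecewise_affine :: "(real \<Rightarrow> real) \<Rightarrow> real \<Rightarrow> real \<Rightarrow> bool" where
  "piecewise_affine g a b \<longleftrightarrow>
     (\<exists>S. finite S \<and>
        (\<forall>u v. a \<le> u \<and> u < v \<and> v \<le> b \<and> {u<..<v} \<inter> S = {} \<longrightarrow>
           (\<exists>m c. \<forall>t\<in>{u..v}. g t = m * t + c)))"

text \<open>
  Net current flowing from the point \<open>w\<close> into the graph under the potential \<open>f\<close>: resistance is length,
  so the current in a direction is minus the slope of \<open>f\<close> in that direction.  The sum runs over all
  directions issuing from \<open>w\<close>; an inner point of an edge has two of them, and a self-loop contributes
  two directions to its vertex.
\<close>

definition outflow :: "('a, 'e) mgraph \<Rightarrow> ('a \<Rightarrow> real) \<Rightarrow> 'a \<Rightarrow> real" where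
  "outflow G f w =
     (\<Sum>e\<in>edges G.
        (\<Sum>t\<in>{t\<in>{0..<elen G e}. emap G e t = w}.
           - vector_derivative (\<lambda>s. f (emap G e s)) (at_right t)) +
        (\<Sum>t\<in>{t\<in>{0<..elen G e}. emap G e t = w}.
           vector_derivative (\<lambda>s. f (emap G e s)) (at_left t)))"

text \<open>\<open>f\<close> is a potential on the circuit when unit current enters at \<open>y\<close> and exits at \<open>z\<close>.\<close>

definition potential :: "('a, 'e) mgraph \<Rightarrow> 'a \<Rightarrow> 'a \<Rightarrow> ('a \<Rightarrow> real) \<Rightarrow> bool" where
  "potential G y z f \<longleftrightarrow>
     (\<forall>e\<in>edges G. piecewise_affine (\<lambda>t. f (emap G e t)) 0 (elen G e)) \<and>
     (\<forall>w\<in>pts G. outflow G f w = of_bool (w = y) - of_bool (w = z))"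

text \<open>\<open>voltage G z x y\<close> is $j_z(x,y)$; note the order of the arguments.\<close>

definition voltage :: "('a, 'e) mgraph \<Rightarrow> 'a \<Rightarrow> 'a \<Rightarrow> 'a \<Rightarrow> real" where
  "voltage G z x y = (THE v. \<exists>f. potential G y z f \<and> f z = 0 \<and> v = f x)"

definition resistance :: "('a, 'e) mgraph \<Rightarrow> 'a \<Rightarrow> 'a \<Rightarrow> real" where
  "resistance G x y = voltage G y x x"

text \<open>
  Integrands are given in edge coordinates, because the derivative along an edge depends (up to sign)
  on the edge and not only on the point.
\<close>

definition graph_integral :: "('a, 'e) mgraph \<Rightarrow> ('e \<Rightarrow> real \<Rightarrow> real) \<Rightarrow> real" where
  "graph_integral G h = (\<Sum>e\<in>edges G. integral {0..elen G e} (h e))"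

definition edge_deriv :: "('a, 'e) mgraph \<Rightarrow> ('a \<Rightarrow> real) \<Rightarrow> 'e \<Rightarrow> real \<Rightarrow> real" where
  "edge_deriv G f e t = deriv (\<lambda>s. f (emap G e s)) t"

definition A_const :: "'a \<Rightarrow> 'a \<Rightarrow> ('a, 'e) mgraph \<Rightarrow> real" where
  "A_const p q G =
     graph_integral G (\<lambda>e t. voltage G (emap G e t) p q *
                             (edge_deriv G (\<lambda>x. voltage G p x q) e t)\<^sup>2)"

text \<open>The common value over all base points \<open>y\<close>.\<close>

definition tau :: "('a, 'e) mgraph \<Rightarrow> real" where
  "tau G =
     (THE c. \<forall>y\<in>pts G.
        c = 1 / 4 * graph_integral G (\<lambda>e t. (edge_deriv G (\<lambda>x. resistance G x y) e t)\<^sup>2))"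

text \<open>
  The path \<open>g\<close> on \<open>[0, L]\<close> runs through \<open>G\<close> at unit speed: after cutting at finitely many parameters,
  each closed piece is a piece of an edge of \<open>G\<close>, traversed in either direction.
\<close>

definition unit_speed_path :: "('a, 'e) mgraph \<Rightarrow> (real \<Rightarrow> 'a) \<Rightarrow> real \<Rightarrow> bool" where
  "unit_speed_path G g L \<longleftrightarrow>
     (\<exists>S. finite S \<and>
        (\<forall>u v. 0 \<le> u \<and> u < v \<and> v \<le> L \<and> {u<..<v} \<inter> S = {} \<longrightarrow>
           (\<exists>e\<in>edges G. \<exists>c.
              (\<forall>t\<in>{u..v}. c + t \<in> {0..elen G e} \<and> g t = emap G e (c + t)) \<or>
              (\<forall>t\<in>{u..v}. c - t \<in> {0..elen G e} \<and> g t = emap G e (c - t)))))"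

text \<open>
  \<open>H\<close> is a part of \<open>G\<close> with the inherited arclength.  The two vertex sets are unrelated: an edge of
  \<open>H\<close> may pass through vertices of \<open>G\<close>, and a vertex of \<open>H\<close> may be an inner point of an edge of \<open>G\<close>.
\<close>

definition metrized_subgraph :: "('a, 'd) mgraph \<Rightarrow> ('a, 'e) mgraph \<Rightarrow> bool" where
  "metrized_subgraph H G \<longleftrightarrow>
     pts H \<subseteq> pts G \<and> (\<forall>d\<in>edges H. unit_speed_path G (emap H d) (elen H d))"

definition is_union :: "('a, 'e) mgraph \<Rightarrow> ('a, 'e1) mgraph \<Rightarrow> ('a, 'e2) mgraph \<Rightarrow> bool" where
  "is_union G G1 G2 \<longleftrightarrow>
     pts G = pts G1 \<union> pts G2 \<and> metrized_subgraph G1 G \<and> metrized_subgraph G2 G"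

end

theory Submission
  imports Defs "HOL-Computational_Algebra.Polynomial"
begin

text \<open>
  Let \<open>E\<close> be the Dirichlet form \<open>E(f,g) = \<integral> f' g'\<close>.  The potential \<open>f\<close> for unit current from \<open>y\<close> to \<open>z\<close>
  satisfies Green's identity \<open>E(f,g) = g(y) - g(z)\<close> for every piecewise polynomial \<open>g\<close>, and is
  determined by it up to a constant.  All voltage identities, and the fact that \<open>4 \<tau> = E(r(_,y), r(_,y))\<close>
  does not depend on \<open>y\<close>, follow from this weak form.

  In the union, \<open>\<Gamma>\<^sub>2\<close> acts on \<open>\<Gamma>\<^sub>1\<close> as a resistor \<open>R\<^sub>2\<close> between \<open>p\<close> and \<open>q\<close>.  With \<open>R = R\<^sub>1 + R\<^sub>2\<close> and
  \<open>u = j\<^sub>p(_,q)\<close> on \<open>\<Gamma>\<^sub>1\<close> this gives \<open>r(x,p) = r\<^sub>1(x,p) - u(x)\<^sup>2 / R\<close> for \<open>x\<close> in \<open>\<Gamma>\<^sub>1\<close>.  By the Leibniz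
  rule and Green's identity for \<open>u\<close>, \<open>E(r\<^sub>1(_,p), u\<^sup>2) = R\<^sub>1\<^sup>2 - 2 A\<close> and \<open>E(u\<^sup>2, u\<^sup>2) = 4 R\<^sub>1\<^sup>3 / 3\<close>, so the
  part \<open>\<Gamma>\<^sub>1\<close> contributes \<open>\<tau>\<^sub>1 - R\<^sub>1\<^sup>2 / (2R) + A / R + R\<^sub>1\<^sup>3 / (3R\<^sup>2)\<close> to \<open>\<tau>\<close>.  Adding the two parts proves
  the formula.
\<close>

subsection \<open>Piecewise polynomials on an interval\<close>

text \<open>\<open>voltage\<close> and \<open>tau\<close> are definite descriptions, so potentials
  must exist and be unique before anything can be computed. Existence is reduced to a finite network
  on the vertices; a source inside an edge is added by an explicit tent, and the resulting formula
  shows that the resistance to a vertex is quadratic along every edge. This is why test functions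
  are piecewise polynomial and not just affine: resistances, \<open>u^2\<close> and
  \<open>u^3\<close> have to be inserted into Green's identity. The obstacle in the union is that
  its edges need not match those of the parts: the same set may be cut at other points and traversed
  in other directions. Current balance at a point is awkward to carry across such a change, while an
  integral is not. Hence in the union only Dirichlet forms are compared, off a finite set of points
  where the parametrizations or the functions may misbehave.\<close>

lemma interval_pieces_induct:
  fixes a b :: real
  assumes "finite S" "a < b"
    and "\<And>u v. a \<le> u \<Longrightarrow> u < v \<Longrightarrow> v \<le> b \<Longrightarrow> {u<..<v} \<inter> S = {} \<Longrightarrow> Q u v"
    and "\<And>u c v. a \<le> u \<Longrightarrow> u < c \<Longrightarrow> c < v \<Longrightarrow> v \<le> b \<Longrightarrow> Q u c \<Longrightarrow> Q c v \<Longrightarrow> Q u v"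
  shows "Q a b"
  using assms
proof (induction S arbitrary: a b rule: finite_induct)
  case empty
  then show ?case by simp
next
  case (insert s S)
  show ?case
  proof (cases "a < s \<and> s < b")
    case True
    have "Q a s"
      by (rule insert.IH) (use True insert.prems in auto)
    moreover have "Q s b"
      by (rule insert.IH) (use True insert.prems in auto)
    ultimately show ?thesis
      using insert.prems(3)[of a s b] True insert.prems by auto
  next
    case False
    show ?thesis
    proof (rule insert.IH)
      show "a < b" by fact
      show "Q u v" if "a \<le> u" "u < v" "v \<le> b" "{u<..<v} \<inter> S = {}" for u v
        by (rule insert.prems(2)) (use that False in auto)
    qed (use insert.prems(3) in auto)
  qed
qed

text \<open>Closed pieces share their ends, which forces continuity at the break points.\<close>

definition piecewise_poly :: "(real \<Rightarrow> real) \<Rightarrow> real \<Rightarrow> real \<Rightarrow> bool" where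
  "piecewise_poly g a b \<longleftrightarrow>
     (\<exists>S. finite S \<and>
        (\<forall>u v. a \<le> u \<and> u < v \<and> v \<le> b \<and> {u<..<v} \<inter> S = {} \<longrightarrow>
           (\<exists>P. \<forall>t\<in>{u..v}. g t = poly P t)))"

text \<open>Open pieces leave the values at break points free. This is the class of the derivatives,
  because \<open>deriv\<close> has an unspecified value at a kink.\<close>

definition piecewise_poly_open :: "(real \<Rightarrow> real) \<Rightarrow> real \<Rightarrow> real \<Rightarrow> bool" where
  "piecewise_poly_open g a b \<longleftrightarrow>
     (\<exists>S. finite S \<and>
        (\<forall>u v. a \<le> u \<and> u < v \<and> v \<le> b \<and> {u<..<v} \<inter> S = {} \<longrightarrow>
           (\<exists>P. \<forall>t\<in>{u<..<v}. g t = poly P t)))"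

lemma piecewise_affine_imp_poly:
  assumes "piecewise_affine g a b"
  shows "piecewise_poly g a b"
proof -
  obtain S where S: "finite S" "\<And>u v. a \<le> u \<and> u < v \<and> v \<le> b \<and> {u<..<v} \<inter> S = {} \<Longrightarrow>
           (\<exists>m c. \<forall>t\<in>{u..v}. g t = m * t + c)"
    using assms unfolding piecewise_affine_def by blast
  have "\<exists>P. \<forall>t\<in>{u..v}. g t = poly P t"
    if uv: "a \<le> u \<and> u < v \<and> v \<le> b \<and> {u<..<v} \<inter> S = {}" for u v
  proof -
    obtain m c where "\<forall>t\<in>{u..v}. g t = m * t + c" using S(2)[OF uv] by blast
    then show ?thesis by (intro exI[of _ "[:c, m:]"]) (auto simp: algebra_simps)
  qed
  then show ?thesis unfolding piecewise_poly_def using S(1) by blast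
qed

lemma piecewise_poly_imp_open:
  assumes "piecewise_poly g a b"
  shows "piecewise_poly_open g a b"
proof -
  obtain S where S: "finite S" "\<And>u v. a \<le> u \<and> u < v \<and> v \<le> b \<and> {u<..<v} \<inter> S = {} \<Longrightarrow>
           (\<exists>P. \<forall>t\<in>{u..v}. g t = poly P t)"
    using assms unfolding piecewise_poly_def by blast
  have "\<exists>P. \<forall>t\<in>{u<..<v}. g t = poly P t"
    if uv: "a \<le> u \<and> u < v \<and> v \<le> b \<and> {u<..<v} \<inter> S = {}" for u v
  proof -
    obtain P where "\<forall>t\<in>{u..v}. g t = poly P t" using S(2)[OF uv] by blast
    then show ?thesis by (intro exI[of _ P]) auto
  qed
  then show ?thesis unfolding piecewise_poly_open_def using S(1) by blast
qed

lemma piecewise_poly_binop: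
  assumes "piecewise_poly f a b" "piecewise_poly g a b"
    and op: "\<And>P Q :: real poly. \<exists>R. \<forall>t. h (poly P t) (poly Q t) = poly R t"
  shows "piecewise_poly (\<lambda>t. h (f t) (g t)) a b"
proof -
  obtain S where S: "finite S" "\<And>u v. a \<le> u \<and> u < v \<and> v \<le> b \<and> {u<..<v} \<inter> S = {} \<Longrightarrow>
           (\<exists>P. \<forall>t\<in>{u..v}. f t = poly P t)"
    using assms(1) unfolding piecewise_poly_def by blast
  obtain S' where S': "finite S'" "\<And>u v. a \<le> u \<and> u < v \<and> v \<le> b \<and> {u<..<v} \<inter> S' = {} \<Longrightarrow>
           (\<exists>P. \<forall>t\<in>{u..v}. g t = poly P t)"
    using assms(2) unfolding piecewise_poly_def by blast
  have "\<exists>R. \<forall>t\<in>{u..v}. h (f t) (g t) = poly R t"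
    if uv: "a \<le> u \<and> u < v \<and> v \<le> b \<and> {u<..<v} \<inter> (S \<union> S') = {}" for u v
  proof -
    have "{u<..<v} \<inter> S = {}" "{u<..<v} \<inter> S' = {}" using uv by blast+
    then obtain P Q where "\<forall>t\<in>{u..v}. f t = poly P t" "\<forall>t\<in>{u..v}. g t = poly Q t"
      using S(2)[of u v] S'(2)[of u v] uv by metis
    moreover obtain R where "\<forall>t. h (poly P t) (poly Q t) = poly R t" using op by blast
    ultimately show ?thesis by (intro exI[of _ R]) auto
  qed
  then show ?thesis unfolding piecewise_poly_def using S(1) S'(1)
    by (intro exI[of _ "S \<union> S'"] conjI) blast+
qed

lemma piecewise_poly_open_binop:
  assumes "piecewise_poly_open f a b" "piecewise_poly_open g a b"
    and op: "\<And>P Q :: real poly. \<exists>R. \<forall>t. h (poly P t) (poly Q t) = poly R t"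
  shows "piecewise_poly_open (\<lambda>t. h (f t) (g t)) a b"
proof -
  obtain S where S: "finite S" "\<And>u v. a \<le> u \<and> u < v \<and> v \<le> b \<and> {u<..<v} \<inter> S = {} \<Longrightarrow>
           (\<exists>P. \<forall>t\<in>{u<..<v}. f t = poly P t)"
    using assms(1) unfolding piecewise_poly_open_def by blast
  obtain S' where S': "finite S'" "\<And>u v. a \<le> u \<and> u < v \<and> v \<le> b \<and> {u<..<v} \<inter> S' = {} \<Longrightarrow>
           (\<exists>P. \<forall>t\<in>{u<..<v}. g t = poly P t)"
    using assms(2) unfolding piecewise_poly_open_def by blast
  have "\<exists>R. \<forall>t\<in>{u<..<v}. h (f t) (g t) = poly R t"
    if uv: "a \<le> u \<and> u < v \<and> v \<le> b \<and> {u<..<v} \<inter> (S \<union> S') = {}" for u v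
  proof -
    have "{u<..<v} \<inter> S = {}" "{u<..<v} \<inter> S' = {}" using uv by blast+
    then obtain P Q where "\<forall>t\<in>{u<..<v}. f t = poly P t" "\<forall>t\<in>{u<..<v}. g t = poly Q t"
      using S(2)[of u v] S'(2)[of u v] uv by metis
    moreover obtain R where "\<forall>t. h (poly P t) (poly Q t) = poly R t" using op by blast
    ultimately show ?thesis by (intro exI[of _ R]) auto
  qed
  then show ?thesis unfolding piecewise_poly_open_def using S(1) S'(1)
    by (intro exI[of _ "S \<union> S'"] conjI) blast+
qed

lemma piecewise_poly_const: "piecewise_poly (\<lambda>t. c) a b"
proof -
  have "\<exists>P. \<forall>t\<in>{u..v}. c = poly P t" for u v :: real
    by (rule exI[of _ "[:c:]"]) simp
  then show ?thesis
    unfolding piecewise_poly_def by blast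
qed

lemma piecewise_poly_add:
  "piecewise_poly f a b \<Longrightarrow> piecewise_poly g a b \<Longrightarrow> piecewise_poly (\<lambda>t. f t + g t) a b"
  by (erule (1) piecewise_poly_binop) (rule exI, rule allI, rule poly_add[symmetric])

lemma piecewise_poly_diff:
  "piecewise_poly f a b \<Longrightarrow> piecewise_poly g a b \<Longrightarrow> piecewise_poly (\<lambda>t. f t - g t) a b"
  by (erule (1) piecewise_poly_binop) (rule exI, rule allI, rule poly_diff[symmetric])

lemma piecewise_poly_mult:
  "piecewise_poly f a b \<Longrightarrow> piecewise_poly g a b \<Longrightarrow> piecewise_poly (\<lambda>t. f t * g t) a b"
  by (erule (1) piecewise_poly_binop) (rule exI, rule allI, rule poly_mult[symmetric])

lemma piecewise_poly_open_mult:
  "piecewise_poly_open f a b \<Longrightarrow> piecewise_poly_open g a b \<Longrightarrow> piecewise_poly_open (\<lambda>t. f t * g t) a b"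
  by (erule (1) piecewise_poly_open_binop) (rule exI, rule allI, rule poly_mult[symmetric])

lemma piecewise_poly_cong:
  assumes "piecewise_poly f a b" "\<And>t. t \<in> {a..b} \<Longrightarrow> g t = f t"
  shows "piecewise_poly g a b"
proof -
  obtain S where S: "finite S" "\<And>u v. a \<le> u \<and> u < v \<and> v \<le> b \<and> {u<..<v} \<inter> S = {} \<Longrightarrow>
           (\<exists>P. \<forall>t\<in>{u..v}. f t = poly P t)"
    using assms(1) unfolding piecewise_poly_def by blast
  have "\<exists>P. \<forall>t\<in>{u..v}. g t = poly P t"
    if uv: "a \<le> u \<and> u < v \<and> v \<le> b \<and> {u<..<v} \<inter> S = {}" for u v
  proof -
    obtain P where "\<forall>t\<in>{u..v}. f t = poly P t" using S(2)[OF uv] by blast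
    then show ?thesis using assms(2) uv by (intro exI[of _ P]) auto
  qed
  then show ?thesis unfolding piecewise_poly_def using S(1) by blast
qed

lemma piecewise_poly_join:
  assumes "piecewise_poly f a c" "piecewise_poly f c b"
  shows "piecewise_poly f a b"
proof -
  obtain S where S: "finite S" "\<And>u v. a \<le> u \<and> u < v \<and> v \<le> c \<and> {u<..<v} \<inter> S = {} \<Longrightarrow>
           (\<exists>P. \<forall>t\<in>{u..v}. f t = poly P t)"
    using assms(1) unfolding piecewise_poly_def by blast
  obtain S' where S': "finite S'" "\<And>u v. c \<le> u \<and> u < v \<and> v \<le> b \<and> {u<..<v} \<inter> S' = {} \<Longrightarrow>
           (\<exists>P. \<forall>t\<in>{u..v}. f t = poly P t)"
    using assms(2) unfolding piecewise_poly_def by blast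
  have "\<exists>P. \<forall>t\<in>{u..v}. f t = poly P t"
    if uv: "a \<le> u \<and> u < v \<and> v \<le> b \<and> {u<..<v} \<inter> insert c (S \<union> S') = {}" for u v
  proof -
    have *: "{u<..<v} \<inter> S = {}" "{u<..<v} \<inter> S' = {}" "c \<notin> {u<..<v}" using uv by blast+
    then consider "v \<le> c" | "c \<le> u" by fastforce
    then show ?thesis
      by cases (use S(2)[of u v] S'(2)[of u v] uv * in auto)
  qed
  then show ?thesis unfolding piecewise_poly_def using S(1) S'(1)
    by (intro exI[of _ "insert c (S \<union> S')"] conjI) blast+
qed

lemma deriv_eq_poly_pderiv:
  assumes "\<And>t. t \<in> {u<..<v} \<Longrightarrow> g t = poly P t" "t \<in> {u<..<v}"
  shows "(g has_real_derivative poly (pderiv P) t) (at t)" "deriv g t = poly (pderiv P) t"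
proof -
  show "(g has_real_derivative poly (pderiv P) t) (at t)"
    by (rule has_field_derivative_transform_within_open[OF poly_DERIV, where S="{u<..<v}"])
      (use assms in auto)
  then show "deriv g t = poly (pderiv P) t" by (rule DERIV_imp_deriv)
qed

lemma piecewise_poly_open_deriv:
  assumes "piecewise_poly f a b"
  shows "piecewise_poly_open (deriv f) a b"
proof -
  obtain S where S: "finite S" "\<And>u v. a \<le> u \<and> u < v \<and> v \<le> b \<and> {u<..<v} \<inter> S = {} \<Longrightarrow>
           (\<exists>P. \<forall>t\<in>{u..v}. f t = poly P t)"
    using assms(1) unfolding piecewise_poly_def by blast
  have "\<exists>P. \<forall>t\<in>{u<..<v}. deriv f t = poly P t"
    if uv: "a \<le> u \<and> u < v \<and> v \<le> b \<and> {u<..<v} \<inter> S = {}" for u v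
  proof -
    obtain P where "\<forall>t\<in>{u..v}. f t = poly P t" using S(2)[OF uv] by blast
    then show ?thesis 
      by (intro exI[of _ "pderiv P"] ballI deriv_eq_poly_pderiv(2)[of u v]) auto
  qed
  then show ?thesis unfolding piecewise_poly_open_def using S(1) by blast
qed

lemma finite_avoiding_nhd:
  fixes t :: real
  assumes "finite S" "t \<in> {a<..<b}" "t \<notin> S"
  obtains u v where "a \<le> u" "u < t" "t < v" "v \<le> b" "{u<..<v} \<inter> S = {}"
proof -
  have "open ({a<..<b} - S)" using assms(1) by (intro open_Diff finite_imp_closed) auto
  then obtain e where e: "e > 0" "ball t e \<subseteq> {a<..<b} - S"
    using assms by (meson DiffI openE)
  have sub: "{t - e<..<t + e} \<subseteq> {a<..<b} - S"
    using e(2) by (auto simp: ball_eq_greaterThanLessThan)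
  then have "{t - e<..<t + e} \<subseteq> {a<..<b}" by blast
  then have "a \<le> t - e" "t + e \<le> b" using e(1) by (auto simp: greaterThanLessThan_subseteq_greaterThanLessThan)
  then show thesis using that[of "t - e" "t + e"] e(1) sub by auto
qed

lemma piecewise_poly_DERIV:
  assumes "piecewise_poly f a b"
  obtains S where "finite S"
    "\<And>t. t \<in> {a<..<b} - S \<Longrightarrow> (f has_real_derivative deriv f t) (at t)"
proof -
  obtain S where S: "finite S" "\<And>u v. a \<le> u \<and> u < v \<and> v \<le> b \<and> {u<..<v} \<inter> S = {} \<Longrightarrow>
           (\<exists>P. \<forall>t\<in>{u..v}. f t = poly P t)"
    using assms(1) unfolding piecewise_poly_def by blast
  have "(f has_real_derivative deriv f t) (at t)" if t: "t \<in> {a<..<b} - S" for t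
  proof -
    obtain u v where uv: "a \<le> u" "u < t" "t < v" "v \<le> b" "{u<..<v} \<inter> S = {}"
      using finite_avoiding_nhd[OF S(1)] t by blast
    then obtain P where P: "\<forall>t\<in>{u..v}. f t = poly P t" using S(2)[of u v] by auto
    show ?thesis using deriv_eq_poly_pderiv[of u v f P t] uv P by auto
  qed
  then show thesis using that S(1) by blast
qed

lemma piecewise_poly_continuous:
  assumes "piecewise_poly f a b" "a < b"
  shows "continuous_on {a..b} f"
proof -
  obtain S where S: "finite S" "\<And>u v. a \<le> u \<and> u < v \<and> v \<le> b \<and> {u<..<v} \<inter> S = {} \<Longrightarrow>
           (\<exists>P. \<forall>t\<in>{u..v}. f t = poly P t)"
    using assms(1) unfolding piecewise_poly_def by blast
  show ?thesis
  proof (rule interval_pieces_induct[OF S(1) assms(2)])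
    fix u v assume "a \<le> u" "u < v" "v \<le> b" "{u<..<v} \<inter> S = {}"
    then obtain P where "\<forall>t\<in>{u..v}. f t = poly P t" using S(2)[of u v] by auto
    then show "continuous_on {u..v} f"
      by (subst continuous_on_cong[where g="poly P", OF refl]) (auto intro!: continuous_intros)
  next
    fix u c v assume *: "u < c" "c < v" "continuous_on {u..c} f" "continuous_on {c..v} f"
    have "{u..v} = {u..c} \<union> {c..v}" using * by auto
    then show "continuous_on {u..v} f"
      using continuous_on_closed_Un[of "{u..c}" "{c..v}" f] * by auto
  qed
qed

lemma piecewise_poly_open_abs_integrable:
  assumes "piecewise_poly_open f a b" "a < b"
  shows "f absolutely_integrable_on {a..b}"
proof -
  obtain S where S: "finite S" "\<And>u v. a \<le> u \<and> u < v \<and> v \<le> b \<and> {u<..<v} \<inter> S = {} \<Longrightarrow>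
           (\<exists>P. \<forall>t\<in>{u<..<v}. f t = poly P t)"
    using assms(1) unfolding piecewise_poly_open_def by blast
  show ?thesis
  proof (rule interval_pieces_induct[OF S(1) assms(2)])
    fix u v assume "a \<le> u" "u < v" "v \<le> b" "{u<..<v} \<inter> S = {}"
    then obtain P where P: "\<forall>t\<in>{u<..<v}. f t = poly P t" using S(2)[of u v] by auto
    have "poly P absolutely_integrable_on {u..v}"
      by (rule absolutely_integrable_continuous_real) (auto intro!: continuous_intros)
    then show "f absolutely_integrable_on {u..v}"
      by (rule absolutely_integrable_spike[where S="{u, v}"]) (use P in auto)
  next
    fix u c v assume *: "u < c" "c < v" "f absolutely_integrable_on {u..c}" "f absolutely_integrable_on {c..v}"
    have "{u..v} = {u..c} \<union> {c..v}" using * by auto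
    then show "f absolutely_integrable_on {u..v}"
      using set_integrable_Un[OF *(3,4)] by auto
  qed
qed

lemma piecewise_poly_FTC:
  assumes "piecewise_poly f a b" "a < b"
  shows "(deriv f has_integral f b - f a) {a..b}"
proof -
  obtain S where S: "finite S"
    "\<And>t. t \<in> {a<..<b} - S \<Longrightarrow> (f has_real_derivative deriv f t) (at t)"
    using piecewise_poly_DERIV[OF assms(1)] by blast
  show ?thesis
    by (rule fundamental_theorem_of_calculus_interior_strong[OF S(1)])
      (use assms S(2) piecewise_poly_continuous in
        \<open>auto simp: has_real_derivative_iff_has_vector_derivative[symmetric]\<close>)
qed

lemma piecewise_poly_deriv_mult:
  assumes "piecewise_poly f a b" "piecewise_poly g a b"
  obtains S where "finite S"
    "\<And>t. t \<in> {a..b} - S \<Longrightarrow> deriv (\<lambda>s. f s * g s) t = f t * deriv g t + g t * deriv f t"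
proof -
  obtain S where S: "finite S"
    "\<And>t. t \<in> {a<..<b} - S \<Longrightarrow> (f has_real_derivative deriv f t) (at t)"
    using piecewise_poly_DERIV[OF assms(1)] by blast
  obtain S' where S': "finite S'"
    "\<And>t. t \<in> {a<..<b} - S' \<Longrightarrow> (g has_real_derivative deriv g t) (at t)"
    using piecewise_poly_DERIV[OF assms(2)] by blast
  show thesis
  \<comment> \<open>The ends are exceptional as well: \<open>deriv\<close> is two-sided and sees
    values outside \<open>{a..b}\<close> there.\<close>
  proof (rule that[of "{a, b} \<union> S \<union> S'"])
    fix t assume t: "t \<in> {a..b} - ({a, b} \<union> S \<union> S')"
    then have "t \<in> {a<..<b} - S" "t \<in> {a<..<b} - S'" by auto
    from DERIV_mult[OF S(2)[OF this(1)] S'(2)[OF this(2)]]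
    show "deriv (\<lambda>s. f s * g s) t = f t * deriv g t + g t * deriv f t"
      by (auto dest!: DERIV_imp_deriv simp: algebra_simps)
  qed (use S S' in auto)
qed

lemma piecewise_poly_deriv_diff:
  assumes "piecewise_poly f a b" "piecewise_poly g a b"
  obtains S where "finite S"
    "\<And>t. t \<in> {a..b} - S \<Longrightarrow> deriv (\<lambda>s. f s - g s) t = deriv f t - deriv g t"
proof -
  obtain S where S: "finite S"
    "\<And>t. t \<in> {a<..<b} - S \<Longrightarrow> (f has_real_derivative deriv f t) (at t)"
    using piecewise_poly_DERIV[OF assms(1)] by blast
  obtain S' where S': "finite S'"
    "\<And>t. t \<in> {a<..<b} - S' \<Longrightarrow> (g has_real_derivative deriv g t) (at t)"
    using piecewise_poly_DERIV[OF assms(2)] by blast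
  show thesis
  proof (rule that[of "{a, b} \<union> S \<union> S'"])
    fix t assume t: "t \<in> {a..b} - ({a, b} \<union> S \<union> S')"
    then have "t \<in> {a<..<b} - S" "t \<in> {a<..<b} - S'" by auto
    from DERIV_diff[OF S(2)[OF this(1)] S'(2)[OF this(2)]]
    show "deriv (\<lambda>s. f s - g s) t = deriv f t - deriv g t"
      by (auto dest!: DERIV_imp_deriv)
  qed (use S S' in auto)
qed

text \<open>Cauchy-Schwarz by hand: with \<open>l\<close> the mean slope on \<open>{a..s}\<close>,
  the integral of \<open>(f' - l)^2\<close> over \<open>{a..s}\<close> is the energy there minus
  \<open>l^2 * (s - a)\<close>. It is nonnegative, so zero energy forces \<open>l = 0\<close>, and
  no almost-everywhere argument is needed.\<close>

lemma zero_energy_imp_const: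
  assumes f: "piecewise_poly f a b" and "a < b"
    and zero: "integral {a..b} (\<lambda>t. deriv f t * deriv f t) = 0" and s: "s \<in> {a..b}"
  shows "f s = f a"
proof (cases "s = a")
  case False
  then have as: "a < s" using s by auto
  have int: "(\<lambda>t. deriv f t * deriv f t) integrable_on {a..b}"
    using piecewise_poly_open_abs_integrable[OF piecewise_poly_open_mult[OF piecewise_poly_open_deriv[OF f] piecewise_poly_open_deriv[OF f]] \<open>a < b\<close>]
    by (rule set_lebesgue_integral_eq_integral(1))
  have ints: "(\<lambda>t. deriv f t * deriv f t) integrable_on {a..s}"
    by (rule integrable_on_subinterval[OF int]) (use s in auto)
  have "integral {a..s} (\<lambda>t. deriv f t * deriv f t) \<le> integral {a..b} (\<lambda>t. deriv f t * deriv f t)"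
    by (rule integral_subset_le) (use s int ints in auto)
  then have le: "integral {a..s} (\<lambda>t. deriv f t * deriv f t) \<le> 0" using zero by simp
  have fs: "piecewise_poly f a s"
    using f s unfolding piecewise_poly_def by (meson atLeastAtMost_iff order_trans)
  define l where "l = (f s - f a) / (s - a)"
  have "((\<lambda>t. deriv f t * deriv f t - 2 * l * deriv f t + l * l) has_integral
      integral {a..s} (\<lambda>t. deriv f t * deriv f t) - 2 * l * (f s - f a) + (s - a) * (l * l)) {a..s}"
    using has_integral_const_real[of "l * l" a s] as
    by (intro has_integral_add has_integral_diff has_integral_mult_right
        integrable_integral ints piecewise_poly_FTC fs) auto
  then have "0 \<le> integral {a..s} (\<lambda>t. deriv f t * deriv f t) - 2 * l * (f s - f a) + (s - a) * (l * l)"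
  proof (rule has_integral_nonneg)
    fix t
    have "deriv f t * deriv f t - 2 * l * deriv f t + l * l = (deriv f t - l)\<^sup>2"
      by (simp add: power2_eq_square algebra_simps)
    then show "0 \<le> deriv f t * deriv f t - 2 * l * deriv f t + l * l" by simp
  qed
  then have "0 \<le> - 2 * l * (f s - f a) + (s - a) * (l * l)" using le by linarith
  moreover have fl: "f s - f a = l * (s - a)" using as by (simp add: l_def)
  ultimately have "0 \<le> - (l * l * (s - a))" by (simp add: algebra_simps)
  then have "l * l * (s - a) \<le> 0" by simp
  then have "l * l \<le> 0" using as by (simp add: mult_le_0_iff)
  then have "l = 0" by (metis mult_eq_0_iff not_square_less_zero order_le_less)
  then show ?thesis using fl by simp
qed simp

section \<open>One-sided slopes and Green's identity on an interval\<close>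

lemma has_vector_derivative_at_right_affine:
  assumes "\<And>t. t \<in> {u..v} \<Longrightarrow> f t = m * t + c" "u \<le> t" "t < v"
  shows "(f has_vector_derivative m) (at_right t)" "vector_derivative f (at_right t) = m"
proof -
  have "((\<lambda>t. m * t + c) has_real_derivative m) (at t within {t..v})"
    by (auto intro!: derivative_eq_intros)
  then have "((\<lambda>t. m * t + c) has_vector_derivative m) (at t within {t..v})"
    by (simp add: has_real_derivative_iff_has_vector_derivative)
  then have "(f has_vector_derivative m) (at t within {t..v})"
    by (rule has_vector_derivative_transform[rotated 2]) (use assms in auto)
  then show *: "(f has_vector_derivative m) (at_right t)"
    using assms(3) by (simp add: at_within_Icc_at_right has_vector_derivative_def)
  show "vector_derivative f (at_right t) = m"
    by (rule vector_derivative_within[OF _ *]) (simp add: trivial_limit_at_right_real)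
qed

lemma has_vector_derivative_at_left_affine:
  assumes "\<And>t. t \<in> {u..v} \<Longrightarrow> f t = m * t + c" "u < t" "t \<le> v"
  shows "(f has_vector_derivative m) (at_left t)" "vector_derivative f (at_left t) = m"
proof -
  have "((\<lambda>t. m * t + c) has_real_derivative m) (at t within {u..t})"
    by (auto intro!: derivative_eq_intros)
  then have "((\<lambda>t. m * t + c) has_vector_derivative m) (at t within {u..t})"
    by (simp add: has_real_derivative_iff_has_vector_derivative)
  then have "(f has_vector_derivative m) (at t within {u..t})"
    by (rule has_vector_derivative_transform[rotated 2]) (use assms in auto)
  then show *: "(f has_vector_derivative m) (at_left t)"
    using assms(2) by (simp add: at_within_Icc_at_left has_vector_derivative_def)
  show "vector_derivative f (at_left t) = m"
    by (rule vector_derivative_within[OF _ *]) (simp add: trivial_limit_at_left_real)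
qed

text \<open>On a piece where \<open>u\<close> has slope \<open>m\<close> the integral is
  \<open>m * (g y - g x)\<close>. A point of \<open>P\<close> inside the piece contributes
  \<open>- m * g t\<close> from its right and \<open>m * g t\<close> from its left, which cancel, so
  extra points in \<open>P\<close> are harmless. This freedom is used on the graph, where the points
  on one edge are dictated by the break points of the others.\<close>

lemma green_interval:
  assumes u: "piecewise_affine u a b" and g: "piecewise_poly g a b" and "a < b"
  obtains P0 where "finite P0"
    "\<And>P. finite P \<Longrightarrow> P0 \<inter> {a..b} \<subseteq> P \<Longrightarrow> integral {a..b} (\<lambda>t. deriv u t * deriv g t) =
       (\<Sum>t\<in>P \<inter> {a..<b}. g t * - vector_derivative u (at_right t)) +
       (\<Sum>t\<in>P \<inter> {a<..b}. g t * vector_derivative u (at_left t))"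
proof -
  obtain S where S: "finite S" "\<And>x y. a \<le> x \<and> x < y \<and> y \<le> b \<and> {x<..<y} \<inter> S = {} \<Longrightarrow>
           (\<exists>m c. \<forall>t\<in>{x..y}. u t = m * t + c)"
    using u unfolding piecewise_affine_def by blast
  let ?I = "\<lambda>x y. integral {x..y} (\<lambda>t. deriv u t * deriv g t)"
  let ?R = "\<lambda>P x y. (\<Sum>t\<in>P \<inter> {x..<y}. g t * - vector_derivative u (at_right t)) +
       (\<Sum>t\<in>P \<inter> {x<..y}. g t * vector_derivative u (at_left t))"
  have int: "(\<lambda>t. deriv u t * deriv g t) integrable_on {a..b}"
    using piecewise_poly_open_abs_integrable[OF piecewise_poly_open_mult[OF piecewise_poly_open_deriv[OF piecewise_affine_imp_poly[OF u]] piecewise_poly_open_deriv[OF g]] \<open>a < b\<close>]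
    by (rule set_lebesgue_integral_eq_integral(1))
  have "\<exists>P0. finite P0 \<and> (\<forall>P. finite P \<longrightarrow> P0 \<inter> {a..b} \<subseteq> P \<longrightarrow> ?I a b = ?R P a b)"
  proof (rule interval_pieces_induct[OF S(1) \<open>a < b\<close>])
    fix x y assume xy: "a \<le> x" "x < y" "y \<le> b" "{x<..<y} \<inter> S = {}"
    then obtain m c where mc: "\<And>t. t \<in> {x..y} \<Longrightarrow> u t = m * t + c" using S(2)[of x y] by metis
    have gxy: "piecewise_poly g x y"
      using g xy unfolding piecewise_poly_def by (meson order_trans)
    have du: "deriv u t = m" if "t \<in> {x<..<y}" for t
      using deriv_eq_poly_pderiv(2)[of x y u "[:c, m:]" t] that mc
      by (auto simp: algebra_simps pderiv_pCons)
    have "?I x y = integral {x..y} (\<lambda>t. m * deriv g t)"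
      by (rule integral_spike[where S="{x,y}"]) (use du in auto)
    also have "\<dots> = m * (g y - g x)"
      using has_integral_mult_right[OF piecewise_poly_FTC[OF gxy xy(2)], of m]
      by (rule integral_unique)
    finally have I: "?I x y = m * (g y - g x)" .
    have "?I x y = ?R P x y" if P: "finite P" "{x, y} \<inter> {x..y} \<subseteq> P" for P
    proof -
      have "(\<Sum>t\<in>P \<inter> {x..<y}. g t * - vector_derivative u (at_right t)) = (\<Sum>t\<in>P \<inter> {x..<y}. - m * g t)"
        by (rule sum.cong) (use has_vector_derivative_at_right_affine(2)[of x y u m c] mc in auto)
      also have "\<dots> = (\<Sum>t\<in>insert x (P \<inter> {x<..<y}). - m * g t)"
        by (rule sum.cong) (use P xy in auto)
      also have "\<dots> = - m * g x + (\<Sum>t\<in>P \<inter> {x<..<y}. - m * g t)"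
        using P by (subst sum.insert) auto
      finally have 1: "(\<Sum>t\<in>P \<inter> {x..<y}. g t * - vector_derivative u (at_right t)) = - m * g x + (\<Sum>t\<in>P \<inter> {x<..<y}. - m * g t)" .
      have "(\<Sum>t\<in>P \<inter> {x<..y}. g t * vector_derivative u (at_left t)) = (\<Sum>t\<in>P \<inter> {x<..y}. m * g t)"
        by (rule sum.cong) (use has_vector_derivative_at_left_affine(2)[of x y u m c] mc in auto)
      also have "\<dots> = (\<Sum>t\<in>insert y (P \<inter> {x<..<y}). m * g t)"
        by (rule sum.cong) (use P xy in auto)
      also have "\<dots> = m * g y + (\<Sum>t\<in>P \<inter> {x<..<y}. m * g t)"
        using P by (subst sum.insert) auto
      finally show ?thesis using 1 I by (simp add: sum_negf algebra_simps)
    qed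
    then show "\<exists>P0. finite P0 \<and> (\<forall>P. finite P \<longrightarrow> P0 \<inter> {x..y} \<subseteq> P \<longrightarrow> ?I x y = ?R P x y)"
      by (intro exI[of _ "{x, y}"]) auto
  next
    fix x c y assume xy: "a \<le> x" "x < c" "c < y" "y \<le> b"
      and "\<exists>P0. finite P0 \<and> (\<forall>P. finite P \<longrightarrow> P0 \<inter> {x..c} \<subseteq> P \<longrightarrow> ?I x c = ?R P x c)"
      and "\<exists>P0. finite P0 \<and> (\<forall>P. finite P \<longrightarrow> P0 \<inter> {c..y} \<subseteq> P \<longrightarrow> ?I c y = ?R P c y)"
    then obtain P1 P2 where P1: "finite P1" "\<And>P. finite P \<Longrightarrow> P1 \<inter> {x..c} \<subseteq> P \<Longrightarrow> ?I x c = ?R P x c"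
      and P2: "finite P2" "\<And>P. finite P \<Longrightarrow> P2 \<inter> {c..y} \<subseteq> P \<Longrightarrow> ?I c y = ?R P c y" by blast
    have "?I x y = ?R P x y" if P: "finite P" "(P1 \<union> P2) \<inter> {x..y} \<subseteq> P" for P
    proof -
      have "(\<lambda>t. deriv u t * deriv g t) integrable_on {x..y}"
        by (rule integrable_on_subinterval[OF int]) (use xy in auto)
      then have "?I x y = ?I x c + ?I c y"
        using Henstock_Kurzweil_Integration.integral_combine[of x c y "\<lambda>t. deriv u t * deriv g t"] xy
        by simp
      also have "\<dots> = ?R P x c + ?R P c y"
        using P1(2)[of P] P2(2)[of P] P xy by (simp add: subset_iff)
      also have "\<dots> = ?R P x y"
      proof -
        have "P \<inter> {x..<y} = (P \<inter> {x..<c}) \<union> (P \<inter> {c..<y})" "P \<inter> {x<..y} = (P \<inter> {x<..c}) \<union> (P \<inter> {c<..y})"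
          using xy by auto
        then show ?thesis using P(1)
          by (simp add: sum.union_disjoint disjoint_iff)
      qed
      finally show ?thesis .
    qed
    then show "\<exists>P0. finite P0 \<and> (\<forall>P. finite P \<longrightarrow> P0 \<inter> {x..y} \<subseteq> P \<longrightarrow> ?I x y = ?R P x y)"
      using P1(1) P2(1) by (intro exI[of _ "P1 \<union> P2"]) auto
  qed
  then show thesis using that by blast
qed

subsection \<open>The Dirichlet form\<close>

definition edgewise_poly :: "('a, 'e) mgraph \<Rightarrow> ('a \<Rightarrow> real) \<Rightarrow> bool" where
  "edgewise_poly G f \<longleftrightarrow> (\<forall>e\<in>edges G. piecewise_poly (\<lambda>t. f (emap G e t)) 0 (elen G e))"

text \<open>The weight \<open>k\<close> exists for the Leibniz rule, which moves a factor of an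
  argument into the weight. \<open>A_const\<close> is itself such a form, with the weight
  \<open>j_x(p,q)\<close>.\<close>

definition dirichlet :: "('a, 'e) mgraph \<Rightarrow> ('a \<Rightarrow> real) \<Rightarrow> ('a \<Rightarrow> real) \<Rightarrow> ('a \<Rightarrow> real) \<Rightarrow> real" where
  "dirichlet G k f g =
     graph_integral G (\<lambda>e t. k (emap G e t) * (edge_deriv G f e t * edge_deriv G g e t))"

abbreviation energy :: "('a, 'e) mgraph \<Rightarrow> ('a \<Rightarrow> real) \<Rightarrow> ('a \<Rightarrow> real) \<Rightarrow> real" where
  "energy G \<equiv> dirichlet G (\<lambda>_. 1)"

text \<open>What the form itself needs of a metrized graph. The combined edge family of two graphs
  has this property even when it is not a metrized graph.\<close>

definition edges_ok :: "('a, 'e) mgraph \<Rightarrow> bool" where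
  "edges_ok G \<longleftrightarrow> finite (edges G) \<and> (\<forall>e\<in>edges G. 0 < elen G e)"

lemma metrized_graphD:
  assumes "metrized_graph G"
  shows "finite (verts G)" "verts G \<noteq> {}" "finite (edges G)"
    "\<And>e. e \<in> edges G \<Longrightarrow> 0 < elen G e"
    "\<And>e. e \<in> edges G \<Longrightarrow> emap G e 0 \<in> verts G"
    "\<And>e. e \<in> edges G \<Longrightarrow> emap G e (elen G e) \<in> verts G"
    "\<And>e. e \<in> edges G \<Longrightarrow> inj_on (emap G e) {0<..<elen G e}"
    "\<And>e t. e \<in> edges G \<Longrightarrow> t \<in> {0<..<elen G e} \<Longrightarrow> emap G e t \<notin> verts G"
    "\<And>e e'. e \<in> edges G \<Longrightarrow> e' \<in> edges G \<Longrightarrow> e \<noteq> e' \<Longrightarrow>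
       emap G e ` {0<..<elen G e} \<inter> emap G e' ` {0<..<elen G e'} = {}"
    "\<And>u v. u \<in> verts G \<Longrightarrow> v \<in> verts G \<Longrightarrow> (u, v) \<in> (adjacent G \<union> (adjacent G)\<inverse>)\<^sup>*"
proof -
  show "emap G e t \<notin> verts G" if "e \<in> edges G" "t \<in> {0<..<elen G e}" for e t
  proof -
    have "emap G e ` {0<..<elen G e} \<inter> verts G = {}" using assms that by (simp add: metrized_graph_def)
    then show ?thesis using that(2) by blast
  qed
qed (use assms in \<open>simp_all add: metrized_graph_def\<close>)

lemma metrized_graph_edges_ok: "metrized_graph G \<Longrightarrow> edges_ok G"
  by (simp add: edges_ok_def metrized_graphD(3,4))

lemma emap_in_pts: "e \<in> edges G \<Longrightarrow> t \<in> {0..elen G e} \<Longrightarrow> emap G e t \<in> pts G"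
  unfolding pts_def by blast

lemma edgewise_poly_const: "edgewise_poly G (\<lambda>_. c)"
  unfolding edgewise_poly_def by (simp add: piecewise_poly_const)

lemma edgewise_poly_add: "edgewise_poly G f \<Longrightarrow> edgewise_poly G g \<Longrightarrow> edgewise_poly G (\<lambda>x. f x + g x)"
  unfolding edgewise_poly_def by (simp add: piecewise_poly_add)

lemma edgewise_poly_diff: "edgewise_poly G f \<Longrightarrow> edgewise_poly G g \<Longrightarrow> edgewise_poly G (\<lambda>x. f x - g x)"
  unfolding edgewise_poly_def by (simp add: piecewise_poly_diff)

lemma edgewise_poly_mult: "edgewise_poly G f \<Longrightarrow> edgewise_poly G g \<Longrightarrow> edgewise_poly G (\<lambda>x. f x * g x)"
  unfolding edgewise_poly_def by (simp add: piecewise_poly_mult)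

lemmas edgewise_poly_intros =
  edgewise_poly_const edgewise_poly_add edgewise_poly_diff edgewise_poly_mult

lemma edgewise_poly_cong:
  assumes "edgewise_poly G f" "\<And>x. x \<in> pts G \<Longrightarrow> g x = f x"
  shows "edgewise_poly G g"
  unfolding edgewise_poly_def
proof
  fix e assume e: "e \<in> edges G"
  show "piecewise_poly (\<lambda>t. g (emap G e t)) 0 (elen G e)"
    by (rule piecewise_poly_cong[of "\<lambda>t. f (emap G e t)"])
      (use e assms emap_in_pts[OF e] in \<open>auto simp: edgewise_poly_def\<close>)
qed

lemma dirichlet_integrand:
  assumes "edges_ok G" "edgewise_poly G k" "edgewise_poly G f" "edgewise_poly G g" "e \<in> edges G"
  shows "(\<lambda>t. k (emap G e t) * (edge_deriv G f e t * edge_deriv G g e t))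
           absolutely_integrable_on {0..elen G e}"
  using assms unfolding edgewise_poly_def edge_deriv_def edges_ok_def
  by (intro piecewise_poly_open_abs_integrable piecewise_poly_open_mult piecewise_poly_open_deriv
      piecewise_poly_imp_open) auto

lemmas dirichlet_integrable = set_lebesgue_integral_eq_integral(1)[OF dirichlet_integrand]

lemma dirichlet_sym: "dirichlet G k f g = dirichlet G k g f"
  unfolding dirichlet_def by (simp add: mult.commute)

text \<open>\<open>emap\<close> is unconstrained outside the edge interval, so agreement on
  \<open>pts G\<close> controls the derivatives at inner parameters only; the two ends are
  negligible for the integral.\<close>

lemma dirichlet_cong:
  assumes "\<And>x. x \<in> pts G \<Longrightarrow> k x = k' x" "\<And>x. x \<in> pts G \<Longrightarrow> f x = f' x"
    "\<And>x. x \<in> pts G \<Longrightarrow> g x = g' x"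
  shows "dirichlet G k f g = dirichlet G k' f' g'"
  unfolding dirichlet_def graph_integral_def
proof (rule sum.cong[OF refl])
  fix e assume e: "e \<in> edges G"
  have D: "edge_deriv G h e t = edge_deriv G h' e t"
    if "\<And>x. x \<in> pts G \<Longrightarrow> h x = h' x" "t \<in> {0<..<elen G e}" for h h' :: "_ \<Rightarrow> real" and t
  proof -
    have "eventually (\<lambda>s. s \<in> {0<..<elen G e}) (nhds t)"
      using that(2) by (intro eventually_nhds_in_open) auto
    then have "eventually (\<lambda>s. h (emap G e s) = h' (emap G e s)) (nhds t)"
      by eventually_elim (use that(1) emap_in_pts[OF e] in auto)
    then show ?thesis unfolding edge_deriv_def by (rule deriv_cong_ev) simp
  qed
  show "integral {0..elen G e} (\<lambda>t. k (emap G e t) * (edge_deriv G f e t * edge_deriv G g e t)) =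
    integral {0..elen G e} (\<lambda>t. k' (emap G e t) * (edge_deriv G f' e t * edge_deriv G g' e t))"
    by (rule integral_spike[where S="{0, elen G e}"])
      (use D[of f f'] D[of g g'] assms emap_in_pts[OF e] in auto)
qed

lemma dirichlet_weight_diff:
  assumes "edges_ok G" "edgewise_poly G k" "edgewise_poly G l" "edgewise_poly G f" "edgewise_poly G g"
  shows "dirichlet G (\<lambda>x. k x - l x) f g = dirichlet G k f g - dirichlet G l f g"
  unfolding dirichlet_def graph_integral_def sum_subtractf[symmetric]
  by (rule sum.cong[OF refl], subst Henstock_Kurzweil_Integration.integral_diff[symmetric])
    (use dirichlet_integrable[OF assms(1,2,4,5)] dirichlet_integrable[OF assms(1,3,4,5)]
      in \<open>auto simp: left_diff_distrib\<close>)

lemma dirichlet_weight_cmult: "dirichlet G (\<lambda>x. c * k x) f g = c * dirichlet G k f g"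
  unfolding dirichlet_def graph_integral_def sum_distrib_left by (simp add: mult.assoc)

lemma dirichlet_diff:
  assumes "edges_ok G" "edgewise_poly G k" "edgewise_poly G f" "edgewise_poly G g" "edgewise_poly G h"
  shows "dirichlet G k (\<lambda>x. f x - g x) h = dirichlet G k f h - dirichlet G k g h"
  unfolding dirichlet_def graph_integral_def sum_subtractf[symmetric]
proof (rule sum.cong[OF refl])
  fix e assume e: "e \<in> edges G"
  obtain S where S: "finite S" "\<And>t. t \<in> {0..elen G e} - S \<Longrightarrow>
      edge_deriv G (\<lambda>x. f x - g x) e t = edge_deriv G f e t - edge_deriv G g e t"
    unfolding edge_deriv_def
    by (rule piecewise_poly_deriv_diff[of "\<lambda>s. f (emap G e s)" 0 "elen G e" "\<lambda>s. g (emap G e s)"])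
      (use assms(3,4) e in \<open>auto simp: edgewise_poly_def\<close>)
  have "integral {0..elen G e} (\<lambda>t. k (emap G e t) * (edge_deriv G (\<lambda>x. f x - g x) e t * edge_deriv G h e t)) =
    integral {0..elen G e} (\<lambda>t. k (emap G e t) * (edge_deriv G f e t * edge_deriv G h e t) -
       k (emap G e t) * (edge_deriv G g e t * edge_deriv G h e t))"
    by (rule integral_spike[where S=S]) (use S in \<open>auto simp: left_diff_distrib right_diff_distrib\<close>)
  also have "\<dots> = integral {0..elen G e} (\<lambda>t. k (emap G e t) * (edge_deriv G f e t * edge_deriv G h e t)) -
    integral {0..elen G e} (\<lambda>t. k (emap G e t) * (edge_deriv G g e t * edge_deriv G h e t))"
    using assms e by (intro Henstock_Kurzweil_Integration.integral_diff dirichlet_integrable)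
  finally show "integral {0..elen G e} (\<lambda>t. k (emap G e t) * (edge_deriv G (\<lambda>x. f x - g x) e t * edge_deriv G h e t)) = \<dots>" .
qed

lemma dirichlet_mult:
  assumes "edges_ok G" "edgewise_poly G k" "edgewise_poly G f" "edgewise_poly G g" "edgewise_poly G h"
  shows "dirichlet G k (\<lambda>x. f x * g x) h =
    dirichlet G (\<lambda>x. k x * f x) g h + dirichlet G (\<lambda>x. k x * g x) f h"
  unfolding dirichlet_def graph_integral_def sum.distrib[symmetric]
proof (rule sum.cong[OF refl])
  fix e assume e: "e \<in> edges G"
  obtain S where S: "finite S" "\<And>t. t \<in> {0..elen G e} - S \<Longrightarrow>
      edge_deriv G (\<lambda>x. f x * g x) e t = f (emap G e t) * edge_deriv G g e t + g (emap G e t) * edge_deriv G f e t"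
    unfolding edge_deriv_def
    by (rule piecewise_poly_deriv_mult[of "\<lambda>s. f (emap G e s)" 0 "elen G e" "\<lambda>s. g (emap G e s)"])
      (use assms(3,4) e in \<open>auto simp: edgewise_poly_def\<close>)
  have "integral {0..elen G e} (\<lambda>t. k (emap G e t) * (edge_deriv G (\<lambda>x. f x * g x) e t * edge_deriv G h e t)) =
    integral {0..elen G e} (\<lambda>t. k (emap G e t) * f (emap G e t) * (edge_deriv G g e t * edge_deriv G h e t) +
       k (emap G e t) * g (emap G e t) * (edge_deriv G f e t * edge_deriv G h e t))"
    by (rule integral_spike[where S=S]) (use S in \<open>auto simp: algebra_simps\<close>)
  also have "\<dots> = integral {0..elen G e} (\<lambda>t. k (emap G e t) * f (emap G e t) * (edge_deriv G g e t * edge_deriv G h e t)) +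
    integral {0..elen G e} (\<lambda>t. k (emap G e t) * g (emap G e t) * (edge_deriv G f e t * edge_deriv G h e t))"
    using assms e by (intro Henstock_Kurzweil_Integration.integral_add dirichlet_integrable edgewise_poly_mult)
  finally show "integral {0..elen G e} (\<lambda>t. k (emap G e t) * (edge_deriv G (\<lambda>x. f x * g x) e t * edge_deriv G h e t)) = \<dots>" .
qed

lemma dirichlet_const_left: "dirichlet G k (\<lambda>x. c) h = 0"
  unfolding dirichlet_def graph_integral_def edge_deriv_def by simp

lemma dirichlet_cmult:
  assumes "edges_ok G" "edgewise_poly G k" "edgewise_poly G f" "edgewise_poly G h"
  shows "dirichlet G k (\<lambda>x. c * f x) h = c * dirichlet G k f h"
  using dirichlet_mult[OF assms(1,2) edgewise_poly_const assms(3,4), of c]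
    dirichlet_weight_cmult[of G c k f h] dirichlet_const_left
  by (simp add: mult.commute)

section \<open>Green's identity on a graph and uniqueness of potentials\<close>

lemma finite_emap_preimage:
  assumes "metrized_graph G" "e \<in> edges G" "finite W"
  shows "finite {t \<in> {0..elen G e}. emap G e t \<in> W}"
proof -
  have "inj_on (emap G e) {0<..<elen G e}" using metrized_graphD(7)[OF assms(1,2)] .
  then have "finite (emap G e -` W \<inter> {0<..<elen G e})" using assms(3) by (rule finite_vimage_IntI[rotated])
  moreover have "{t \<in> {0..elen G e}. emap G e t \<in> W} \<subseteq> {0, elen G e} \<union> (emap G e -` W \<inter> {0<..<elen G e})"
    by auto
  ultimately show ?thesis by (meson finite.emptyI finite.insertI finite_UnI finite_subset)
qed

text \<open>The boundary terms of the interval identity are regrouped by the point of the graph at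
  which they sit. The terms at \<open>w\<close> then add up to \<open>g w * outflow G u w\<close>,
  and the outflow is prescribed.\<close>

lemma green_graph:
  assumes G: "metrized_graph G" and pot: "potential G y z u" and y: "y \<in> pts G" and z: "z \<in> pts G"
    and g: "edgewise_poly G g"
  shows "energy G u g = g y - g z"
proof -
  have fin: "finite (edges G)" and pos: "\<And>e. e \<in> edges G \<Longrightarrow> 0 < elen G e"
    using metrized_graphD[OF G] by auto
  let ?R = "\<lambda>e P. (\<Sum>t\<in>P \<inter> {0..<elen G e}. g (emap G e t) * - vector_derivative (\<lambda>s. u (emap G e s)) (at_right t)) +
       (\<Sum>t\<in>P \<inter> {0<..elen G e}. g (emap G e t) * vector_derivative (\<lambda>s. u (emap G e s)) (at_left t))"
  have "\<exists>P0. finite P0 \<and> (\<forall>P. finite P \<longrightarrow> P0 \<inter> {0..elen G e} \<subseteq> P \<longrightarrow>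
      integral {0..elen G e} (\<lambda>t. edge_deriv G u e t * edge_deriv G g e t) = ?R e P)" if e: "e \<in> edges G" for e
  proof -
    have "piecewise_affine (\<lambda>s. u (emap G e s)) 0 (elen G e)" "piecewise_poly (\<lambda>s. g (emap G e s)) 0 (elen G e)"
      using pot g e unfolding potential_def edgewise_poly_def by auto
    then show ?thesis
      unfolding edge_deriv_def by (rule green_interval[OF _ _ pos[OF e]]) blast
  qed
  then have "\<forall>e\<in>edges G. \<exists>P0. finite P0 \<and> (\<forall>P. finite P \<longrightarrow> P0 \<inter> {0..elen G e} \<subseteq> P \<longrightarrow>
      integral {0..elen G e} (\<lambda>t. edge_deriv G u e t * edge_deriv G g e t) = ?R e P)" by (rule ballI)
  from bchoice[OF this] obtain P0 where P0: "\<And>e. e \<in> edges G \<Longrightarrow> finite (P0 e)"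
    "\<And>e P. e \<in> edges G \<Longrightarrow> finite P \<Longrightarrow> P0 e \<inter> {0..elen G e} \<subseteq> P \<Longrightarrow>
      integral {0..elen G e} (\<lambda>t. edge_deriv G u e t * edge_deriv G g e t) = ?R e P"
    by blast
  \<comment> \<open>Break points of one edge matter on every edge through the same point: only when
    \<open>P e\<close> is the full preimage of \<open>W\<close> does the sum at \<open>w\<close> run
    over all directions issuing from \<open>w\<close>, as \<open>outflow\<close> demands.\<close>
  define W where "W = {y, z} \<union> (\<Union>e\<in>edges G. emap G e ` (P0 e \<inter> {0..elen G e}))"
  have W: "finite W" "W \<subseteq> pts G"
    unfolding W_def using fin P0(1) y z emap_in_pts by fastforce+
  define P where "P = (\<lambda>e. {t \<in> {0..elen G e}. emap G e t \<in> W})"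
  have P: "finite (P e)" if "e \<in> edges G" for e
    unfolding P_def using finite_emap_preimage[OF G that W(1)] .
  let ?r = "\<lambda>w e. (\<Sum>t\<in>{t\<in>{0..<elen G e}. emap G e t = w}. - vector_derivative (\<lambda>s. u (emap G e s)) (at_right t))"
  let ?l = "\<lambda>w e. (\<Sum>t\<in>{t\<in>{0<..elen G e}. emap G e t = w}. vector_derivative (\<lambda>s. u (emap G e s)) (at_left t))"
  have R: "?R e (P e) = (\<Sum>w\<in>W. g w * (?r w e + ?l w e))" if e: "e \<in> edges G" for e
  proof -
    have "(\<Sum>t\<in>P e \<inter> {0..<elen G e}. g (emap G e t) * - vector_derivative (\<lambda>s. u (emap G e s)) (at_right t))
      = (\<Sum>w\<in>W. \<Sum>t\<in>{t \<in> P e \<inter> {0..<elen G e}. emap G e t = w}. g (emap G e t) * - vector_derivative (\<lambda>s. u (emap G e s)) (at_right t))"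
      by (rule sum.group[symmetric]) (use P[OF e] W(1) in \<open>auto simp: P_def\<close>)
    also have "\<dots> = (\<Sum>w\<in>W. g w * ?r w e)"
      unfolding sum_distrib_left by (intro sum.cong) (auto simp: P_def)
    finally have 1: "(\<Sum>t\<in>P e \<inter> {0..<elen G e}. g (emap G e t) * - vector_derivative (\<lambda>s. u (emap G e s)) (at_right t))
      = (\<Sum>w\<in>W. g w * ?r w e)" .
    have "(\<Sum>t\<in>P e \<inter> {0<..elen G e}. g (emap G e t) * vector_derivative (\<lambda>s. u (emap G e s)) (at_left t))
      = (\<Sum>w\<in>W. \<Sum>t\<in>{t \<in> P e \<inter> {0<..elen G e}. emap G e t = w}. g (emap G e t) * vector_derivative (\<lambda>s. u (emap G e s)) (at_left t))"
      by (rule sum.group[symmetric]) (use P[OF e] W(1) in \<open>auto simp: P_def\<close>)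
    also have "\<dots> = (\<Sum>w\<in>W. g w * ?l w e)"
      unfolding sum_distrib_left by (intro sum.cong) (auto simp: P_def)
    finally show ?thesis using 1 by (simp only: distrib_left sum.distrib)
  qed
  have "energy G u g = (\<Sum>e\<in>edges G. ?R e (P e))"
    unfolding dirichlet_def graph_integral_def
  proof (rule sum.cong[OF refl])
    fix e assume e: "e \<in> edges G"
    have "P0 e \<inter> {0..elen G e} \<subseteq> P e" unfolding P_def W_def using e by auto
    then show "integral {0..elen G e} (\<lambda>t. 1 * (edge_deriv G u e t * edge_deriv G g e t)) = ?R e (P e)"
      using P0(2)[OF e P[OF e]] by simp
  qed
  also have "\<dots> = (\<Sum>e\<in>edges G. \<Sum>w\<in>W. g w * (?r w e + ?l w e))" using R by simp
  also have "\<dots> = (\<Sum>w\<in>W. \<Sum>e\<in>edges G. g w * (?r w e + ?l w e))" by (rule sum.swap)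
  also have "\<dots> = (\<Sum>w\<in>W. g w * outflow G u w)"
    unfolding outflow_def by (simp only: sum_distrib_left)
  also have "\<dots> = (\<Sum>w\<in>W. g w * (of_bool (w = y) - of_bool (w = z)))"
    using pot W(2) unfolding potential_def by (intro sum.cong) auto
  also have "\<dots> = (\<Sum>w\<in>W. if w = y then g w else 0) - (\<Sum>w\<in>W. if w = z then g w else 0)"
    by (subst sum_subtractf[symmetric]) (rule sum.cong, auto)
  also have "\<dots> = g y - g z"
    using W(1) by (simp add: sum.delta) (simp add: W_def)
  finally show ?thesis .
qed

lemma energy_zero_imp_const:
  assumes G: "metrized_graph G" and f: "edgewise_poly G f" and zero: "energy G f f = 0"
    and x: "x \<in> pts G" and y: "y \<in> pts G"
  shows "f x = f y"
proof -
  have fin: "finite (edges G)" and pos: "\<And>e. e \<in> edges G \<Longrightarrow> 0 < elen G e"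
    using metrized_graphD[OF G] by auto
  let ?I = "\<lambda>e. integral {0..elen G e} (\<lambda>t. edge_deriv G f e t * edge_deriv G f e t)"
  \<comment> \<open>The index \<open>e\<close> is arbitrary, so integrability is not at hand; a
    non-integrable function has integral 0 by convention.\<close>
  have nn: "0 \<le> ?I e" for e
    by (cases "(\<lambda>t. edge_deriv G f e t * edge_deriv G f e t) integrable_on {0..elen G e}")
      (auto intro: Henstock_Kurzweil_Integration.integral_nonneg simp: not_integrable_integral)
  have "sum ?I (edges G) = 0" using zero unfolding dirichlet_def graph_integral_def by simp
  then have "?I e = 0" if "e \<in> edges G" for e
    using that nn sum_nonneg_eq_0_iff[OF fin, of ?I] by simp
  then have edge: "f (emap G e t) = f (emap G e 0)" if "e \<in> edges G" "t \<in> {0..elen G e}" for e t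
    using zero_energy_imp_const[of "\<lambda>s. f (emap G e s)" 0 "elen G e" t] that f pos
    unfolding edgewise_poly_def edge_deriv_def by auto
  have step: "f u = f v" if "(u, v) \<in> adjacent G \<union> (adjacent G)\<inverse>" for u v
  proof -
    have "f (emap G e (elen G e)) = f (emap G e 0)" if "e \<in> edges G" for e
      using edge[OF that, of "elen G e"] pos[OF that] by simp
    then show ?thesis using that by (auto simp: adjacent_def)
  qed
  have path: "f u = f v" if "(u, v) \<in> (adjacent G \<union> (adjacent G)\<inverse>)\<^sup>*" for u v
    using that
  proof (induction rule: rtrancl_induct)
    case (step v w)
    then show ?case using \<open>\<And>u v. (u, v) \<in> adjacent G \<union> (adjacent G)\<inverse> \<Longrightarrow> f u = f v\<close>[of v w] by simp
  qed simp
  have vx: "\<exists>v\<in>verts G. f x = f v" if "x \<in> pts G" for x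
    using that edge metrized_graphD(5)[OF G] unfolding pts_def by blast
  show ?thesis using vx[OF x] vx[OF y] path metrized_graphD(10)[OF G] by metis
qed

text \<open>Only integrals occur here, so the notion carries over to another parametrization of the
  same space. The class of test functions contains the resistance functions and all products needed
  later.\<close>

definition weak_potential :: "('a, 'e) mgraph \<Rightarrow> 'a \<Rightarrow> 'a \<Rightarrow> ('a \<Rightarrow> real) \<Rightarrow> bool" where
  "weak_potential G y z f \<longleftrightarrow>
     edgewise_poly G f \<and> (\<forall>g. edgewise_poly G g \<longrightarrow> energy G f g = g y - g z)"

lemma potential_imp_weak:
  assumes "metrized_graph G" "potential G y z u" "y \<in> pts G" "z \<in> pts G"
  shows "weak_potential G y z u"
proof -
  have "edgewise_poly G u"
    using assms(2) piecewise_affine_imp_poly unfolding potential_def edgewise_poly_def by blast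
  then show ?thesis
    unfolding weak_potential_def using green_graph[OF assms] by blast
qed

lemma weak_potential_unique:
  assumes G: "metrized_graph G" and f: "weak_potential G y z f" and g: "weak_potential G y z g"
    and x: "x \<in> pts G" "x' \<in> pts G"
  shows "f x - f x' = g x - g x'"
proof -
  let ?d = "\<lambda>x. f x - g x"
  have K: "edgewise_poly G f" "edgewise_poly G g" using f g unfolding weak_potential_def by auto
  then have d: "edgewise_poly G ?d" by (rule edgewise_poly_diff)
  have "energy G ?d ?d = energy G f ?d - energy G g ?d"
    using dirichlet_diff[OF metrized_graph_edges_ok[OF G] edgewise_poly_const K d] .
  also have "\<dots> = 0" using f g d unfolding weak_potential_def by simp
  finally have "?d x = ?d x'" using energy_zero_imp_const[OF G d _ x] by blast
  then show ?thesis by simp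
qed

lemma weak_potential_diff:
  assumes G: "metrized_graph G" and f: "weak_potential G y z f" and g: "weak_potential G x z g"
  shows "weak_potential G y x (\<lambda>w. f w - g w)"
proof -
  have K: "edgewise_poly G f" "edgewise_poly G g" using f g unfolding weak_potential_def by auto
  have "energy G (\<lambda>w. f w - g w) h = h y - h x" if h: "edgewise_poly G h" for h
    using dirichlet_diff[OF metrized_graph_edges_ok[OF G] edgewise_poly_const K h, of 1] f g h
    unfolding weak_potential_def by simp
  then show ?thesis unfolding weak_potential_def using edgewise_poly_diff[OF K] by blast
qed

subsection \<open>Unit flows in a finite network\<close>

text \<open>The weighted graph Laplacian, summed over edges of conductance \<open>c e\<close> from
  \<open>a e\<close> to \<open>b e\<close>, so that its value at \<open>w\<close> is the net current
  leaving \<open>w\<close>. Multiple edges add up, and a self-loop contributes 0.\<close>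

definition laplacian :: "'e set \<Rightarrow> ('e \<Rightarrow> 'a) \<Rightarrow> ('e \<Rightarrow> 'a) \<Rightarrow> ('e \<Rightarrow> real) \<Rightarrow> ('a \<Rightarrow> real) \<Rightarrow> 'a \<Rightarrow> real" where
  "laplacian E a b c f w =
     (\<Sum>e\<in>E. c e * (f (a e) - f (b e)) * (of_bool (w = a e) - of_bool (w = b e)))"

text \<open>By linearity this is an equivalence relation on vertices. Once it contains the ends of
  every edge, it contains every pair joined by a path, and no matrix has to be inverted.\<close>

definition unit_flow_solvable :: "'e set \<Rightarrow> ('e \<Rightarrow> 'a) \<Rightarrow> ('e \<Rightarrow> 'a) \<Rightarrow> ('e \<Rightarrow> real) \<Rightarrow> 'a \<Rightarrow> 'a \<Rightarrow> bool" where
  "unit_flow_solvable E a b c x y \<longleftrightarrow>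
     (\<exists>f. \<forall>w. laplacian E a b c f w = of_bool (w = x) - of_bool (w = y))"

lemma laplacian_add: "laplacian E a b c (\<lambda>v. f v + g v) w = laplacian E a b c f w + laplacian E a b c g w"
  unfolding laplacian_def sum.distrib[symmetric] by (rule sum.cong) (auto simp: algebra_simps)

lemma laplacian_cmult: "laplacian E a b c (\<lambda>v. k * f v) w = k * laplacian E a b c f w"
  unfolding laplacian_def sum_distrib_left by (rule sum.cong) (auto simp: algebra_simps)

lemma laplacian_const: "laplacian E a b c (\<lambda>v. k) w = 0"
  unfolding laplacian_def by simp

lemma unit_flow_solvable_refl: "unit_flow_solvable E a b c x x"
  unfolding unit_flow_solvable_def by (rule exI[of _ "\<lambda>_. 0"]) (simp add: laplacian_const)

lemma unit_flow_solvable_sym: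
  assumes "unit_flow_solvable E a b c x y"
  shows "unit_flow_solvable E a b c y x"
proof -
  obtain f where "\<forall>w. laplacian E a b c f w = of_bool (w = x) - of_bool (w = y)"
    using assms unfolding unit_flow_solvable_def by blast
  then show ?thesis
    unfolding unit_flow_solvable_def by (intro exI[of _ "\<lambda>v. -1 * f v"]) (simp only: laplacian_cmult, simp)
qed

lemma unit_flow_solvable_trans:
  assumes "unit_flow_solvable E a b c x y" "unit_flow_solvable E a b c y z"
  shows "unit_flow_solvable E a b c x z"
proof -
  obtain f where "\<forall>w. laplacian E a b c f w = of_bool (w = x) - of_bool (w = y)"
    using assms unfolding unit_flow_solvable_def by blast
  moreover obtain g where "\<forall>w. laplacian E a b c g w = of_bool (w = y) - of_bool (w = z)"
    using assms unfolding unit_flow_solvable_def by blast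
  ultimately show ?thesis
    unfolding unit_flow_solvable_def by (intro exI[of _ "\<lambda>v. f v + g v"]) (simp add: laplacian_add)
qed

text \<open>Discrete energy: paired with \<open>f\<close>, the Laplacian gives the drop
  \<open>f x - f y\<close> on one side and, after summation by parts, the sum of \<open>c e\<close>
  times the squared drop along \<open>e\<close> on the other.\<close>

lemma unit_flow_potential_drop_nonneg:
  assumes "finite E" "\<forall>e\<in>E. 0 < c e"
    and f: "\<And>w. laplacian E a b c f w = of_bool (w = x) - of_bool (w = y)"
  shows "0 \<le> f x - f y"
proof -
  define W where "W = {x, y} \<union> a ` E \<union> b ` E"
  have W: "finite W" "x \<in> W" "y \<in> W" "\<And>e. e \<in> E \<Longrightarrow> a e \<in> W \<and> b e \<in> W"
    unfolding W_def using assms(1) by auto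
  have delta: "(\<Sum>w\<in>W. f w * (of_bool (w = u) - of_bool (w = v))) = f u - f v" if "u \<in> W" "v \<in> W" for u v
  proof -
    have "(\<Sum>w\<in>W. f w * (of_bool (w = u) - of_bool (w = v))) =
      (\<Sum>w\<in>W. if w = u then f w else 0) - (\<Sum>w\<in>W. if w = v then f w else 0)"
      by (subst sum_subtractf[symmetric]) (rule sum.cong, auto)
    then show ?thesis using that W(1) by simp
  qed
  have "f x - f y = (\<Sum>w\<in>W. f w * laplacian E a b c f w)" using delta[of x y] W f by simp
  also have "\<dots> = (\<Sum>w\<in>W. \<Sum>e\<in>E. c e * (f (a e) - f (b e)) * (f w * (of_bool (w = a e) - of_bool (w = b e))))"
    unfolding laplacian_def sum_distrib_left by (intro sum.cong) (auto simp: mult_ac)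
  also have "\<dots> = (\<Sum>e\<in>E. c e * (f (a e) - f (b e)) * (\<Sum>w\<in>W. f w * (of_bool (w = a e) - of_bool (w = b e))))"
    by (subst sum.swap) (simp only: sum_distrib_left)
  also have "\<dots> = (\<Sum>e\<in>E. c e * ((f (a e) - f (b e)) * (f (a e) - f (b e))))"
    by (rule sum.cong) (use delta W in \<open>auto simp: mult.assoc\<close>)
  also have "\<dots> \<ge> 0" using assms(2) by (intro sum_nonneg) (auto simp: less_imp_le)
  finally show ?thesis .
qed

text \<open>Induction over the edges. A new edge \<open>e0\<close> either has both ends in one class
  of the old network or joins two classes. In both cases old solvable pairs remain solvable, and the
  ends of \<open>e0\<close> become solvable too.\<close>

lemma unit_flow_solvable_edge:
  assumes "finite E" "\<forall>e\<in>E. 0 < c e"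
  shows "\<forall>e\<in>E. unit_flow_solvable E a b c (a e) (b e)"
  using assms
proof (induction E rule: finite_induct)
  case (insert e0 E)
  let ?S = "unit_flow_solvable E a b c" and ?L = "laplacian E a b c"
  let ?d = "\<lambda>w. of_bool (w = a e0) - of_bool (w = b e0) :: real"
  have IH: "\<forall>e\<in>E. ?S (a e) (b e)" using insert by auto
  have k: "0 < c e0" using insert by auto
  have L: "laplacian (insert e0 E) a b c f w = c e0 * (f (a e0) - f (b e0)) * ?d w + ?L f w" for f w
    unfolding laplacian_def using insert.hyps by (subst sum.insert) auto
  show ?case
  proof (cases "?S (a e0) (b e0)")
    \<comment> \<open>Rank-one update: correct an old solution by a multiple of the unit flow between the ends of \<open>e0\<close>.\<close>
    case True
    then obtain f where f: "\<And>w. ?L f w = ?d w" unfolding unit_flow_solvable_def by blast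
    define r where "r = f (a e0) - f (b e0)"
    have r: "0 \<le> r"
      unfolding r_def using unit_flow_potential_drop_nonneg[of E c a b f] insert f by auto
    have "unit_flow_solvable (insert e0 E) a b c x y" if xy: "?S x y" for x y
    proof -
      obtain g where g: "\<And>w. ?L g w = of_bool (w = x) - of_bool (w = y)"
        using xy unfolding unit_flow_solvable_def by blast
      \<comment> \<open>In the enlarged network \<open>g\<close> sends the unwanted current
        \<open>c e0 * (g (a e0) - g (b e0))\<close> through \<open>e0\<close>. Adding
        \<open>s\<close> copies of \<open>f\<close> must cancel it, where one copy carries 1 through
        the old edges and \<open>c e0 * r\<close> through \<open>e0\<close>. Since \<open>r\<close>
        is nonnegative, the divisor is positive.\<close>
      define s where "s = - (c e0 * (g (a e0) - g (b e0)) / (1 + c e0 * r))"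
      have "1 + c e0 * r > 0" using r k by (simp add: add_pos_nonneg)
      then have s: "c e0 * (g (a e0) - g (b e0)) + s * (1 + c e0 * r) = 0" by (simp add: s_def)
      have "laplacian (insert e0 E) a b c (\<lambda>v. g v + s * f v) w = of_bool (w = x) - of_bool (w = y)" for w
      proof -
        have "laplacian (insert e0 E) a b c (\<lambda>v. g v + s * f v) w =
          c e0 * ((g (a e0) + s * f (a e0)) - (g (b e0) + s * f (b e0))) * ?d w + (of_bool (w = x) - of_bool (w = y) + s * ?d w)"
          unfolding L[of "\<lambda>v. g v + s * f v"] unfolding laplacian_add laplacian_cmult f g ..
        also have "\<dots> = (c e0 * (g (a e0) - g (b e0)) + s * (1 + c e0 * r)) * ?d w + (of_bool (w = x) - of_bool (w = y))"
          unfolding r_def by (simp add: algebra_simps)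
        finally show ?thesis unfolding s by simp
      qed
      then show ?thesis unfolding unit_flow_solvable_def by blast
    qed
    then show ?thesis using IH True by blast
  next
    \<comment> \<open>Here \<open>e0\<close> is a bridge, and the indicator \<open>h\<close> of one side is harmonic for the old edges.\<close>
    case False
    define h where "h = (\<lambda>v. of_bool (?S (a e0) v) :: real)"
    have h: "h (a e0) = 1" "h (b e0) = 0" unfolding h_def using unit_flow_solvable_refl False by auto
    have "?S (a e0) (a e) \<longleftrightarrow> ?S (a e0) (b e)" if "e \<in> E" for e
      using that IH unit_flow_solvable_trans unit_flow_solvable_sym by metis
    then have Lh: "?L h w = 0" for w unfolding laplacian_def h_def by (intro sum.neutral) auto
    have "laplacian (insert e0 E) a b c (\<lambda>v. 1 / c e0 * h v) w = ?d w" for w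
      unfolding L[of "\<lambda>v. 1 / c e0 * h v"] unfolding laplacian_cmult Lh h using k by simp
    then have "unit_flow_solvable (insert e0 E) a b c (a e0) (b e0)"
      unfolding unit_flow_solvable_def by blast
    moreover have "unit_flow_solvable (insert e0 E) a b c x y" if xy: "?S x y" for x y
    proof -
      obtain g where g: "\<And>w. ?L g w = of_bool (w = x) - of_bool (w = y)"
        using xy unfolding unit_flow_solvable_def by blast
      \<comment> \<open>The multiple of \<open>h\<close> shifts one side of the bridge until both
        ends of \<open>e0\<close> have equal potential, so no current crosses it.\<close>
      have "laplacian (insert e0 E) a b c (\<lambda>v. g v + (g (b e0) - g (a e0)) * h v) w =
          of_bool (w = x) - of_bool (w = y)" for w
        unfolding L[of "\<lambda>v. g v + (g (b e0) - g (a e0)) * h v"] unfolding laplacian_add laplacian_cmult Lh h g by simp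
      then show ?thesis
        unfolding unit_flow_solvable_def by blast
    qed
    ultimately show ?thesis using IH by blast
  qed
qed simp

subsection \<open>Existence of potentials\<close>

definition vertex_laplacian :: "('a, 'e) mgraph \<Rightarrow> ('a \<Rightarrow> real) \<Rightarrow> 'a \<Rightarrow> real" where
  "vertex_laplacian G =
     laplacian (edges G) (\<lambda>e. emap G e 0) (\<lambda>e. emap G e (elen G e)) (\<lambda>e. 1 / elen G e)"

lemma vertex_laplacian_solvable:
  assumes G: "metrized_graph G" and "x \<in> verts G" "y \<in> verts G"
  obtains f where "f y = 0" "\<And>w. vertex_laplacian G f w = of_bool (w = x) - of_bool (w = y)"
proof -
  let ?S = "unit_flow_solvable (edges G) (\<lambda>e. emap G e 0) (\<lambda>e. emap G e (elen G e)) (\<lambda>e. 1 / elen G e)"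
  have edge: "\<forall>e\<in>edges G. ?S (emap G e 0) (emap G e (elen G e))"
    using unit_flow_solvable_edge[of "edges G" "\<lambda>e. 1 / elen G e" "\<lambda>e. emap G e 0" "\<lambda>e. emap G e (elen G e)"]
    by (simp add: metrized_graphD(3,4)[OF G])
  have adj: "?S u v" if "(u, v) \<in> adjacent G \<union> (adjacent G)\<inverse>" for u v
    using that edge by (auto simp: adjacent_def intro: unit_flow_solvable_sym)
  have path: "?S u v" if "(u, v) \<in> (adjacent G \<union> (adjacent G)\<inverse>)\<^sup>*" for u v
    using that
  proof (induction rule: rtrancl_induct)
    case base
    show ?case by (rule unit_flow_solvable_refl)
  next
    case (step v w)
    show ?case by (rule unit_flow_solvable_trans[OF step.IH adj[OF step.hyps(2)]])
  qed
  have "?S x y" by (rule path) (rule metrized_graphD(10)[OF assms])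
  then obtain g where g: "\<And>w. vertex_laplacian G g w = of_bool (w = x) - of_bool (w = y)"
    unfolding unit_flow_solvable_def vertex_laplacian_def by blast
  have "vertex_laplacian G (\<lambda>v. g v + - g y) w = vertex_laplacian G g w" for w
    unfolding vertex_laplacian_def laplacian_add laplacian_const by simp
  then show thesis using that[of "\<lambda>v. g v + - g y"] g by simp
qed

section \<open>Functions on the graph built edge by edge\<close>

lemma emap_inner_unique:
  assumes G: "metrized_graph G" and "e \<in> edges G" "e' \<in> edges G" "t \<in> {0..elen G e}" "t' \<in> {0..elen G e'}"
    and eq: "emap G e t = emap G e' t'" and nv: "emap G e t \<notin> verts G"
  shows "e = e'" "t = t'" "t \<in> {0<..<elen G e}"
proof -
  have t: "t \<in> {0<..<elen G e}"
    using metrized_graphD(5,6)[OF G \<open>e \<in> edges G\<close>] nv assms(4) by (cases "t = 0"; cases "t = elen G e") auto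
  have t': "t' \<in> {0<..<elen G e'}"
    using metrized_graphD(5,6)[OF G \<open>e' \<in> edges G\<close>] nv eq assms(5) by (cases "t' = 0"; cases "t' = elen G e'") auto
  show e: "e = e'" using metrized_graphD(9)[OF G assms(2,3)] t t' eq by blast
  show "t = t'" using metrized_graphD(7)[OF G assms(2)] t t' eq e by (auto dest: inj_onD)
  show "t \<in> {0<..<elen G e}" by (fact t)
qed

text \<open>Only vertices have several edge coordinates, and there the \<open>h e\<close> agree with
  \<open>f\<close>. At every other point the coordinate chosen by \<open>SOME\<close> is the only
  one.\<close>

lemma glue_edge_functions:
  fixes f :: "'a \<Rightarrow> real" and h :: "'e \<Rightarrow> real \<Rightarrow> real"
  assumes G: "metrized_graph (G :: ('a, 'e) mgraph)"
    and "\<And>e. e \<in> edges G \<Longrightarrow> h e 0 = f (emap G e 0)"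
    and "\<And>e. e \<in> edges G \<Longrightarrow> h e (elen G e) = f (emap G e (elen G e))"
  obtains F where "\<And>v. v \<in> verts G \<Longrightarrow> F v = f v"
    "\<And>e t. e \<in> edges G \<Longrightarrow> t \<in> {0..elen G e} \<Longrightarrow> F (emap G e t) = h e t"
proof -
  define F where "F = (\<lambda>x. if x \<in> verts G then f x else
    case (SOME (e, t). e \<in> edges G \<and> t \<in> {0..elen G e} \<and> x = emap G e t) of (e, t) \<Rightarrow> h e t)"
  have "F (emap G e t) = h e t" if e: "e \<in> edges G" and t: "t \<in> {0..elen G e}" for e t
  proof (cases "emap G e t \<in> verts G")
    case True
    then have "t = 0 \<or> t = elen G e" using metrized_graphD(8)[OF G e, of t] t by fastforce
    then show ?thesis using True assms(2,3)[OF e] by (auto simp: F_def)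
  next
    case False
    let ?P = "\<lambda>p. case p of (e', t') \<Rightarrow> e' \<in> edges G \<and> t' \<in> {0..elen G e'} \<and> emap G e t = emap G e' t'"
    have "?P (Eps ?P)" by (rule someI[of ?P "(e, t)"]) (use e t in auto)
    moreover obtain e' t' where et: "Eps ?P = (e', t')" by force
    ultimately have "e' = e" "t' = t"
      using emap_inner_unique(1,2)[OF G e _ t _ _ False, of e' t'] by auto
    then show ?thesis using False et by (simp add: F_def)
  qed
  then show thesis using that[of F] by (simp add: F_def)
qed

text \<open>At an inner parameter the two directions cancel unless it is the kink \<open>t0\<close>,
  where the left slope is \<open>m1\<close> and the right slope is \<open>m2\<close>. Each end of
  the edge contributes a single direction.\<close>

lemma broken_line_edge_outflow:
  assumes G: "metrized_graph G" and e: "e \<in> edges G" and t0: "t0 \<in> {0<..<elen G e}"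
    and m1: "\<And>t. t \<in> {0..t0} \<Longrightarrow> F (emap G e t) = m1 * t + c1"
    and m2: "\<And>t. t \<in> {t0..elen G e} \<Longrightarrow> F (emap G e t) = m2 * t + c2"
  shows "(\<Sum>t\<in>{t\<in>{0..<elen G e}. emap G e t = w}. - vector_derivative (\<lambda>s. F (emap G e s)) (at_right t)) +
         (\<Sum>t\<in>{t\<in>{0<..elen G e}. emap G e t = w}. vector_derivative (\<lambda>s. F (emap G e s)) (at_left t))
       = m2 * of_bool (w = emap G e (elen G e)) - m1 * of_bool (w = emap G e 0) + (m1 - m2) * of_bool (w = emap G e t0)"
proof -
  let ?L = "elen G e" and ?u = "\<lambda>s. F (emap G e s)"
  have R: "vector_derivative ?u (at_right t) = (if t < t0 then m1 else m2)" if "t \<in> {0..<?L}" for t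
    using has_vector_derivative_at_right_affine(2)[of 0 t0 ?u m1 c1 t]
      has_vector_derivative_at_right_affine(2)[of t0 ?L ?u m2 c2 t] m1 m2 that t0 by auto
  have L: "vector_derivative ?u (at_left t) = (if t \<le> t0 then m1 else m2)" if "t \<in> {0<..?L}" for t
    using has_vector_derivative_at_left_affine(2)[of 0 t0 ?u m1 c1 t]
      has_vector_derivative_at_left_affine(2)[of t0 ?L ?u m2 c2 t] m1 m2 that t0 by auto
  define A where "A = {t\<in>{0<..<?L}. emap G e t = w}"
  have "A \<subseteq> {t \<in> {0..?L}. emap G e t \<in> {w}}" unfolding A_def by auto
  then have A: "finite A" using finite_emap_preimage[OF G e, of "{w}"] finite_subset by blast
  have S1: "{t\<in>{0..<?L}. emap G e t = w} = (if w = emap G e 0 then insert 0 A else A)"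
    using t0 by (auto simp: A_def order_le_less)
  have S2: "{t\<in>{0<..?L}. emap G e t = w} = (if w = emap G e ?L then insert ?L A else A)"
    using t0 by (auto simp: A_def order_le_less)
  have "(\<Sum>t\<in>{t\<in>{0..<?L}. emap G e t = w}. - vector_derivative ?u (at_right t))
    = (\<Sum>t\<in>(if w = emap G e 0 then insert 0 A else A). - (if t < t0 then m1 else m2))"
    by (rule sum.cong[OF S1]) (use R t0 in \<open>auto simp: A_def split: if_splits\<close>)
  also have "\<dots> = - m1 * of_bool (w = emap G e 0) + (\<Sum>t\<in>A. - (if t < t0 then m1 else m2))"
  proof -
    have "0 \<notin> A" by (simp add: A_def)
    then show ?thesis using A t0 by simp
  qed
  finally have 1: "(\<Sum>t\<in>{t\<in>{0..<?L}. emap G e t = w}. - vector_derivative ?u (at_right t)) =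
    - m1 * of_bool (w = emap G e 0) + (\<Sum>t\<in>A. - (if t < t0 then m1 else m2))" .
  have "(\<Sum>t\<in>{t\<in>{0<..?L}. emap G e t = w}. vector_derivative ?u (at_left t))
    = (\<Sum>t\<in>(if w = emap G e ?L then insert ?L A else A). (if t \<le> t0 then m1 else m2))"
    by (rule sum.cong[OF S2]) (use L t0 in \<open>auto simp: A_def split: if_splits\<close>)
  also have "\<dots> = m2 * of_bool (w = emap G e ?L) + (\<Sum>t\<in>A. (if t \<le> t0 then m1 else m2))"
  proof -
    have "?L \<notin> A" by (simp add: A_def)
    then show ?thesis using A t0 by simp
  qed
  finally have 2: "(\<Sum>t\<in>{t\<in>{0<..?L}. emap G e t = w}. vector_derivative ?u (at_left t)) =
    m2 * of_bool (w = emap G e ?L) + (\<Sum>t\<in>A. (if t \<le> t0 then m1 else m2))" .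
  have "(\<Sum>t\<in>A. - (if t < t0 then m1 else m2)) + (\<Sum>t\<in>A. (if t \<le> t0 then m1 else m2))
    = (\<Sum>t\<in>A. if t = t0 then m1 - m2 else 0)"
    unfolding sum.distrib[symmetric] by (rule sum.cong) auto
  also have "\<dots> = (m1 - m2) * of_bool (w = emap G e t0)"
    using A t0 by (auto simp: A_def)
  finally show ?thesis using 1 2 by simp
qed

lemma piecewise_affine_two_pieces:
  assumes "\<And>t. t \<in> {a..t0} \<Longrightarrow> g t = m1 * t + c1" "\<And>t. t \<in> {t0..b} \<Longrightarrow> g t = m2 * t + c2"
  shows "piecewise_affine g a b"
proof -
  have "\<exists>m c. \<forall>t\<in>{u..v}. g t = m * t + c" if "a \<le> u" "u < v" "v \<le> b" "{u<..<v} \<inter> {t0} = {}" for u v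
  proof -
    consider "v \<le> t0" | "t0 \<le> u" using \<open>{u<..<v} \<inter> {t0} = {}\<close> by fastforce
    then show ?thesis
    proof cases
      case 1
      then show ?thesis using assms(1) that by (intro exI[of _ m1] exI[of _ c1]) auto
    next
      case 2
      then show ?thesis using assms(2) that by (intro exI[of _ m2] exI[of _ c2]) auto
    qed
  qed
  then show ?thesis unfolding piecewise_affine_def by (intro exI[of _ "{t0}"]) auto
qed

text \<open>On each edge \<open>f\<close> is interpolated linearly, and \<open>k e\<close> times the
  Green function of the interval with source at \<open>s e\<close> is added. This tent vanishes at
  both ends and has slopes \<open>1 - s e / elen G e\<close> and \<open>- s e / elen G e\<close>: a
  unit current entering at \<open>s e\<close> leaves at the two ends in these proportions.\<close>

lemma tent_extension:
  fixes f :: "'a \<Rightarrow> real" and k s :: "'e \<Rightarrow> real"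
  assumes G: "metrized_graph (G :: ('a, 'e) mgraph)"
    and s: "\<And>e. e \<in> edges G \<Longrightarrow> s e \<in> {0<..<elen G e}"
  obtains F where "\<And>v. v \<in> verts G \<Longrightarrow> F v = f v"
    "\<And>e. e \<in> edges G \<Longrightarrow> piecewise_affine (\<lambda>t. F (emap G e t)) 0 (elen G e)"
    "\<And>e. e \<in> edges G \<Longrightarrow> F (emap G e (s e)) =
      (1 - s e / elen G e) * f (emap G e 0) + s e / elen G e * f (emap G e (elen G e)) +
      k e * (s e * (elen G e - s e) / elen G e)"
    "\<And>w. outflow G F w = vertex_laplacian G f w +
      (\<Sum>e\<in>edges G. k e * (of_bool (w = emap G e (s e)) - (1 - s e / elen G e) * of_bool (w = emap G e 0)
          - s e / elen G e * of_bool (w = emap G e (elen G e))))"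
proof -
  define m where "m = (\<lambda>e. (f (emap G e (elen G e)) - f (emap G e 0)) / elen G e)"
  define h where "h = (\<lambda>e t. f (emap G e 0) + m e * t +
    k e * (if t \<le> s e then t * (1 - s e / elen G e) else s e - s e / elen G e * t))"
  have pos: "0 < elen G e" if "e \<in> edges G" for e using metrized_graphD(4)[OF G that] .
  obtain F where F: "\<And>v. v \<in> verts G \<Longrightarrow> F v = f v"
    "\<And>e t. e \<in> edges G \<Longrightarrow> t \<in> {0..elen G e} \<Longrightarrow> F (emap G e t) = h e t"
  proof (rule glue_edge_functions[OF G, of h f])
    fix e assume e: "e \<in> edges G"
    show "h e 0 = f (emap G e 0)" using s[OF e] by (simp add: h_def)
    show "h e (elen G e) = f (emap G e (elen G e))" using s[OF e] pos[OF e] by (simp add: h_def m_def)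
  qed blast
  have F1: "F (emap G e t) = (m e + k e * (1 - s e / elen G e)) * t + f (emap G e 0)"
    if "e \<in> edges G" "t \<in> {0..s e}" for e t
    using F(2)[of e t] that s[of e] by (auto simp: h_def algebra_simps)
  have F2: "F (emap G e t) = (m e - k e * (s e / elen G e)) * t + (f (emap G e 0) + k e * s e)"
    if "e \<in> edges G" "t \<in> {s e..elen G e}" for e t
  proof -
    have "F (emap G e t) = h e t" using F(2)[of e t] that s[of e] by auto
    also have "\<dots> = f (emap G e 0) + m e * t + k e * (s e - s e / elen G e * t)"
      using that by (cases "t = s e") (auto simp: h_def algebra_simps)
    finally show ?thesis by (simp add: algebra_simps)
  qed
  show thesis
  proof (rule that[of F])
    fix e assume e: "e \<in> edges G"
    show "piecewise_affine (\<lambda>t. F (emap G e t)) 0 (elen G e)"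
      by (rule piecewise_affine_two_pieces[OF F1[OF e] F2[OF e]])
    show "F (emap G e (s e)) =
      (1 - s e / elen G e) * f (emap G e 0) + s e / elen G e * f (emap G e (elen G e)) +
      k e * (s e * (elen G e - s e) / elen G e)"
      using F1[OF e, of "s e"] s[OF e] pos[OF e] by (simp add: m_def field_simps)
  next
    fix w
    show "outflow G F w = vertex_laplacian G f w +
      (\<Sum>e\<in>edges G. k e * (of_bool (w = emap G e (s e)) - (1 - s e / elen G e) * of_bool (w = emap G e 0)
          - s e / elen G e * of_bool (w = emap G e (elen G e))))"
      unfolding outflow_def vertex_laplacian_def laplacian_def sum.distrib[symmetric]
    proof (rule sum.cong[OF refl])
      fix e assume e: "e \<in> edges G"
      have ring: "(m - k * r) * B - (m + k * (1 - r)) * A + (m + k * (1 - r) - (m - k * r)) * C =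
        - m * (A - B) + k * (C - (1 - r) * A - r * B)" for m k r A B C :: real
        by (simp add: algebra_simps)
      have sl: "1 / elen G e * (f (emap G e 0) - f (emap G e (elen G e))) = - m e"
        unfolding m_def using pos[OF e] by (simp add: field_simps)
      show "(\<Sum>t\<in>{t\<in>{0..<elen G e}. emap G e t = w}. - vector_derivative (\<lambda>s. F (emap G e s)) (at_right t)) +
         (\<Sum>t\<in>{t\<in>{0<..elen G e}. emap G e t = w}. vector_derivative (\<lambda>s. F (emap G e s)) (at_left t)) =
        1 / elen G e * (f (emap G e 0) - f (emap G e (elen G e))) *
           (of_bool (w = emap G e 0) - of_bool (w = emap G e (elen G e))) +
        k e * (of_bool (w = emap G e (s e)) - (1 - s e / elen G e) * of_bool (w = emap G e 0)
          - s e / elen G e * of_bool (w = emap G e (elen G e)))"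
        by (rule trans[OF broken_line_edge_outflow[OF G e s[OF e] F1[OF e] F2[OF e]]], unfold sl)
          (assumption | rule ring)+
    qed
  qed (use F(1) in auto)
qed

text \<open>The value of the potential at its own source is recorded because it is the resistance to
  \<open>v\<close>; its explicit form shows that it is a polynomial in \<open>t\<close>.\<close>

lemma potential_to_vertex:
  assumes G: "metrized_graph G" and v: "v \<in> verts G"
    and \<phi>: "\<And>a. a \<in> verts G \<Longrightarrow> \<phi> a v = 0"
      "\<And>a w. a \<in> verts G \<Longrightarrow> vertex_laplacian G (\<phi> a) w = of_bool (w = a) - of_bool (w = v)"
  shows "\<And>a. a \<in> verts G \<Longrightarrow> \<exists>F. potential G a v F \<and> F v = 0 \<and> F a = \<phi> a a"
    and "\<And>e t. e \<in> edges G \<Longrightarrow> t \<in> {0..elen G e} \<Longrightarrow>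
      \<exists>F. potential G (emap G e t) v F \<and> F v = 0 \<and>
        F (emap G e t) = (let a = emap G e 0; b = emap G e (elen G e); r = t / elen G e in
           (1 - r) * ((1 - r) * \<phi> a a + r * \<phi> b a) + r * ((1 - r) * \<phi> a b + r * \<phi> b b) + t * (1 - r))"
proof -
  have pos: "0 < elen G e" if "e \<in> edges G" for e using metrized_graphD(4)[OF G that] .
  show vertex: "\<exists>F. potential G a v F \<and> F v = 0 \<and> F a = \<phi> a a" if a: "a \<in> verts G" for a
  proof -
    obtain F where F: "\<And>v. v \<in> verts G \<Longrightarrow> F v = \<phi> a v"
      "\<And>e. e \<in> edges G \<Longrightarrow> piecewise_affine (\<lambda>t. F (emap G e t)) 0 (elen G e)"
      "\<And>w. outflow G F w = vertex_laplacian G (\<phi> a) w + (\<Sum>e\<in>edges G. 0 *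
        (of_bool (w = emap G e (elen G e / 2)) - (1 - elen G e / 2 / elen G e) * of_bool (w = emap G e 0)
          - elen G e / 2 / elen G e * of_bool (w = emap G e (elen G e))))"
    \<comment> \<open>With height 0 there is no tent, and the midpoints are mere
      placeholders.\<close>
    proof (rule tent_extension[OF G, of "\<lambda>e. elen G e / 2" "\<phi> a" "\<lambda>_. 0"])
      show "elen G e / 2 \<in> {0<..<elen G e}" if "e \<in> edges G" for e using pos[OF that] by simp
    qed blast
    then show ?thesis using a v \<phi> by (intro exI[of _ F]) (simp add: potential_def)
  qed
  fix e t assume e: "e \<in> edges G" and t: "t \<in> {0..elen G e}"
  define a b r where "a = emap G e 0" and "b = emap G e (elen G e)" and "r = t / elen G e"
  have ab: "a \<in> verts G" "b \<in> verts G" unfolding a_def b_def using metrized_graphD(5,6)[OF G e] by auto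
  consider "t = 0" | "t = elen G e" | "t \<in> {0<..<elen G e}" using t by fastforce
  then have "\<exists>F. potential G (emap G e t) v F \<and> F v = 0 \<and>
        F (emap G e t) = (1 - r) * ((1 - r) * \<phi> a a + r * \<phi> b a) + r * ((1 - r) * \<phi> a b + r * \<phi> b b) + t * (1 - r)"
  proof cases
    case 1
    then show ?thesis using vertex[OF ab(1)] by (simp add: r_def a_def)
  next
    case 2
    then show ?thesis using vertex[OF ab(2)] pos[OF e] by (simp add: r_def b_def)
  next
    case 3
    \<comment> \<open>The tent at \<open>t\<close> drains \<open>1 - r\<close> at \<open>a\<close>
      and \<open>r\<close> at \<open>b\<close>. The network solution \<open>f\<close> injects
      exactly these amounts again and carries all of it to \<open>v\<close>.\<close>
    define f where "f = (\<lambda>w. (1 - r) * \<phi> a w + r * \<phi> b w)"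
    define s where "s = (\<lambda>e'. if e' = e then t else elen G e' / 2)"
    obtain F where F: "\<And>v. v \<in> verts G \<Longrightarrow> F v = f v"
      "\<And>e. e \<in> edges G \<Longrightarrow> piecewise_affine (\<lambda>t. F (emap G e t)) 0 (elen G e)"
      "\<And>e'. e' \<in> edges G \<Longrightarrow> F (emap G e' (s e')) =
        (1 - s e' / elen G e') * f (emap G e' 0) + s e' / elen G e' * f (emap G e' (elen G e')) +
        of_bool (e' = e) * (s e' * (elen G e' - s e') / elen G e')"
      "\<And>w. outflow G F w = vertex_laplacian G f w +
        (\<Sum>e'\<in>edges G. of_bool (e' = e) * (of_bool (w = emap G e' (s e')) - (1 - s e' / elen G e') * of_bool (w = emap G e' 0)
            - s e' / elen G e' * of_bool (w = emap G e' (elen G e'))))"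
    proof (rule tent_extension[OF G, of s f "\<lambda>e'. of_bool (e' = e)"])
      show "s e' \<in> {0<..<elen G e'}" if "e' \<in> edges G" for e' using pos[OF that] 3 by (simp add: s_def)
    qed blast
    have Fe: "F (emap G e t) = (1 - r) * f a + r * f b + t * (1 - r)"
      using F(3)[OF e] pos[OF e] by (simp add: s_def a_def b_def r_def field_simps)
    have "outflow G F w = of_bool (w = emap G e t) - of_bool (w = v)" for w
    proof -
      have "(\<Sum>e'\<in>edges G. of_bool (e' = e) * (of_bool (w = emap G e' (s e')) - (1 - s e' / elen G e') * of_bool (w = emap G e' 0)
            - s e' / elen G e' * of_bool (w = emap G e' (elen G e')))) =
        (\<Sum>e'\<in>edges G. if e' = e then of_bool (w = emap G e t) - (1 - r) * of_bool (w = a)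
            - r * of_bool (w = b) else 0)"
        by (rule sum.cong) (auto simp: s_def a_def b_def r_def)
      also have "\<dots> = of_bool (w = emap G e t) - (1 - r) * of_bool (w = a) - r * of_bool (w = b)"
        using e metrized_graphD(3)[OF G] by simp
      finally have "outflow G F w = vertex_laplacian G f w + (of_bool (w = emap G e t) - (1 - r) * of_bool (w = a) - r * of_bool (w = b))"
        using F(4) by simp
      moreover have "vertex_laplacian G f w = (1 - r) * (of_bool (w = a) - of_bool (w = v)) + r * (of_bool (w = b) - of_bool (w = v))"
        unfolding f_def vertex_laplacian_def laplacian_add laplacian_cmult
        unfolding vertex_laplacian_def[symmetric] using \<phi>(2) ab by simp
      ultimately show ?thesis by (simp add: algebra_simps)
    qed
    then have "potential G (emap G e t) v F" using F(2) by (simp add: potential_def)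
    moreover have "F v = 0" using F(1)[OF v] \<phi>(1)[OF ab(1)] \<phi>(1)[OF ab(2)] by (simp add: f_def)
    ultimately show ?thesis using Fe by (intro exI[of _ F]) (simp add: f_def)
  qed
  then show "\<exists>F. potential G (emap G e t) v F \<and> F v = 0 \<and>
        F (emap G e t) = (let a = emap G e 0; b = emap G e (elen G e); r = t / elen G e in
           (1 - r) * ((1 - r) * \<phi> a a + r * \<phi> b a) + r * ((1 - r) * \<phi> a b + r * \<phi> b b) + t * (1 - r))"
    by (simp add: Let_def a_def b_def r_def)
qed

section \<open>Linearity of the outflow, and potentials between arbitrary points\<close>

lemma piecewise_affine_diff:
  assumes "piecewise_affine f a b" "piecewise_affine g a b"
  shows "piecewise_affine (\<lambda>t. f t - g t) a b"
proof -
  obtain S where S: "finite S" "\<And>u v. a \<le> u \<and> u < v \<and> v \<le> b \<and> {u<..<v} \<inter> S = {} \<Longrightarrow>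
           (\<exists>m c. \<forall>t\<in>{u..v}. f t = m * t + c)"
    using assms(1) unfolding piecewise_affine_def by blast
  obtain S' where S': "finite S'" "\<And>u v. a \<le> u \<and> u < v \<and> v \<le> b \<and> {u<..<v} \<inter> S' = {} \<Longrightarrow>
           (\<exists>m c. \<forall>t\<in>{u..v}. g t = m * t + c)"
    using assms(2) unfolding piecewise_affine_def by blast
  have "\<exists>m c. \<forall>t\<in>{u..v}. f t - g t = m * t + c"
    if uv: "a \<le> u \<and> u < v \<and> v \<le> b \<and> {u<..<v} \<inter> (S \<union> S') = {}" for u v
  proof -
    have *: "{u<..<v} \<inter> S = {}" "{u<..<v} \<inter> S' = {}" using uv by blast+
    obtain m c where 1: "\<forall>t\<in>{u..v}. f t = m * t + c" using S(2)[of u v] uv * by auto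
    obtain n d where 2: "\<forall>t\<in>{u..v}. g t = n * t + d" using S'(2)[of u v] uv * by auto
    show ?thesis using 1 2 by (intro exI[of _ "m - n"] exI[of _ "c - d"]) (simp add: algebra_simps)
  qed
  then show ?thesis unfolding piecewise_affine_def using S(1) S'(1)
    by (intro exI[of _ "S \<union> S'"] conjI) blast+
qed

lemma piecewise_affine_at_right:
  assumes "piecewise_affine f a b" "t \<in> {a..<b}"
  obtains m where "(f has_vector_derivative m) (at_right t)"
proof -
  obtain S where S: "finite S" "\<And>u v. a \<le> u \<and> u < v \<and> v \<le> b \<and> {u<..<v} \<inter> S = {} \<Longrightarrow>
           (\<exists>m c. \<forall>t\<in>{u..v}. f t = m * t + c)"
    using assms(1) unfolding piecewise_affine_def by blast
  define v where "v = Min (insert b {s \<in> S. t < s})"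
  have fin: "finite (insert b {s \<in> S. t < s})" using S(1) by simp
  have v: "t < v" "v \<le> b" unfolding v_def using fin assms(2) by auto
  have "{t<..<v} \<inter> S = {}" unfolding v_def using fin by auto
  then obtain m c where "\<forall>x\<in>{t..v}. f x = m * x + c" using S(2)[of t v] v assms(2) by auto
  then show thesis using has_vector_derivative_at_right_affine(1)[of t v f m c t] v that by auto
qed

lemma piecewise_affine_at_left:
  assumes "piecewise_affine f a b" "t \<in> {a<..b}"
  obtains m where "(f has_vector_derivative m) (at_left t)"
proof -
  obtain S where S: "finite S" "\<And>u v. a \<le> u \<and> u < v \<and> v \<le> b \<and> {u<..<v} \<inter> S = {} \<Longrightarrow>
           (\<exists>m c. \<forall>t\<in>{u..v}. f t = m * t + c)"
    using assms(1) unfolding piecewise_affine_def by blast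
  define v where "v = Max (insert a {s \<in> S. s < t})"
  have fin: "finite (insert a {s \<in> S. s < t})" using S(1) by simp
  have v: "v < t" "a \<le> v" unfolding v_def using fin assms(2) by auto
  have "{v<..<t} \<inter> S = {}" unfolding v_def using fin by auto
  then obtain m c where "\<forall>x\<in>{v..t}. f x = m * x + c" using S(2)[of v t] v assms(2) by auto
  then show thesis using has_vector_derivative_at_left_affine(1)[of v t f m c t] v that by auto
qed

text \<open>\<open>vector_derivative\<close> is additive only where the derivatives exist; piecewise
  affine functions have all one-sided slopes.\<close>

lemma vector_derivative_diff_at_right:
  assumes "piecewise_affine f a b" "piecewise_affine g a b" "t \<in> {a..<b}"
  shows "vector_derivative (\<lambda>s. f s - g s) (at_right t) =
    vector_derivative f (at_right t) - vector_derivative g (at_right t)"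
proof -
  obtain m where m: "(f has_vector_derivative m) (at_right t)"
    by (rule piecewise_affine_at_right[OF assms(1,3)])
  obtain n where n: "(g has_vector_derivative n) (at_right t)"
    by (rule piecewise_affine_at_right[OF assms(2,3)])
  have nb: "at_right t \<noteq> bot" by (simp add: trivial_limit_at_right_real)
  show ?thesis
    unfolding vector_derivative_within[OF nb m] vector_derivative_within[OF nb n]
    by (rule vector_derivative_within[OF nb has_vector_derivative_diff[OF m n]])
qed

lemma vector_derivative_diff_at_left:
  assumes "piecewise_affine f a b" "piecewise_affine g a b" "t \<in> {a<..b}"
  shows "vector_derivative (\<lambda>s. f s - g s) (at_left t) =
    vector_derivative f (at_left t) - vector_derivative g (at_left t)"
proof -
  obtain m where m: "(f has_vector_derivative m) (at_left t)"
    by (rule piecewise_affine_at_left[OF assms(1,3)])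
  obtain n where n: "(g has_vector_derivative n) (at_left t)"
    by (rule piecewise_affine_at_left[OF assms(2,3)])
  have nb: "at_left t \<noteq> bot" by (simp add: trivial_limit_at_left_real)
  show ?thesis
    unfolding vector_derivative_within[OF nb m] vector_derivative_within[OF nb n]
    by (rule vector_derivative_within[OF nb has_vector_derivative_diff[OF m n]])
qed

lemma outflow_diff:
  assumes "\<And>e. e \<in> edges G \<Longrightarrow> piecewise_affine (\<lambda>t. f (emap G e t)) 0 (elen G e)"
    and "\<And>e. e \<in> edges G \<Longrightarrow> piecewise_affine (\<lambda>t. g (emap G e t)) 0 (elen G e)"
  shows "outflow G (\<lambda>x. f x - g x) w = outflow G f w - outflow G g w"
  unfolding outflow_def sum_subtractf[symmetric]
proof (rule sum.cong[OF refl])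
  fix e assume e: "e \<in> edges G"
  note * = assms[OF e]
  have 1: "(\<Sum>t\<in>{t\<in>{0..<elen G e}. emap G e t = w}. - vector_derivative (\<lambda>s. f (emap G e s) - g (emap G e s)) (at_right t))
    = (\<Sum>t\<in>{t\<in>{0..<elen G e}. emap G e t = w}. - vector_derivative (\<lambda>s. f (emap G e s)) (at_right t))
    - (\<Sum>t\<in>{t\<in>{0..<elen G e}. emap G e t = w}. - vector_derivative (\<lambda>s. g (emap G e s)) (at_right t))"
    unfolding sum_subtractf[symmetric]
    by (rule sum.cong[OF refl]) (use vector_derivative_diff_at_right[OF *] in simp)
  have 2: "(\<Sum>t\<in>{t\<in>{0<..elen G e}. emap G e t = w}. vector_derivative (\<lambda>s. f (emap G e s) - g (emap G e s)) (at_left t))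
    = (\<Sum>t\<in>{t\<in>{0<..elen G e}. emap G e t = w}. vector_derivative (\<lambda>s. f (emap G e s)) (at_left t))
    - (\<Sum>t\<in>{t\<in>{0<..elen G e}. emap G e t = w}. vector_derivative (\<lambda>s. g (emap G e s)) (at_left t))"
    unfolding sum_subtractf[symmetric]
    by (rule sum.cong[OF refl]) (use vector_derivative_diff_at_left[OF *] in simp)
  show "(\<Sum>t\<in>{t\<in>{0..<elen G e}. emap G e t = w}. - vector_derivative (\<lambda>s. f (emap G e s) - g (emap G e s)) (at_right t)) +
    (\<Sum>t\<in>{t\<in>{0<..elen G e}. emap G e t = w}. vector_derivative (\<lambda>s. f (emap G e s) - g (emap G e s)) (at_left t)) =
    (\<Sum>t\<in>{t\<in>{0..<elen G e}. emap G e t = w}. - vector_derivative (\<lambda>s. f (emap G e s)) (at_right t)) +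
    (\<Sum>t\<in>{t\<in>{0<..elen G e}. emap G e t = w}. vector_derivative (\<lambda>s. f (emap G e s)) (at_left t)) -
    ((\<Sum>t\<in>{t\<in>{0..<elen G e}. emap G e t = w}. - vector_derivative (\<lambda>s. g (emap G e s)) (at_right t)) +
    (\<Sum>t\<in>{t\<in>{0<..elen G e}. emap G e t = w}. vector_derivative (\<lambda>s. g (emap G e s)) (at_left t)))"
    unfolding 1 2 by linarith
qed

lemma outflow_const:
  assumes "\<And>x. x \<in> pts G \<Longrightarrow> f x = c"
  shows "outflow G f w = 0"
  unfolding outflow_def
proof (rule sum.neutral, rule ballI)
  fix e assume e: "e \<in> edges G"
  have c: "f (emap G e t) = 0 * t + c" if "t \<in> {0..elen G e}" for t
    using assms emap_in_pts[OF e that] by simp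
  have 1: "(\<Sum>t\<in>{t\<in>{0..<elen G e}. emap G e t = w}. - vector_derivative (\<lambda>s. f (emap G e s)) (at_right t)) = 0"
    by (rule sum.neutral) (use has_vector_derivative_at_right_affine(2)[of 0 "elen G e" "\<lambda>s. f (emap G e s)", OF c] in auto)
  have 2: "(\<Sum>t\<in>{t\<in>{0<..elen G e}. emap G e t = w}. vector_derivative (\<lambda>s. f (emap G e s)) (at_left t)) = 0"
    by (rule sum.neutral) (use has_vector_derivative_at_left_affine(2)[of 0 "elen G e" "\<lambda>s. f (emap G e s)", OF c] in auto)
  show "(\<Sum>t\<in>{t\<in>{0..<elen G e}. emap G e t = w}. - vector_derivative (\<lambda>s. f (emap G e s)) (at_right t)) +
    (\<Sum>t\<in>{t\<in>{0<..elen G e}. emap G e t = w}. vector_derivative (\<lambda>s. f (emap G e s)) (at_left t)) = 0"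
    unfolding 1 2 by simp
qed

lemma potential_diff:
  assumes "potential G y v f" "potential G z v g"
  shows "potential G y z (\<lambda>x. f x - g x)"
  using assms unfolding potential_def
  by (auto simp: outflow_diff piecewise_affine_diff)

lemma potential_const: "potential G v v (\<lambda>_. c)"
proof -
  have "piecewise_affine (\<lambda>t. c) a b" for a b
    by (rule piecewise_affine_two_pieces[of a a _ 0 c b 0 c]) auto
  then show ?thesis unfolding potential_def using outflow_const[of G "\<lambda>_. c" c] by simp
qed

lemma vertex_potential_family:
  assumes G: "metrized_graph G" and v: "v \<in> verts G"
  obtains \<phi> where "\<And>a. a \<in> verts G \<Longrightarrow> \<phi> a v = 0"
    "\<And>a w. a \<in> verts G \<Longrightarrow> vertex_laplacian G (\<phi> a) w = of_bool (w = a) - of_bool (w = v)"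
proof -
  have "\<exists>f. f v = 0 \<and> (\<forall>w. vertex_laplacian G f w = of_bool (w = a) - of_bool (w = v))"
    if "a \<in> verts G" for a
    by (rule vertex_laplacian_solvable[OF G that v]) blast
  then have "\<forall>a\<in>verts G. \<exists>f. f v = 0 \<and> (\<forall>w. vertex_laplacian G f w = of_bool (w = a) - of_bool (w = v))"
    by (rule ballI)
  from bchoice[OF this] show thesis using that by blast
qed

text \<open>Both sources are drained at one vertex \<open>v\<close>, and the drains cancel in the
  difference. Thus \<open>y\<close> and \<open>z\<close> never have to be inserted into the network
  together.\<close>

lemma potential_exists:
  assumes G: "metrized_graph G" and "y \<in> pts G" "z \<in> pts G"
  obtains f where "potential G y z f"
proof -
  obtain v where v: "v \<in> verts G" using metrized_graphD(2)[OF G] by blast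
  obtain \<phi> where \<phi>: "\<And>a. a \<in> verts G \<Longrightarrow> \<phi> a v = 0"
    "\<And>a w. a \<in> verts G \<Longrightarrow> vertex_laplacian G (\<phi> a) w = of_bool (w = a) - of_bool (w = v)"
    by (rule vertex_potential_family[OF G v]) blast
  have "\<exists>F. potential G x v F" if x: "x \<in> pts G" for x
  proof (cases "x \<in> verts G")
    case True
    then show ?thesis using potential_to_vertex(1)[where \<phi>=\<phi>, OF G v \<phi> True] by blast
  next
    case False
    then obtain e t where "e \<in> edges G" "t \<in> {0..elen G e}" "x = emap G e t"
      using x unfolding pts_def by blast
    then show ?thesis using potential_to_vertex(2)[where \<phi>=\<phi>, OF G v \<phi>, of e t] by blast
  qed
  then obtain f g where "potential G y v f" "potential G z v g" using assms(2,3) by blast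
  from potential_diff[OF this] show thesis by (rule that)
qed

subsection \<open>Voltage, resistance and the tau constant\<close>

text \<open>\<open>voltage\<close> describes a potential in the sense of current balance. Such a
  potential exists, and its weak form agrees with \<open>f\<close> up to a constant, so every weak
  potential computes the voltage. In the union only the weak form is verified.\<close>

lemma voltage_eq:
  assumes G: "metrized_graph G" and x: "x \<in> pts G" and y: "y \<in> pts G" and z: "z \<in> pts G"
    and f: "weak_potential G y z f"
  shows "voltage G z x y = f x - f z"
  unfolding voltage_def
proof (rule the_equality)
  obtain F where F: "potential G y z F" using potential_exists[OF G y z] .
  have "potential G y z (\<lambda>w. F w - F z)" using potential_diff[OF F potential_const] .
  moreover have "f x - f z = F x - F z"
    using weak_potential_unique[OF G f potential_imp_weak[OF G F y z] x z] .
  ultimately show "\<exists>h. potential G y z h \<and> h z = 0 \<and> f x - f z = h x"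
    by (intro exI[of _ "\<lambda>w. F w - F z"]) simp
next
  fix v assume "\<exists>h. potential G y z h \<and> h z = 0 \<and> v = h x"
  then obtain h where h: "potential G y z h" "h z = 0" "v = h x" by blast
  show "v = f x - f z"
    using weak_potential_unique[OF G f potential_imp_weak[OF G h(1) y z] x z] h by simp
qed

lemma weak_potential_cong:
  assumes "weak_potential G y z f" "\<And>x. x \<in> pts G \<Longrightarrow> g x = f x"
  shows "weak_potential G y z g"
proof -
  have "energy G g h = energy G f h" for h
    by (rule dirichlet_cong) (use assms(2) in auto)
  then show ?thesis
    using assms edgewise_poly_cong[of G f g] unfolding weak_potential_def by auto
qed

lemma weak_potential_shift:
  assumes "metrized_graph G" "weak_potential G y z f"
  shows "weak_potential G y z (\<lambda>x. f x - c)"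
proof -
  have "weak_potential G z z (\<lambda>_. c)"
    unfolding weak_potential_def by (simp add: edgewise_poly_const dirichlet_const_left)
  from weak_potential_diff[OF assms this] show ?thesis .
qed

lemma voltage_weak_potential:
  assumes G: "metrized_graph G" and y: "y \<in> pts G" and z: "z \<in> pts G"
  shows "weak_potential G y z (\<lambda>x. voltage G z x y)"
proof -
  obtain F where F: "potential G y z F" using potential_exists[OF G y z] .
  have w: "weak_potential G y z F" using potential_imp_weak[OF G F y z] .
  show ?thesis
    by (rule weak_potential_cong[OF weak_potential_shift[OF G w, of "F z"]])
      (use voltage_eq[OF G _ y z w] in simp)
qed

section \<open>Reciprocity, change of base point, and resistance\<close>

lemma voltage_base_zero:
  assumes "metrized_graph G" "y \<in> pts G" "z \<in> pts G"
  shows "voltage G z z y = 0"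
  using voltage_eq[OF assms(1,3,2,3) voltage_weak_potential[OF assms]] by simp

text \<open>Reciprocity: each of the two potentials is tested against the other, and the energy is
  symmetric.\<close>

lemma voltage_sym:
  assumes G: "metrized_graph G" and x: "x \<in> pts G" and y: "y \<in> pts G" and z: "z \<in> pts G"
  shows "voltage G z x y = voltage G z y x"
proof -
  let ?X = "\<lambda>w. voltage G z w x" and ?Y = "\<lambda>w. voltage G z w y"
  have X: "weak_potential G x z ?X" and Y: "weak_potential G y z ?Y"
    using voltage_weak_potential[OF G] x y z by auto
  have "energy G ?X ?Y = ?Y x - ?Y z" "energy G ?Y ?X = ?X y - ?X z"
    using X Y unfolding weak_potential_def by auto
  then show ?thesis
    using dirichlet_sym[of G "\<lambda>_. 1" ?X ?Y] voltage_base_zero[OF G] x y z by simp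
qed

lemma voltage_change_base:
  assumes G: "metrized_graph G" and "x \<in> pts G" "y \<in> pts G" "z \<in> pts G" "p \<in> pts G"
  shows "voltage G z x y = voltage G p x y - voltage G p x z - voltage G p z y + voltage G p z z"
proof -
  have "weak_potential G y z (\<lambda>w. voltage G p w y - voltage G p w z)"
    using weak_potential_diff[OF G] voltage_weak_potential[OF G] assms by blast
  from voltage_eq[OF G assms(2-4) this] show ?thesis by simp
qed

text \<open>Equivalently, \<open>j_p(x,y)\<close> is the Gromov product of \<open>x\<close> and
  \<open>y\<close> at \<open>p\<close> for the resistance metric. Through this identity statements
  about one base point pass to another.\<close>

lemma resistance_eq_voltage:
  assumes G: "metrized_graph G" and "x \<in> pts G" "y \<in> pts G" "p \<in> pts G"
  shows "resistance G x y = resistance G x p - 2 * voltage G p x y + resistance G y p"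
  unfolding resistance_def using voltage_change_base[OF G, of x x y p] voltage_sym[OF G, of x y p] assms
  by simp

lemma resistance_self:
  assumes "metrized_graph G" "x \<in> pts G"
  shows "resistance G x x = 0"
  unfolding resistance_def using voltage_base_zero[OF assms(1)] assms(2) by simp

lemma resistance_sym:
  assumes G: "metrized_graph G" and "x \<in> pts G" "y \<in> pts G"
  shows "resistance G x y = resistance G y x"
  using resistance_eq_voltage[OF G assms(2,3,2)] resistance_self[OF G assms(2)]
    voltage_base_zero[OF G assms(3,2)] by simp

text \<open>Here the source moves together with the point of evaluation, so affineness of each
  single potential says nothing. The explicit value of a potential at its source gives one quadratic
  polynomial for the whole edge.\<close>

lemma resistance_to_vertex_poly:
  assumes G: "metrized_graph G" and v: "v \<in> verts G"
  shows "edgewise_poly G (\<lambda>x. resistance G x v)"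
  unfolding edgewise_poly_def
proof
  fix e assume e: "e \<in> edges G"
  have vp: "v \<in> pts G" using v unfolding pts_def by blast
  obtain \<phi> where \<phi>: "\<And>a. a \<in> verts G \<Longrightarrow> \<phi> a v = 0"
    "\<And>a w. a \<in> verts G \<Longrightarrow> vertex_laplacian G (\<phi> a) w = of_bool (w = a) - of_bool (w = v)"
    by (rule vertex_potential_family[OF G v]) blast
  define a b where "a = emap G e 0" and "b = emap G e (elen G e)"
  define r where "r = [:0, 1 / elen G e:]"
  define P where "P = (1 - r) * ((1 - r) * [:\<phi> a a:] + r * [:\<phi> b a:]) + r * ((1 - r) * [:\<phi> a b:] + r * [:\<phi> b b:]) + [:0, 1:] * (1 - r)"
  have "resistance G (emap G e t) v = poly P t" if t: "t \<in> {0..elen G e}" for t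
  proof -
    obtain F where F: "potential G (emap G e t) v F" "F v = 0"
      "F (emap G e t) = (let a = emap G e 0; b = emap G e (elen G e); r = t / elen G e in
           (1 - r) * ((1 - r) * \<phi> a a + r * \<phi> b a) + r * ((1 - r) * \<phi> a b + r * \<phi> b b) + t * (1 - r))"
      using potential_to_vertex(2)[where \<phi>=\<phi>, OF G v \<phi> e t] by blast
    have x: "emap G e t \<in> pts G" using emap_in_pts[OF e t] .
    have "resistance G (emap G e t) v = F (emap G e t)"
      unfolding resistance_def
      using voltage_eq[OF G x x vp potential_imp_weak[OF G F(1) x vp]] F(2) by simp
    also have "\<dots> = poly P t"
      unfolding F(3) Let_def P_def r_def a_def[symmetric] b_def[symmetric] by (simp add: mult.commute)
    finally show ?thesis .
  qed
  then show "piecewise_poly (\<lambda>t. resistance G (emap G e t) v) 0 (elen G e)"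
    unfolding piecewise_poly_def by (intro exI[of _ "{}"] conjI allI impI exI[of _ P]) auto
qed

lemma voltage_edgewise_poly:
  assumes "metrized_graph G" "y \<in> pts G" "z \<in> pts G"
  shows "edgewise_poly G (\<lambda>x. voltage G z x y)"
  using voltage_weak_potential[OF assms] unfolding weak_potential_def by blast

lemma resistance_edgewise_poly:
  assumes G: "metrized_graph G" and y: "y \<in> pts G"
  shows "edgewise_poly G (\<lambda>x. resistance G x y)"
proof -
  obtain v where v: "v \<in> verts G" using metrized_graphD(2)[OF G] by blast
  then have vp: "v \<in> pts G" unfolding pts_def by blast
  have "edgewise_poly G (\<lambda>x. resistance G x v - 2 * voltage G v x y + resistance G y v)"
    by (intro edgewise_poly_intros resistance_to_vertex_poly[OF G v] voltage_edgewise_poly[OF G y vp])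
  then show ?thesis
    by (rule edgewise_poly_cong) (rule resistance_eq_voltage[OF G _ y vp])
qed

text \<open>Up to a constant \<open>r(_,y)\<close> is \<open>r(_,z) - 2 * j_z(_,y)\<close>, and
  Green's identity evaluates the energy of the voltage. Replacing \<open>y\<close> by
  \<open>z\<close> in the first argument costs \<open>+ 2 * c\<close>, in the second
  \<open>- 2 * c\<close>, where \<open>c = r(y,z)\<close>.\<close>

lemma energy_resistance_base:
  assumes G: "metrized_graph G" and y: "y \<in> pts G" and z: "z \<in> pts G"
  shows "energy G (\<lambda>x. resistance G x y) (\<lambda>x. resistance G x y) =
    energy G (\<lambda>x. resistance G x z) (\<lambda>x. resistance G x z)"
proof -
  let ?r = "\<lambda>x. resistance G x y" and ?s = "\<lambda>x. resistance G x z" and ?u = "\<lambda>x. voltage G z x y"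
  define c where "c = resistance G y z"
  note ok = metrized_graph_edges_ok[OF G]
  have K: "edgewise_poly G ?r" "edgewise_poly G ?s" "edgewise_poly G ?u"
    using resistance_edgewise_poly[OF G] voltage_edgewise_poly[OF G] y z by auto
  have u: "energy G ?u h = h y - h z" if "edgewise_poly G h" for h
    using voltage_weak_potential[OF G y z] that unfolding weak_potential_def by blast
  have r: "energy G ?r h = energy G ?s h - 2 * (h y - h z)" if h: "edgewise_poly G h" for h
  proof -
    have "energy G ?r h = energy G (\<lambda>x. ?s x - (2 * ?u x - c)) h"
      by (rule dirichlet_cong) (use resistance_eq_voltage[OF G _ y z] in \<open>auto simp: c_def\<close>)
    also have "\<dots> = energy G ?s h - energy G (\<lambda>x. 2 * ?u x - c) h"
      by (rule dirichlet_diff[OF ok]) (intro edgewise_poly_intros K h)+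
    also have "energy G (\<lambda>x. 2 * ?u x - c) h = energy G (\<lambda>x. 2 * ?u x) h - energy G (\<lambda>_. c) h"
      by (rule dirichlet_diff[OF ok]) (intro edgewise_poly_intros K h)+
    also have "energy G (\<lambda>x. 2 * ?u x) h = 2 * energy G ?u h"
      by (rule dirichlet_cmult[OF ok]) (intro edgewise_poly_intros K h)+
    finally show ?thesis using u[OF h] dirichlet_const_left by simp
  qed
  have "energy G ?r ?r = energy G ?s ?r + 2 * c"
    using r[OF K(1)] resistance_self[OF G y] resistance_sym[OF G y z] by (simp add: c_def)
  also have "energy G ?s ?r = energy G ?r ?s" by (rule dirichlet_sym)
  also have "\<dots> = energy G ?s ?s - 2 * c"
    using r[OF K(2)] resistance_self[OF G z] by (simp add: c_def)
  finally show ?thesis by simp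
qed

lemma tau_eq_energy:
  assumes G: "metrized_graph G" and y: "y \<in> pts G"
  shows "tau G = energy G (\<lambda>x. resistance G x y) (\<lambda>x. resistance G x y) / 4"
proof -
  have *: "1 / 4 * graph_integral G (\<lambda>e t. (edge_deriv G (\<lambda>x. resistance G x z) e t)\<^sup>2) =
    energy G (\<lambda>x. resistance G x z) (\<lambda>x. resistance G x z) / 4" for z
    unfolding dirichlet_def by (simp add: power2_eq_square)
  show ?thesis
    unfolding tau_def *
  proof (rule the_equality)
    show "\<forall>z\<in>pts G. energy G (\<lambda>x. resistance G x y) (\<lambda>x. resistance G x y) / 4 =
      energy G (\<lambda>x. resistance G x z) (\<lambda>x. resistance G x z) / 4"
      using energy_resistance_base[OF G y] by metis
  qed (use y in blast)
qed

lemma energy_nonneg: "0 \<le> energy G f f"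
  unfolding dirichlet_def graph_integral_def
proof (rule sum_nonneg)
  fix e
  show "0 \<le> integral {0..elen G e} (\<lambda>t. 1 * (edge_deriv G f e t * edge_deriv G f e t))"
    by (cases "(\<lambda>t. edge_deriv G f e t * edge_deriv G f e t) integrable_on {0..elen G e}")
      (auto intro: Henstock_Kurzweil_Integration.integral_nonneg simp: not_integrable_integral)
qed

text \<open>The resistance is the energy of its own potential. If that were 0, the potential would
  be constant and no current could leave \<open>p\<close>.\<close>

lemma resistance_pos:
  assumes G: "metrized_graph G" and p: "p \<in> pts G" and q: "q \<in> pts G" and "p \<noteq> q"
  shows "0 < resistance G p q"
proof -
  obtain f where f: "potential G p q f" using potential_exists[OF G p q] .
  note w = potential_imp_weak[OF G f p q]
  have r: "resistance G p q = energy G f f"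
    unfolding resistance_def using voltage_eq[OF G p p q w] w unfolding weak_potential_def by auto
  have "energy G f f \<noteq> 0"
  proof
    assume "energy G f f = 0"
    then have "f x = f p" if "x \<in> pts G" for x
      using energy_zero_imp_const[OF G _ _ that p] w unfolding weak_potential_def by blast
    then have "outflow G f p = 0" by (rule outflow_const)
    then show False using f p \<open>p \<noteq> q\<close> unfolding potential_def by auto
  qed
  then show ?thesis using r energy_nonneg[of G f] by simp
qed

text \<open>The function \<open>u\<close> rises from 0 at \<open>p\<close> to \<open>R\<close> at
  \<open>q\<close>, so Green's identity and the Leibniz rule evaluate the form with weight
  \<open>u^n\<close> and both arguments \<open>u\<close> as \<open>R^(n+1) / (n+1)\<close>, needed
  for \<open>n = 1\<close> and \<open>n = 2\<close>. The remaining weights \<open>\<rho>\<close> and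
  \<open>u\<close> are linked by expanding the energy of \<open>\<rho> * u\<close> against
  \<open>u\<close>, which is \<open>R^2\<close>.\<close>

lemma A_const_energy:
  assumes G: "metrized_graph G" and p: "p \<in> pts G" and q: "q \<in> pts G"
  defines "R \<equiv> resistance G p q" and "u \<equiv> \<lambda>x. voltage G p x q" and "\<rho> \<equiv> \<lambda>x. resistance G x p"
  shows "energy G \<rho> (\<lambda>x. u x * u x) = R\<^sup>2 - 2 * A_const p q G"
    and "energy G (\<lambda>x. u x * u x) (\<lambda>x. u x * u x) = 4 / 3 * R ^ 3"
proof -
  note ok = metrized_graph_edges_ok[OF G]
  have K: "edgewise_poly G \<rho>" "edgewise_poly G u"
    using resistance_edgewise_poly[OF G p] voltage_edgewise_poly[OF G q p] by (auto simp: \<rho>_def u_def)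
  have K2: "edgewise_poly G (\<lambda>x. u x * u x)" "edgewise_poly G (\<lambda>x. \<rho> x * u x)"
    "edgewise_poly G (\<lambda>x. u x * (u x * u x))"
    using K by (auto intro: edgewise_poly_mult)
  have up: "u p = 0" and uq: "u q = R"
    unfolding u_def R_def using voltage_base_zero[OF G q p] resistance_sym[OF G p q]
    by (auto simp: resistance_def)
  have \<rho>q: "\<rho> q = R" unfolding \<rho>_def R_def using resistance_sym[OF G p q] by simp
  have E: "energy G u h = h q - h p" if "edgewise_poly G h" for h
    using voltage_weak_potential[OF G q p] that unfolding weak_potential_def u_def by blast
  have one: "edgewise_poly G (\<lambda>_. 1)" by (rule edgewise_poly_const)
  let ?T = "dirichlet G"
  have uu: "?T k (\<lambda>x. u x * u x) h = 2 * ?T (\<lambda>x. k x * u x) u h"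
    if "edgewise_poly G k" "edgewise_poly G h" for k h
    using dirichlet_mult[OF ok that(1) K(2) K(2) that(2)] by simp
  have a: "?T u u u = R\<^sup>2 / 2"
    using uu[OF one K(2)] E[OF K2(1)] dirichlet_sym[of G "\<lambda>_. 1" u "\<lambda>x. u x * u x"] up uq
    by (simp add: power2_eq_square)
  have "energy G (\<lambda>x. u x * (u x * u x)) u =
      ?T u (\<lambda>x. u x * u x) u + ?T (\<lambda>x. u x * u x) u u"
    using dirichlet_mult[OF ok one K(2) K2(1) K(2)] by simp
  also have "\<dots> = 3 * ?T (\<lambda>x. u x * u x) u u" using uu[OF K(2) K(2)] by simp
  finally have b: "?T (\<lambda>x. u x * u x) u u = R ^ 3 / 3"
    using E[OF K2(3)] dirichlet_sym[of G "\<lambda>_. 1" u "\<lambda>x. u x * (u x * u x)"] up uq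
    by (simp add: power3_eq_cube)
  have "energy G (\<lambda>x. u x * u x) (\<lambda>x. u x * u x) = 2 * ?T u u (\<lambda>x. u x * u x)"
    using uu[OF one K2(1)] by simp
  also have "?T u u (\<lambda>x. u x * u x) = 2 * ?T (\<lambda>x. u x * u x) u u"
    using uu[OF K(2) K(2)] dirichlet_sym[of G u] by metis
  finally show "energy G (\<lambda>x. u x * u x) (\<lambda>x. u x * u x) = 4 / 3 * R ^ 3" using b by simp
  have "energy G (\<lambda>x. \<rho> x * u x) u = ?T \<rho> u u + ?T u \<rho> u"
    using dirichlet_mult[OF ok one K(1) K(2) K(2)] by simp
  then have c: "?T \<rho> u u = R\<^sup>2 - ?T u \<rho> u"
    using E[OF K2(2)] dirichlet_sym[of G "\<lambda>_. 1" u "\<lambda>x. \<rho> x * u x"] up uq \<rho>q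
    by (simp add: power2_eq_square)
  have d: "energy G \<rho> (\<lambda>x. u x * u x) = 2 * ?T u \<rho> u"
    using uu[OF one K(1)] dirichlet_sym[of G "\<lambda>_. 1" \<rho>] dirichlet_sym[of G u \<rho> u] by simp
  have "A_const p q G = ?T (\<lambda>x. voltage G x p q) u u"
    unfolding A_const_def dirichlet_def u_def by (simp add: power2_eq_square)
  also have "\<dots> = ?T (\<lambda>x. \<rho> x - u x) u u"
  proof (rule dirichlet_cong)
    fix x assume x: "x \<in> pts G"
    \<comment> \<open>Of the four terms of the change of base only \<open>j_p(x,x)\<close> and
      \<open>j_p(x,q)\<close> survive.\<close>
    show "voltage G x p q = \<rho> x - u x"
      using voltage_change_base[OF G p q x p] voltage_base_zero[OF G] p q x
      by (simp add: \<rho>_def u_def resistance_def)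
  qed auto
  also have "\<dots> = ?T \<rho> u u - ?T u u u"
    using dirichlet_weight_diff[OF ok K(1) K(2) K(2) K(2)] .
  finally show "energy G \<rho> (\<lambda>x. u x * u x) = R\<^sup>2 - 2 * A_const p q G"
    using a c d by simp
qed

subsection \<open>Invariance under subdivision\<close>

lemma piecewise_poly_reparam:
  assumes g: "piecewise_poly g a b" and \<sigma>: "\<sigma> = 1 \<or> \<sigma> = -1"
    and range: "\<And>t. t \<in> {u..v} \<Longrightarrow> c + \<sigma> * t \<in> {a..b}"
  shows "piecewise_poly (\<lambda>t. g (c + \<sigma> * t)) u v"
proof -
  obtain S where S: "finite S" "\<And>u v. a \<le> u \<and> u < v \<and> v \<le> b \<and> {u<..<v} \<inter> S = {} \<Longrightarrow>
           (\<exists>P. \<forall>t\<in>{u..v}. g t = poly P t)"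
    using g unfolding piecewise_poly_def by blast
  \<comment> \<open>As \<open>\<sigma>\<close> is its own inverse, this is the preimage of the break
    points.\<close>
  define S' where "S' = (\<lambda>x. \<sigma> * (x - c)) ` S"
  have "\<exists>P. \<forall>t\<in>{x..y}. g (c + \<sigma> * t) = poly P t"
    if xy: "u \<le> x \<and> x < y \<and> y \<le> v \<and> {x<..<y} \<inter> S' = {}" for x y
  proof -
    define l r where "l = min (c + \<sigma> * x) (c + \<sigma> * y)" and "r = max (c + \<sigma> * x) (c + \<sigma> * y)"
    have lr: "a \<le> l" "l < r" "r \<le> b"
      using range[of x] range[of y] xy \<sigma> by (auto simp: l_def r_def)
    have "s \<notin> S" if "s \<in> {l<..<r}" for s
    proof
      assume "s \<in> S"
      then have "\<sigma> * (s - c) \<in> S'" by (auto simp: S'_def)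
      moreover have "\<sigma> * (s - c) \<in> {x<..<y}" using that \<sigma> xy by (auto simp: l_def r_def)
      ultimately show False using xy by blast
    qed
    then have "{l<..<r} \<inter> S = {}" by blast
    then obtain P where P: "\<forall>t\<in>{l..r}. g t = poly P t" using S(2)[of l r] lr by auto
    have "g (c + \<sigma> * t) = poly (pcompose P [:c, \<sigma>:]) t" if "t \<in> {x..y}" for t
    proof -
      have "c + \<sigma> * t \<in> {l..r}" using that \<sigma> by (auto simp: l_def r_def)
      then show ?thesis using P by (simp add: poly_pcompose mult.commute)
    qed
    then show ?thesis by blast
  qed
  then show ?thesis
    unfolding piecewise_poly_def using S(1) by (intro exI[of _ S'] conjI) (auto simp: S'_def)
qed

text \<open>
  Two parametrizations of the same space are compared off a finite set \<open>N\<close> of points containing all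
  vertices and break points; \<open>H\<close> below need not be a metrized graph.
\<close>

definition inj_off :: "'a set \<Rightarrow> ('a, 'e) mgraph \<Rightarrow> bool" where
  "inj_off N G \<longleftrightarrow>
     (\<forall>e\<in>edges G. emap G e 0 \<in> N \<and> emap G e (elen G e) \<in> N \<and>
        finite {t \<in> {0..elen G e}. emap G e t \<in> N}) \<and>
     (\<forall>e\<in>edges G. \<forall>e'\<in>edges G. \<forall>t\<in>{0..elen G e}. \<forall>t'\<in>{0..elen G e'}.
        emap G e t = emap G e' t' \<longrightarrow> emap G e t \<notin> N \<longrightarrow> e = e' \<and> t = t')"

text \<open>Unlike in \<open>unit_speed_path\<close>, the cuts are points of the space and not
  parameters. One set \<open>N\<close> then cuts both parametrizations, and the relation can be
  reversed.\<close>

definition subdivided :: "'a set \<Rightarrow> ('a, 'd) mgraph \<Rightarrow> ('a, 'e) mgraph \<Rightarrow> bool" where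
  "subdivided N H G \<longleftrightarrow>
     (\<forall>d\<in>edges H. \<forall>u v. 0 \<le> u \<and> u < v \<and> v \<le> elen H d \<and> emap H d ` {u<..<v} \<inter> N = {} \<longrightarrow>
        (\<exists>e\<in>edges G. \<exists>c \<sigma>. (\<sigma> = 1 \<or> \<sigma> = -1) \<and>
           (\<forall>t\<in>{u..v}. c + \<sigma> * t \<in> {0..elen G e} \<and> emap H d t = emap G e (c + \<sigma> * t))))"

definition covered_off :: "'a set \<Rightarrow> ('a, 'e) mgraph \<Rightarrow> ('a, 'd) mgraph \<Rightarrow> bool" where
  "covered_off N G H \<longleftrightarrow>
     (\<forall>e\<in>edges G. \<forall>t\<in>{0..elen G e}. emap G e t \<notin> N \<longrightarrow>
        (\<exists>d\<in>edges H. \<exists>s\<in>{0..elen H d}. emap H d s = emap G e t))"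

lemma inj_offD:
  assumes "inj_off N G" "e \<in> edges G"
  shows "emap G e 0 \<in> N" "emap G e (elen G e) \<in> N" "finite {t \<in> {0..elen G e}. emap G e t \<in> N}"
  using assms(1)[unfolded inj_off_def, THEN conjunct1] assms(2) by auto

lemma inj_off_unique:
  assumes "inj_off N G" "e \<in> edges G" "e' \<in> edges G" "t \<in> {0..elen G e}" "t' \<in> {0..elen G e'}"
    "emap G e t = emap G e' t'" "emap G e t \<notin> N"
  shows "e = e'" "t = t'"
  using assms(1)[unfolded inj_off_def, THEN conjunct2, rule_format, OF assms(2-7)] by auto

lemma inj_off_inner:
  assumes "inj_off N G" "e \<in> edges G" "t \<in> {0..elen G e}" "emap G e t \<notin> N"
  shows "t \<in> {0<..<elen G e}"
  using inj_offD(1,2)[OF assms(1,2)] assms(3,4) by (cases "t = 0"; cases "t = elen G e") auto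

lemma subdividedD:
  assumes "subdivided N H G" "d \<in> edges H" "0 \<le> u" "u < v" "v \<le> elen H d"
    "\<forall>t\<in>{u<..<v}. emap H d t \<notin> N"
  shows "\<exists>e c \<sigma>. e \<in> edges G \<and> (\<sigma> = 1 \<or> \<sigma> = (-1::real)) \<and>
    (\<forall>t\<in>{u..v}. c + \<sigma> * t \<in> {0..elen G e} \<and> emap H d t = emap G e (c + \<sigma> * t))"
proof -
  have "emap H d ` {u<..<v} \<inter> N = {}" using assms(6) by blast
  then show ?thesis
    using assms(1-5) unfolding subdivided_def Bex_def by simp
qed

text \<open>The midpoint of a free piece of \<open>G\<close> lies on some edge of \<open>H\<close>.
  The largest free interval around it there runs along an edge of \<open>G\<close>, which must be
  the given one by injectivity off \<open>N\<close>. It covers the whole piece, so its affine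
  coordinate change can be inverted.\<close>

lemma subdivided_sym:
  assumes HG: "subdivided N H G" and iH: "inj_off N H" and iG: "inj_off N G"
    and cov: "covered_off N G H"
  shows "subdivided N G H"
  unfolding subdivided_def
proof (intro ballI allI impI)
  fix e u v assume e: "e \<in> edges G"
    and uv: "0 \<le> u \<and> u < v \<and> v \<le> elen G e \<and> emap G e ` {u<..<v} \<inter> N = {}"
  define t where "t = (u + v) / 2"
  have t: "u < t" "t < v" using uv by (auto simp: t_def)
  then have "t \<in> {u<..<v}" by simp
  then have tN: "emap G e t \<notin> N" using uv by blast
  obtain d s where d: "d \<in> edges H" and s: "s \<in> {0..elen H d}" and ds: "emap H d s = emap G e t"
    using cov e tN t uv unfolding covered_off_def by force
  define T where "T = {x \<in> {0..elen H d}. emap H d x \<in> N}"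
  have T: "finite T" using inj_offD(3)[OF iH d] by (simp add: T_def)
  have s': "s \<in> {0<..<elen H d}" using inj_off_inner[OF iH d s] ds tN by simp
  then have ends: "0 \<in> T" "elen H d \<in> T" using inj_offD(1,2)[OF iH d] by (auto simp: T_def)
  \<comment> \<open>The largest interval around \<open>s\<close> free of \<open>N\<close>. The ends
    of the edge lie over \<open>N\<close>, so both sets are nonempty.\<close>
  define s1 s2 where "s1 = Max {x \<in> T. x < s}" and "s2 = Min {x \<in> T. s < x}"
  have s1: "s1 \<in> {x \<in> T. x < s}" unfolding s1_def using T ends s' by (intro Max_in) auto
  have s2: "s2 \<in> {x \<in> T. s < x}" unfolding s2_def using T ends s' by (intro Min_in) auto
  have free: "\<forall>x\<in>{s1<..<s2}. emap H d x \<notin> N"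
  proof (rule ballI, rule notI)
    fix x assume x: "x \<in> {s1<..<s2}"
    assume "emap H d x \<in> N"
    then have xT: "x \<in> T" using x s1 s2 by (auto simp: T_def)
    have "x \<noteq> s" using ds tN \<open>emap H d x \<in> N\<close> by auto
    then consider "x < s" | "s < x" by linarith
    then show False
    proof cases
      case 1
      then have "x \<le> s1" unfolding s1_def using xT T by (intro Max_ge) auto
      then show False using x by simp
    next
      case 2
      then have "s2 \<le> x" unfolding s2_def using xT T by (intro Min_le) auto
      then show False using x by simp
    qed
  qed
  have s12: "0 \<le> s1" "s1 < s2" "s2 \<le> elen H d" using s1 s2 by (auto simp: T_def)
  obtain e' c \<sigma> where piece: "e' \<in> edges G \<and> (\<sigma> = 1 \<or> \<sigma> = (-1::real)) \<and>
      (\<forall>x\<in>{s1..s2}. c + \<sigma> * x \<in> {0..elen G e'} \<and> emap H d x = emap G e' (c + \<sigma> * x))"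
    using subdividedD[OF HG d s12 free] by (elim exE) (rule that)
  have e': "e' \<in> edges G" and \<sigma>: "\<sigma> = 1 \<or> \<sigma> = (-1::real)" using piece by blast+
  have c1: "\<And>x. x \<in> {s1..s2} \<Longrightarrow> c + \<sigma> * x \<in> {0..elen G e'}"
    and c2: "\<And>x. x \<in> {s1..s2} \<Longrightarrow> emap H d x = emap G e' (c + \<sigma> * x)"
    using piece by simp_all
  have ss: "s \<in> {s1..s2}" using s1 s2 by auto
  have "t \<in> {0..elen G e}" using t uv by auto
  then have eq: "e = e'" "t = c + \<sigma> * s"
    using inj_off_unique[OF iG e e' _ c1[OF ss] _ tN] c2[OF ss] ds by auto
  \<comment> \<open>The ends of the interval lie over \<open>N\<close>, so their images are outside
    \<open>{u<..<v}\<close>. As the image contains \<open>t\<close>, it contains all of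
    \<open>{u..v}\<close>.\<close>
  have out: "c + \<sigma> * s1 \<notin> {u<..<v}" "c + \<sigma> * s2 \<notin> {u<..<v}"
  proof -
    have "x \<notin> {u<..<v}" if "emap G e x \<in> N" for x using uv that by blast
    then show "c + \<sigma> * s1 \<notin> {u<..<v}" "c + \<sigma> * s2 \<notin> {u<..<v}"
      using c2[of s1] c2[of s2] s1 s2 eq(1) by (auto simp: T_def)
  qed
  have "\<forall>x\<in>{u..v}. - (\<sigma> * c) + \<sigma> * x \<in> {s1..s2}"
    using \<sigma>
  proof
    assume "\<sigma> = 1"
    then show ?thesis using out t eq(2) s1 s2 by auto
  next
    assume "\<sigma> = -1"
    then show ?thesis using out t eq(2) s1 s2 by auto
  qed
  moreover have "c + \<sigma> * (- (\<sigma> * c) + \<sigma> * x) = x" for x using \<sigma> by auto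
  ultimately have "\<forall>x\<in>{u..v}. - (\<sigma> * c) + \<sigma> * x \<in> {0..elen H d} \<and>
      emap G e x = emap H d (- (\<sigma> * c) + \<sigma> * x)"
    using c2 eq(1) s12 by fastforce
  then show "\<exists>d\<in>edges H. \<exists>c \<sigma>. (\<sigma> = 1 \<or> \<sigma> = -1) \<and>
      (\<forall>x\<in>{u..v}. c + \<sigma> * x \<in> {0..elen H d} \<and> emap G e x = emap H d (c + \<sigma> * x))"
    using d \<sigma> by blast
qed

lemma edgewise_poly_subdivided:
  assumes HG: "subdivided N H G" and iH: "inj_off N H" and ok: "edges_ok H" and f: "edgewise_poly G f"
  shows "edgewise_poly H f"
  unfolding edgewise_poly_def
proof
  fix d assume d: "d \<in> edges H"
  let ?S = "{t \<in> {0..elen H d}. emap H d t \<in> N}"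
  have pos: "0 < elen H d" using ok d unfolding edges_ok_def by blast
  show "piecewise_poly (\<lambda>t. f (emap H d t)) 0 (elen H d)"
  proof (rule interval_pieces_induct[OF inj_offD(3)[OF iH d] pos])
    fix u v assume uv: "0 \<le> u" "u < v" "v \<le> elen H d" "{u<..<v} \<inter> ?S = {}"
    have free: "\<forall>t\<in>{u<..<v}. emap H d t \<notin> N" using uv by auto
    obtain e c \<sigma> where piece: "e \<in> edges G \<and> (\<sigma> = 1 \<or> \<sigma> = (-1::real)) \<and>
        (\<forall>x\<in>{u..v}. c + \<sigma> * x \<in> {0..elen G e} \<and> emap H d x = emap G e (c + \<sigma> * x))"
      using subdividedD[OF HG d uv(1-3) free] by (elim exE) (rule that)
    have e: "e \<in> edges G" and \<sigma>: "\<sigma> = 1 \<or> \<sigma> = (-1::real)" using piece by blast+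
    have c1: "\<And>x. x \<in> {u..v} \<Longrightarrow> c + \<sigma> * x \<in> {0..elen G e}"
      and c2: "\<And>x. x \<in> {u..v} \<Longrightarrow> emap H d x = emap G e (c + \<sigma> * x)"
      using piece by simp_all
    have "piecewise_poly (\<lambda>t. f (emap G e t)) 0 (elen G e)" using f e unfolding edgewise_poly_def by blast
    from piecewise_poly_reparam[OF this \<sigma> c1]
    show "piecewise_poly (\<lambda>t. f (emap H d t)) u v"
      by (rule piecewise_poly_cong) (use c2 in auto)
  qed (rule piecewise_poly_join)
qed

text \<open>Off \<open>N\<close> the parameters on \<open>d\<close> that lie over \<open>e\<close>
  form a set \<open>A d e\<close>, and the transition map carries it bijectively onto the set
  \<open>B d e\<close> of parameters on \<open>e\<close>. Its derivative is 1 or -1, so change of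
  variables equates the two integrals, whatever the order and orientation of the pieces. The double
  sum over \<open>d\<close> and \<open>e\<close> is then read in both orders.\<close>

lemma dirichlet_subdivided:
  assumes HG: "subdivided N H G" and iH: "inj_off N H" and iG: "inj_off N G"
    and cov: "covered_off N G H" and okH: "edges_ok H" and okG: "edges_ok G"
    and H: "edgewise_poly H k" "edgewise_poly H f" "edgewise_poly H g"
    and smooth: "\<And>e t. e \<in> edges G \<Longrightarrow> t \<in> {0..elen G e} \<Longrightarrow> emap G e t \<notin> N \<Longrightarrow>
        ((\<lambda>s. f (emap G e s)) has_real_derivative edge_deriv G f e t) (at t) \<and>
        ((\<lambda>s. g (emap G e s)) has_real_derivative edge_deriv G g e t) (at t)"
  shows "dirichlet H k f g = dirichlet G k f g"
proof -
  define A where "A = (\<lambda>d e. {s \<in> {0..elen H d}. emap H d s \<notin> N \<and> (\<exists>t\<in>{0..elen G e}. emap H d s = emap G e t)})"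
  define B where "B = (\<lambda>d e. {t \<in> {0..elen G e}. emap G e t \<notin> N \<and> (\<exists>s\<in>{0..elen H d}. emap H d s = emap G e t)})"
  define hH where "hH = (\<lambda>d s. k (emap H d s) * (edge_deriv H f d s * edge_deriv H g d s))"
  define hG where "hG = (\<lambda>e t. k (emap G e t) * (edge_deriv G f e t * edge_deriv G g e t))"
  have loc: "\<exists>u v e c \<sigma>. u < s \<and> s < v \<and> 0 \<le> u \<and> v \<le> elen H d \<and> e \<in> edges G \<and> (\<sigma> = 1 \<or> \<sigma> = (-1::real)) \<and>
      (\<forall>x\<in>{u<..<v}. emap H d x \<notin> N \<and> c + \<sigma> * x \<in> {0..elen G e} \<and> emap H d x = emap G e (c + \<sigma> * x))"
    if d: "d \<in> edges H" and s: "s \<in> {0..elen H d}" "emap H d s \<notin> N" for d s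
  proof -
    have s': "s \<in> {0<..<elen H d}" using inj_off_inner[OF iH d s] .
    obtain u v where uv: "0 \<le> u" "u < s" "s < v" "v \<le> elen H d"
      "{u<..<v} \<inter> {t \<in> {0..elen H d}. emap H d t \<in> N} = {}"
      by (rule finite_avoiding_nhd[OF inj_offD(3)[OF iH d] s']) (use s in auto)
    have free: "\<forall>t\<in>{u<..<v}. emap H d t \<notin> N" using uv by auto
    have "u < v" using uv by simp
    obtain e c \<sigma> where piece: "e \<in> edges G \<and> (\<sigma> = 1 \<or> \<sigma> = (-1::real)) \<and>
        (\<forall>x\<in>{u..v}. c + \<sigma> * x \<in> {0..elen G e} \<and> emap H d x = emap G e (c + \<sigma> * x))"
      using subdividedD[OF HG d uv(1) \<open>u < v\<close> uv(4) free] by (elim exE) (rule that)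
    have e: "e \<in> edges G" and \<sigma>: "\<sigma> = 1 \<or> \<sigma> = (-1::real)" using piece by blast+
    have c1: "\<And>x. x \<in> {u..v} \<Longrightarrow> c + \<sigma> * x \<in> {0..elen G e}"
      and c2: "\<And>x. x \<in> {u..v} \<Longrightarrow> emap H d x = emap G e (c + \<sigma> * x)"
      using piece by simp_all
    have all: "\<forall>x\<in>{u<..<v}. emap H d x \<notin> N \<and> c + \<sigma> * x \<in> {0..elen G e} \<and> emap H d x = emap G e (c + \<sigma> * x)"
      using free c1 c2 by simp
    show ?thesis
      by (intro exI[of _ u] exI[of _ v] exI[of _ e] exI[of _ c] exI[of _ \<sigma>] conjI uv e \<sigma> all)
  qed
  have hHint: "hH d absolutely_integrable_on {0..elen H d}" if "d \<in> edges H" for d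
    unfolding hH_def using dirichlet_integrand[OF okH H that] .
  have change: "hH d absolutely_integrable_on A d e \<and> hG e absolutely_integrable_on B d e \<and>
      integral (B d e) (hG e) = integral (A d e) (hH d)"
    if d: "d \<in> edges H" and e: "e \<in> edges G" for d e
  proof -
    define \<gamma> where "\<gamma> = (\<lambda>s. THE t. t \<in> {0..elen G e} \<and> emap H d s = emap G e t)"
    have \<gamma>: "\<gamma> s = t" if "s \<in> {0..elen H d}" "emap H d s \<notin> N" "t \<in> {0..elen G e}" "emap H d s = emap G e t" for s t
      unfolding \<gamma>_def
    proof (rule the_equality)
      fix t' assume t': "t' \<in> {0..elen G e} \<and> emap H d s = emap G e t'"
      have "emap G e t' = emap G e t" "emap G e t' \<notin> N" using t' that(2,4) by metis+
      then show "t' = t" by (rule inj_off_unique(2)[OF iG e e conjunct1[OF t'] that(3)])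
    qed (use that(3,4) in blast)
    have \<gamma>A: "\<gamma> s \<in> {0..elen G e}" "emap H d s = emap G e (\<gamma> s)" "s \<in> {0..elen H d}" "emap H d s \<notin> N"
      if sA: "s \<in> A d e" for s
    proof -
      obtain t where t: "s \<in> {0..elen H d}" "emap H d s \<notin> N" "t \<in> {0..elen G e}" "emap H d s = emap G e t"
        using sA unfolding A_def by blast
      then have "\<gamma> s = t" by (rule \<gamma>)
      then show "\<gamma> s \<in> {0..elen G e}" "emap H d s = emap G e (\<gamma> s)" "s \<in> {0..elen H d}" "emap H d s \<notin> N"
        using t by blast+
    qed
    have locA: "\<exists>u v \<sigma> c. u < s \<and> s < v \<and> (\<sigma> = 1 \<or> \<sigma> = (-1::real)) \<and> {u<..<v} \<subseteq> A d e \<and>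
      (\<forall>x\<in>{u<..<v}. \<gamma> x = c + \<sigma> * x \<and> emap H d x = emap G e (c + \<sigma> * x))" if s: "s \<in> A d e" for s
    proof -
      obtain u v e' c \<sigma> where piece: "u < s \<and> s < v \<and> 0 \<le> u \<and> v \<le> elen H d \<and> e' \<in> edges G \<and> (\<sigma> = 1 \<or> \<sigma> = (-1::real)) \<and>
        (\<forall>x\<in>{u<..<v}. emap H d x \<notin> N \<and> c + \<sigma> * x \<in> {0..elen G e'} \<and> emap H d x = emap G e' (c + \<sigma> * x))"
        using loc[OF d \<gamma>A(3,4)[OF s]] by (elim exE) (rule that)
      then have uv: "u < s" "s < v" "0 \<le> u" "v \<le> elen H d" and e': "e' \<in> edges G"
        and \<sigma>: "\<sigma> = 1 \<or> \<sigma> = (-1::real)" by blast+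
      have c: "\<And>x. x \<in> {u<..<v} \<Longrightarrow> emap H d x \<notin> N" "\<And>x. x \<in> {u<..<v} \<Longrightarrow> c + \<sigma> * x \<in> {0..elen G e'}"
          "\<And>x. x \<in> {u<..<v} \<Longrightarrow> emap H d x = emap G e' (c + \<sigma> * x)"
        using piece by blast+
      have ss: "s \<in> {u<..<v}" using uv by simp
      have "e = e'"
        using inj_off_unique(1)[OF iG e e' \<gamma>A(1)[OF s] c(2)[OF ss]] \<gamma>A(2,4)[OF s] c(3)[OF ss] by metis
      note c = c[folded this]
      have xA: "x \<in> A d e \<and> \<gamma> x = c + \<sigma> * x" if x: "x \<in> {u<..<v}" for x
      proof -
        have "x \<in> {0..elen H d}" using x uv by auto
        then show ?thesis using c[OF x] \<gamma>[of x "c + \<sigma> * x"] unfolding A_def by blast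
      qed
      have sub: "{u<..<v} \<subseteq> A d e" using xA by blast
      have all: "\<forall>x\<in>{u<..<v}. \<gamma> x = c + \<sigma> * x \<and> emap H d x = emap G e (c + \<sigma> * x)"
        using xA c(3) by blast
      show ?thesis
        by (intro exI[of _ u] exI[of _ v] exI[of _ \<sigma>] exI[of _ c] conjI uv \<sigma> sub all)
    qed
    \<comment> \<open>Off \<open>N\<close> the transition map is defined on a whole interval around
      each parameter, so \<open>A d e\<close> is open and in particular measurable.\<close>
    have "open (A d e)"
      unfolding open_contains_ball
    proof
      fix s assume "s \<in> A d e"
      then obtain u v where "s \<in> {u<..<v}" "{u<..<v} \<subseteq> A d e" using locA[of s] by auto
      then show "\<exists>r>0. ball s r \<subseteq> A d e"
        by (meson open_contains_ball open_greaterThanLessThan subset_trans)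
    qed
    then have meas: "A d e \<in> sets lebesgue" by simp
    have "A d e \<subseteq> {0..elen H d}" unfolding A_def by blast
    then have intA: "hH d absolutely_integrable_on A d e"
      using set_integrable_subset[OF hHint[OF d] meas] by blast
    have key: "(\<gamma> has_real_derivative deriv \<gamma> s) (at s within A d e) \<and> \<bar>deriv \<gamma> s\<bar> * hG e (\<gamma> s) = hH d s"
      if s: "s \<in> A d e" for s
    proof -
      obtain u v \<sigma> c where piece: "u < s \<and> s < v \<and> (\<sigma> = 1 \<or> \<sigma> = (-1::real)) \<and> {u<..<v} \<subseteq> A d e \<and>
        (\<forall>x\<in>{u<..<v}. \<gamma> x = c + \<sigma> * x \<and> emap H d x = emap G e (c + \<sigma> * x))"
        using locA[OF s] by (elim exE) (rule that)
      then have uv: "u < s" "s < v" and \<sigma>: "\<sigma> = 1 \<or> \<sigma> = (-1::real)" by blast+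
      have c: "\<And>x. x \<in> {u<..<v} \<Longrightarrow> \<gamma> x = c + \<sigma> * x" "\<And>x. x \<in> {u<..<v} \<Longrightarrow> emap H d x = emap G e (c + \<sigma> * x)"
        using piece by blast+
      have ss: "s \<in> {u<..<v}" using uv by simp
      have aff: "((\<lambda>x. c + \<sigma> * x) has_real_derivative \<sigma>) (at s)" by (auto intro!: derivative_eq_intros)
      have d\<gamma>: "(\<gamma> has_real_derivative \<sigma>) (at s)"
        by (rule has_field_derivative_transform_within_open[OF aff, where S="{u<..<v}"]) (use uv c in auto)
      \<comment> \<open>\<open>deriv\<close> obeys the chain rule only where the derivative exists;
        \<open>smooth\<close> guarantees this off \<open>N\<close>.\<close>
      have chain: "edge_deriv H h d s = edge_deriv G h e (\<gamma> s) * \<sigma>"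
        if "((\<lambda>s. h (emap G e s)) has_real_derivative edge_deriv G h e (\<gamma> s)) (at (\<gamma> s))" for h
      proof -
        have "((\<lambda>x. h (emap G e (c + \<sigma> * x))) has_real_derivative edge_deriv G h e (\<gamma> s) * \<sigma>) (at s)"
          using DERIV_chain2[of "\<lambda>s. h (emap G e s)", OF _ aff] that c(1)[OF ss] by simp
        then have "((\<lambda>x. h (emap H d x)) has_real_derivative edge_deriv G h e (\<gamma> s) * \<sigma>) (at s)"
          by (rule has_field_derivative_transform_within_open[where S="{u<..<v}"]) (use uv c in auto)
        then show ?thesis unfolding edge_deriv_def[of H] by (rule DERIV_imp_deriv)
      qed
      have "emap G e (\<gamma> s) \<notin> N" using \<gamma>A(2,4)[OF s] by metis
      then have fg: "edge_deriv H f d s = edge_deriv G f e (\<gamma> s) * \<sigma>" "edge_deriv H g d s = edge_deriv G g e (\<gamma> s) * \<sigma>"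
        using smooth[OF e \<gamma>A(1)[OF s]] chain[of f] chain[of g] by auto
      \<comment> \<open>Orientation drops out: \<open>\<sigma>\<close> enters once through its
        absolute value and twice through the two derivatives.\<close>
      have "\<bar>deriv \<gamma> s\<bar> * hG e (\<gamma> s) = hH d s"
        unfolding DERIV_imp_deriv[OF d\<gamma>] hG_def hH_def fg \<gamma>A(2)[OF s] using \<sigma> by auto
      moreover have "(\<gamma> has_real_derivative deriv \<gamma> s) (at s within A d e)"
        unfolding DERIV_imp_deriv[OF d\<gamma>] using d\<gamma> by (rule has_field_derivative_at_within)
      ultimately show ?thesis by blast
    qed
    have inj: "inj_on \<gamma> (A d e)"
    proof (rule inj_onI)
      fix s s' assume "s \<in> A d e" "s' \<in> A d e" "\<gamma> s = \<gamma> s'"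
      then show "s = s'" using inj_off_unique(2)[OF iH d d, of s s'] \<gamma>A[of s] \<gamma>A[of s'] by metis
    qed
    have image: "\<gamma> ` A d e = B d e"
    proof
      show "\<gamma> ` A d e \<subseteq> B d e"
      proof
        fix t assume "t \<in> \<gamma> ` A d e"
        then obtain s where "s \<in> A d e" "t = \<gamma> s" by blast
        then show "t \<in> B d e" using \<gamma>A[of s] unfolding B_def by (metis (mono_tags, lifting) mem_Collect_eq)
      qed
      show "B d e \<subseteq> \<gamma> ` A d e"
      proof
        fix t assume "t \<in> B d e"
        then obtain s where st: "s \<in> {0..elen H d}" "emap H d s = emap G e t" "t \<in> {0..elen G e}" "emap G e t \<notin> N"
          unfolding B_def by blast
        then have n: "emap H d s \<notin> N" by simp
        have "\<gamma> s = t" by (rule \<gamma>[OF st(1) n st(3,2)])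
        moreover have "s \<in> A d e" unfolding A_def using st n by blast
        ultimately show "t \<in> \<gamma> ` A d e" by blast
      qed
    qed
    have eqA: "(\<lambda>x. \<bar>deriv \<gamma> x\<bar> * hG e (\<gamma> x)) absolutely_integrable_on A d e \<longleftrightarrow> hH d absolutely_integrable_on A d e"
      by (rule set_integrable_cong) (use key in auto)
    have eqI: "integral (A d e) (\<lambda>x. \<bar>deriv \<gamma> x\<bar> * hG e (\<gamma> x)) = integral (A d e) (hH d)"
      by (rule integral_cong) (use key in auto)
    show ?thesis
      using has_absolute_integral_change_of_variables_1'[OF meas _ inj, of "deriv \<gamma>" "hG e" "integral (A d e) (hH d)"]
        key intA unfolding eqA eqI image by blast
  qed
  have finG: "finite (edges G)" and finH: "finite (edges H)" using okG okH unfolding edges_ok_def by auto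
  have sumH: "integral {0..elen H d} (hH d) = (\<Sum>e\<in>edges G. integral (A d e) (hH d))" if d: "d \<in> edges H" for d
  proof -
    have "(hH d has_integral (\<Sum>e\<in>edges G. integral (A d e) (hH d))) (\<Union>e\<in>edges G. A d e)"
    proof (rule has_integral_UN[OF finG])
      show "(hH d has_integral integral (A d e) (hH d)) (A d e)" if "e \<in> edges G" for e
        using change[OF d that] set_lebesgue_integral_eq_integral(1) by blast
      show "pairwise (\<lambda>e e'. negligible (A d e \<inter> A d e')) (edges G)"
      proof (rule pairwiseI)
        fix e e' assume ee: "e \<in> edges G" "e' \<in> edges G" "e \<noteq> e'"
        have "A d e \<inter> A d e' = {}"
        proof (rule ccontr)
          assume "A d e \<inter> A d e' \<noteq> {}"
          then obtain s t t' where "t \<in> {0..elen G e}" "emap H d s = emap G e t" "t' \<in> {0..elen G e'}"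
            "emap H d s = emap G e' t'" "emap H d s \<notin> N" unfolding A_def by blast
          then show False using inj_off_unique(1)[OF iG ee(1,2), of t t'] ee(3) by metis
        qed
        then show "negligible (A d e \<inter> A d e')" by simp
      qed
    qed
    then have I: "integral (\<Union>e\<in>edges G. A d e) (hH d) = (\<Sum>e\<in>edges G. integral (A d e) (hH d))"
      by (rule integral_unique)
    have sub: "(\<Union>e\<in>edges G. A d e) \<subseteq> {0..elen H d}" unfolding A_def by blast
    \<comment> \<open>A parameter off \<open>N\<close> lies over some edge of \<open>G\<close>, so
      what is left lies over \<open>N\<close> and is finite.\<close>
    have "{0..elen H d} - (\<Union>e\<in>edges G. A d e) \<subseteq> {s \<in> {0..elen H d}. emap H d s \<in> N}"
    proof
      fix s assume s: "s \<in> {0..elen H d} - (\<Union>e\<in>edges G. A d e)"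
      have "emap H d s \<in> N"
      proof (rule ccontr)
        assume n: "emap H d s \<notin> N"
        have sd: "s \<in> {0..elen H d}" using s by blast
        obtain u v e c \<sigma> where piece: "u < s \<and> s < v \<and> 0 \<le> u \<and> v \<le> elen H d \<and> e \<in> edges G \<and> (\<sigma> = 1 \<or> \<sigma> = (-1::real)) \<and>
          (\<forall>x\<in>{u<..<v}. emap H d x \<notin> N \<and> c + \<sigma> * x \<in> {0..elen G e} \<and> emap H d x = emap G e (c + \<sigma> * x))"
          using loc[OF d sd n] by (elim exE) (rule that)
        then have "s \<in> {u<..<v}" by simp
        then have "c + \<sigma> * s \<in> {0..elen G e}" "emap H d s = emap G e (c + \<sigma> * s)" using piece by blast+
        then have "s \<in> A d e" unfolding A_def using sd n by blast
        then show False using s piece by blast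
      qed
      then show "s \<in> {s \<in> {0..elen H d}. emap H d s \<in> N}" using s by blast
    qed
    then have "finite ({0..elen H d} - (\<Union>e\<in>edges G. A d e))" using inj_offD(3)[OF iH d] finite_subset by blast
    then have neg: "negligible ({0..elen H d} - (\<Union>e\<in>edges G. A d e))" by (rule negligible_finite)
    have "{x \<in> (\<Union>e\<in>edges G. A d e) - {0..elen H d}. hH d x \<noteq> 0} = {}" using sub by blast
    then have "integral {0..elen H d} (hH d) = integral (\<Union>e\<in>edges G. A d e) (hH d)"
      by (intro integral_spike_set negligible_subset[OF neg]) auto
    then show ?thesis using I by simp
  qed
  have sumG: "integral {0..elen G e} (hG e) = (\<Sum>d\<in>edges H. integral (B d e) (hG e))" if e: "e \<in> edges G" for e
  proof -
    have "(hG e has_integral (\<Sum>d\<in>edges H. integral (B d e) (hG e))) (\<Union>d\<in>edges H. B d e)"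
    proof (rule has_integral_UN[OF finH])
      show "(hG e has_integral integral (B d e) (hG e)) (B d e)" if "d \<in> edges H" for d
        using change[OF that e] set_lebesgue_integral_eq_integral(1) by blast
      show "pairwise (\<lambda>d d'. negligible (B d e \<inter> B d' e)) (edges H)"
      proof (rule pairwiseI)
        fix d d' assume dd: "d \<in> edges H" "d' \<in> edges H" "d \<noteq> d'"
        have "B d e \<inter> B d' e = {}"
        proof (rule ccontr)
          assume "B d e \<inter> B d' e \<noteq> {}"
          then obtain t s s' where "s \<in> {0..elen H d}" "emap H d s = emap G e t" "s' \<in> {0..elen H d'}"
            "emap H d' s' = emap G e t" "emap G e t \<notin> N" unfolding B_def by blast
          then show False using inj_off_unique(1)[OF iH dd(1,2), of s s'] dd(3) by metis
        qed
        then show "negligible (B d e \<inter> B d' e)" by simp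
      qed
    qed
    then have I: "integral (\<Union>d\<in>edges H. B d e) (hG e) = (\<Sum>d\<in>edges H. integral (B d e) (hG e))"
      by (rule integral_unique)
    have sub: "(\<Union>d\<in>edges H. B d e) \<subseteq> {0..elen G e}" unfolding B_def by blast
    have "{0..elen G e} - (\<Union>d\<in>edges H. B d e) \<subseteq> {t \<in> {0..elen G e}. emap G e t \<in> N}"
    proof
      fix t assume t: "t \<in> {0..elen G e} - (\<Union>d\<in>edges H. B d e)"
      have "emap G e t \<in> N"
      proof (rule ccontr)
        assume n: "emap G e t \<notin> N"
        have te: "t \<in> {0..elen G e}" using t by blast
        obtain d where d: "d \<in> edges H" and "\<exists>s\<in>{0..elen H d}. emap H d s = emap G e t"
          using cov[unfolded covered_off_def, rule_format, OF e te n] by blast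
        then have "t \<in> B d e" unfolding B_def using te n by simp
        then show False using t d by blast
      qed
      then show "t \<in> {t \<in> {0..elen G e}. emap G e t \<in> N}" using t by blast
    qed
    then have "finite ({0..elen G e} - (\<Union>d\<in>edges H. B d e))" using inj_offD(3)[OF iG e] finite_subset by blast
    then have neg: "negligible ({0..elen G e} - (\<Union>d\<in>edges H. B d e))" by (rule negligible_finite)
    have "{x \<in> (\<Union>d\<in>edges H. B d e) - {0..elen G e}. hG e x \<noteq> 0} = {}" using sub by blast
    then have "integral {0..elen G e} (hG e) = integral (\<Union>d\<in>edges H. B d e) (hG e)"
      by (intro integral_spike_set negligible_subset[OF neg]) auto
    then show ?thesis using I by simp
  qed
  have "dirichlet H k f g = (\<Sum>d\<in>edges H. \<Sum>e\<in>edges G. integral (A d e) (hH d))"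
    unfolding dirichlet_def graph_integral_def using sumH by (simp add: hH_def)
  also have "\<dots> = (\<Sum>d\<in>edges H. \<Sum>e\<in>edges G. integral (B d e) (hG e))"
    using change by simp
  also have "\<dots> = (\<Sum>e\<in>edges G. \<Sum>d\<in>edges H. integral (B d e) (hG e))" by (rule sum.swap)
  also have "\<dots> = dirichlet G k f g"
    unfolding dirichlet_def graph_integral_def using sumG by (simp add: hG_def)
  finally show ?thesis .
qed

subsection \<open>Union along two points\<close>

text \<open>
  The edges of both parts, as one family.  This is not a metrized graph in general, since \<open>p\<close> may be an
  inner point of an edge in each of the parts.
\<close>

definition graph_sum :: "('a, 'e1) mgraph \<Rightarrow> ('a, 'e2) mgraph \<Rightarrow> ('a, 'e1 + 'e2) mgraph" where
  "graph_sum G1 G2 = \<lparr>verts = verts G1 \<union> verts G2, edges = edges G1 <+> edges G2,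
     elen = case_sum (elen G1) (elen G2), emap = case_sum (emap G1) (emap G2)\<rparr>"

lemma graph_sum_simps [simp]:
  "edges (graph_sum G1 G2) = edges G1 <+> edges G2"
  "elen (graph_sum G1 G2) (Inl d) = elen G1 d" "elen (graph_sum G1 G2) (Inr d') = elen G2 d'"
  "emap (graph_sum G1 G2) (Inl d) = emap G1 d" "emap (graph_sum G1 G2) (Inr d') = emap G2 d'"
  by (simp_all add: graph_sum_def)

lemma ball_edges_graph_sum:
  "(\<forall>d\<in>edges (graph_sum G1 G2). P d) \<longleftrightarrow> (\<forall>d\<in>edges G1. P (Inl d)) \<and> (\<forall>d\<in>edges G2. P (Inr d))"
  by (auto simp: Plus_def)

lemma edges_ok_graph_sum: "edges_ok G1 \<Longrightarrow> edges_ok G2 \<Longrightarrow> edges_ok (graph_sum G1 G2)"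
  unfolding edges_ok_def ball_edges_graph_sum by simp

lemma edgewise_poly_graph_sum:
  "edgewise_poly (graph_sum G1 G2) f \<longleftrightarrow> edgewise_poly G1 f \<and> edgewise_poly G2 f"
  unfolding edgewise_poly_def ball_edges_graph_sum by simp

lemma dirichlet_graph_sum:
  assumes "finite (edges G1)" "finite (edges G2)"
  shows "dirichlet (graph_sum G1 G2) k f g = dirichlet G1 k f g + dirichlet G2 k f g"
  unfolding dirichlet_def graph_integral_def edge_deriv_def
  using assms by (simp add: sum.Plus)

lemma subdivided_graph_sum:
  "subdivided N G1 G \<Longrightarrow> subdivided N G2 G \<Longrightarrow> subdivided N (graph_sum G1 G2) G"
  unfolding subdivided_def ball_edges_graph_sum graph_sum_simps(2-5) by (rule conjI)

section \<open>A common exceptional set for the union and its parts\<close>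

lemma inj_off_metrized_graph:
  assumes G: "metrized_graph G" and N: "finite N" "verts G \<subseteq> N"
  shows "inj_off N G"
  unfolding inj_off_def
proof (intro conjI ballI impI)
  fix e e' t t' assume *: "e \<in> edges G" "e' \<in> edges G" "t \<in> {0..elen G e}" "t' \<in> {0..elen G e'}"
    "emap G e t = emap G e' t'" "emap G e t \<notin> N"
  then have "emap G e t \<notin> verts G" using N by blast
  from emap_inner_unique[OF G *(1-5) this] show "e = e'" "t = t'" by blast+
qed (use finite_emap_preimage[OF G _ N(1)] metrized_graphD(5,6)[OF G] N(2) in \<open>auto simp: subset_iff\<close>)

text \<open>A point of both parts has coordinates in both edge families, so such points have to be
  exceptional.\<close>

lemma inj_off_graph_sum:
  assumes i1: "inj_off N G1" and i2: "inj_off N G2" and N: "pts G1 \<inter> pts G2 \<subseteq> N"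
  shows "inj_off N (graph_sum G1 G2)"
proof -
  have cross: "emap G1 d t \<noteq> emap G2 d' t'"
    if "d \<in> edges G1" "d' \<in> edges G2" "t \<in> {0..elen G1 d}" "t' \<in> {0..elen G2 d'}" "emap G1 d t \<notin> N" for d d' t t'
    using emap_in_pts[OF that(1,3)] emap_in_pts[OF that(2,4)] N that(5) by auto
  show ?thesis
    unfolding inj_off_def ball_edges_graph_sum graph_sum_simps(2-5) sum.inject
  proof (intro conjI ballI impI)
    fix d d' t t' assume *: "d \<in> edges G1" "d' \<in> edges G1" "t \<in> {0..elen G1 d}" "t' \<in> {0..elen G1 d'}"
      "emap G1 d t = emap G1 d' t'" "emap G1 d t \<notin> N"
    show "d = d'" "t = t'" using inj_off_unique[OF i1 *] .
  next
    fix d d' t t' assume *: "d \<in> edges G2" "d' \<in> edges G2" "t \<in> {0..elen G2 d}" "t' \<in> {0..elen G2 d'}"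
      "emap G2 d t = emap G2 d' t'" "emap G2 d t \<notin> N"
    show "d = d'" "t = t'" using inj_off_unique[OF i2 *] .
  next
    fix d d' t t' assume *: "d \<in> edges G1" "d' \<in> edges G2" "t \<in> {0..elen G1 d}" "t' \<in> {0..elen G2 d'}"
      "emap G1 d t = emap G2 d' t'" "emap G1 d t \<notin> N"
    show "Inl d = Inr d'" "t = t'" using cross[OF *(1-4,6)] *(5) by blast+
  next
    fix d d' t t' assume *: "d \<in> edges G2" "d' \<in> edges G1" "t \<in> {0..elen G2 d}" "t' \<in> {0..elen G1 d'}"
      "emap G2 d t = emap G1 d' t'" "emap G2 d t \<notin> N"
    have n: "emap G1 d' t' \<notin> N" using *(5,6) by simp
    show "Inr d = Inl d'" "t = t'" using cross[OF *(2,1,4,3) n] *(5) by simp_all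
  qed (use inj_offD[OF i1] inj_offD[OF i2] in auto)
qed

text \<open>Each break parameter is replaced by the point it lies over. Enlarging \<open>N\<close>
  only leaves fewer pieces to match, so every larger set works too.\<close>

lemma metrized_subgraph_subdivided:
  assumes "metrized_subgraph H G" "finite (edges H)"
  obtains N0 where "finite N0" "\<And>N. N0 \<subseteq> N \<Longrightarrow> subdivided N H G"
proof -
  let ?P = "\<lambda>d u v. \<exists>e\<in>edges G. \<exists>c.
      (\<forall>t\<in>{u..v}. c + t \<in> {0..elen G e} \<and> emap H d t = emap G e (c + t)) \<or>
      (\<forall>t\<in>{u..v}. c - t \<in> {0..elen G e} \<and> emap H d t = emap G e (c - t))"
  have "\<forall>d\<in>edges H. \<exists>S. finite S \<and> (\<forall>u v. 0 \<le> u \<and> u < v \<and> v \<le> elen H d \<and> {u<..<v} \<inter> S = {} \<longrightarrow> ?P d u v)"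
    using assms(1) unfolding metrized_subgraph_def unit_speed_path_def by (rule conjunct2)
  from bchoice[OF this] obtain S where S: "\<forall>d\<in>edges H. finite (S d) \<and>
      (\<forall>u v. 0 \<le> u \<and> u < v \<and> v \<le> elen H d \<and> {u<..<v} \<inter> S d = {} \<longrightarrow> ?P d u v)" by (rule exE)
  define N0 where "N0 = (\<Union>d\<in>edges H. emap H d ` S d)"
  have "subdivided N H G" if N: "N0 \<subseteq> N" for N
    unfolding subdivided_def
  proof (intro ballI allI impI)
    fix d u v assume d: "d \<in> edges H"
      and uv: "0 \<le> u \<and> u < v \<and> v \<le> elen H d \<and> emap H d ` {u<..<v} \<inter> N = {}"
    have "{u<..<v} \<inter> S d = {}" using uv N d unfolding N0_def by blast
    then have "?P d u v" using S[rule_format, OF d] uv by simp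
    then obtain e c where e: "e \<in> edges G" and
      c: "(\<forall>t\<in>{u..v}. c + t \<in> {0..elen G e} \<and> emap H d t = emap G e (c + t)) \<or>
        (\<forall>t\<in>{u..v}. c - t \<in> {0..elen G e} \<and> emap H d t = emap G e (c - t))" by blast
    from c show "\<exists>e\<in>edges G. \<exists>c \<sigma>. (\<sigma> = 1 \<or> \<sigma> = -1) \<and>
           (\<forall>t\<in>{u..v}. c + \<sigma> * t \<in> {0..elen G e} \<and> emap H d t = emap G e (c + \<sigma> * t))"
    proof
      assume "\<forall>t\<in>{u..v}. c + t \<in> {0..elen G e} \<and> emap H d t = emap G e (c + t)"
      then show ?thesis by (intro bexI[OF _ e] exI[of _ c] exI[of _ 1]) simp
    next
      assume "\<forall>t\<in>{u..v}. c - t \<in> {0..elen G e} \<and> emap H d t = emap G e (c - t)"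
      then show ?thesis by (intro bexI[OF _ e] exI[of _ c] exI[of _ "-1"]) simp
    qed
  qed
  moreover have "finite N0" unfolding N0_def using assms(2) S by auto
  ultimately show thesis using that by blast
qed

lemma edgewise_poly_smooth_off:
  assumes "finite (edges G)" and f: "edgewise_poly G f"
  obtains M where "finite M" "\<And>e t. e \<in> edges G \<Longrightarrow> t \<in> {0..elen G e} \<Longrightarrow> emap G e t \<notin> M \<Longrightarrow>
    ((\<lambda>s. f (emap G e s)) has_real_derivative edge_deriv G f e t) (at t)"
proof -
  have "\<forall>e\<in>edges G. \<exists>S. finite S \<and> (\<forall>t\<in>{0<..<elen G e} - S.
    ((\<lambda>s. f (emap G e s)) has_real_derivative edge_deriv G f e t) (at t))"
  proof
    fix e assume "e \<in> edges G"
    then have "piecewise_poly (\<lambda>s. f (emap G e s)) 0 (elen G e)" using f unfolding edgewise_poly_def by blast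
    then show "\<exists>S. finite S \<and> (\<forall>t\<in>{0<..<elen G e} - S.
        ((\<lambda>s. f (emap G e s)) has_real_derivative edge_deriv G f e t) (at t))"
      unfolding edge_deriv_def by (rule piecewise_poly_DERIV) blast
  qed
  from bchoice[OF this] obtain S where S: "\<forall>e\<in>edges G. finite (S e) \<and> (\<forall>t\<in>{0<..<elen G e} - S e.
    ((\<lambda>s. f (emap G e s)) has_real_derivative edge_deriv G f e t) (at t))" by (rule exE)
  define M where "M = (\<Union>e\<in>edges G. emap G e ` ({0, elen G e} \<union> S e))"
  show thesis
  proof (rule that[of M])
    show "finite M" unfolding M_def using assms(1) S by auto
    fix e t assume e: "e \<in> edges G" and t: "t \<in> {0..elen G e}" "emap G e t \<notin> M"
    have "t \<notin> {0, elen G e} \<union> S e" using e t(2) unfolding M_def by blast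
    then have "t \<in> {0<..<elen G e} - S e" using t(1) by auto
    then show "((\<lambda>s. f (emap G e s)) has_real_derivative edge_deriv G f e t) (at t)" using S e by blast
  qed
qed

lemma union_subdivided:
  assumes G1: "metrized_graph G1" and G2: "metrized_graph G2" and G: "metrized_graph G"
    and U: "is_union G G1 G2" and fin: "finite (pts G1 \<inter> pts G2)"
  obtains N0 where "finite N0" "\<And>N. finite N \<Longrightarrow> N0 \<subseteq> N \<Longrightarrow> inj_off N (graph_sum G1 G2) \<and> inj_off N G \<and>
    subdivided N (graph_sum G1 G2) G \<and> covered_off N G (graph_sum G1 G2)"
proof -
  have sub: "metrized_subgraph G1 G" "metrized_subgraph G2 G" and pts: "pts G = pts G1 \<union> pts G2"
    using U unfolding is_union_def by auto
  obtain N1 where N1: "finite N1" "\<And>N. N1 \<subseteq> N \<Longrightarrow> subdivided N G1 G"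
    by (rule metrized_subgraph_subdivided[OF sub(1) metrized_graphD(3)[OF G1]]) blast
  obtain N2 where N2: "finite N2" "\<And>N. N2 \<subseteq> N \<Longrightarrow> subdivided N G2 G"
    by (rule metrized_subgraph_subdivided[OF sub(2) metrized_graphD(3)[OF G2]]) blast
  define N0 where "N0 = N1 \<union> N2 \<union> verts G \<union> verts G1 \<union> verts G2 \<union> (pts G1 \<inter> pts G2)"
  show thesis
  proof (rule that[of N0])
    show "finite N0"
      unfolding N0_def using N1(1) N2(1) fin metrized_graphD(1)[OF G] metrized_graphD(1)[OF G1] metrized_graphD(1)[OF G2]
      by simp
    fix N assume N: "finite N" "N0 \<subseteq> N"
    have "inj_off N (graph_sum G1 G2)"
      by (intro inj_off_graph_sum inj_off_metrized_graph[OF G1 N(1)] inj_off_metrized_graph[OF G2 N(1)])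
        (use N(2) in \<open>auto simp: N0_def\<close>)
    moreover have "inj_off N G"
      by (rule inj_off_metrized_graph[OF G N(1)]) (use N(2) in \<open>auto simp: N0_def\<close>)
    moreover have "subdivided N (graph_sum G1 G2) G"
      by (intro subdivided_graph_sum N1(2) N2(2)) (use N(2) in \<open>auto simp: N0_def\<close>)
    moreover have "covered_off N G (graph_sum G1 G2)"
      unfolding covered_off_def
    proof (intro ballI impI)
      fix e t assume "e \<in> edges G" "t \<in> {0..elen G e}" and n: "emap G e t \<notin> N"
      then have "emap G e t \<in> pts G1 \<union> pts G2" using emap_in_pts pts by metis
      moreover have "emap G e t \<notin> verts G1" "emap G e t \<notin> verts G2" using n N(2) by (auto simp: N0_def)
      ultimately consider d s where "d \<in> edges G1" "s \<in> {0..elen G1 d}" "emap G e t = emap G1 d s"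
        | d s where "d \<in> edges G2" "s \<in> {0..elen G2 d}" "emap G e t = emap G2 d s"
        unfolding pts_def by blast
      then show "\<exists>d\<in>edges (graph_sum G1 G2). \<exists>s\<in>{0..elen (graph_sum G1 G2) d}.
          emap (graph_sum G1 G2) d s = emap G e t"
      proof cases
        case (1 d s)
        then show ?thesis by (intro bexI[of _ "Inl d"] bexI[of _ s]) auto
      next
        case (2 d s)
        then show ?thesis by (intro bexI[of _ "Inr d"] bexI[of _ s]) auto
      qed
    qed
    ultimately show "inj_off N (graph_sum G1 G2) \<and> inj_off N G \<and>
      subdivided N (graph_sum G1 G2) G \<and> covered_off N G (graph_sum G1 G2)" by blast
  qed
qed

text \<open>One direction restricts test functions to the parts; the other, by symmetry of
  subdivision, shows that a function glued from the two parts is admissible on the union.\<close>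

lemma union_edgewise_poly:
  assumes G1: "metrized_graph G1" and G2: "metrized_graph G2" and G: "metrized_graph G"
    and "is_union G G1 G2" "finite (pts G1 \<inter> pts G2)"
  shows "edgewise_poly G f \<longleftrightarrow> edgewise_poly G1 f \<and> edgewise_poly G2 f"
proof -
  obtain N where N: "inj_off N (graph_sum G1 G2) \<and> inj_off N G \<and>
      subdivided N (graph_sum G1 G2) G \<and> covered_off N G (graph_sum G1 G2)"
    by (rule union_subdivided[OF assms]) blast
  have ok: "edges_ok (graph_sum G1 G2)" "edges_ok G"
    using edges_ok_graph_sum metrized_graph_edges_ok[OF G1] metrized_graph_edges_ok[OF G2] metrized_graph_edges_ok[OF G]
    by blast+
  have "subdivided N G (graph_sum G1 G2)" using subdivided_sym[of N "graph_sum G1 G2" G] N by blast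
  then have "edgewise_poly G f \<longleftrightarrow> edgewise_poly (graph_sum G1 G2) f"
    using edgewise_poly_subdivided[of N G "graph_sum G1 G2" f] edgewise_poly_subdivided[of N "graph_sum G1 G2" G f] N ok
    by blast
  then show ?thesis unfolding edgewise_poly_graph_sum .
qed

lemma union_dirichlet:
  assumes G1: "metrized_graph G1" and G2: "metrized_graph G2" and G: "metrized_graph G"
    and U: "is_union G G1 G2" "finite (pts G1 \<inter> pts G2)"
    and k: "edgewise_poly G k" and f: "edgewise_poly G f" and g: "edgewise_poly G g"
  shows "dirichlet G k f g = dirichlet G1 k f g + dirichlet G2 k f g"
proof -
  let ?H = "graph_sum G1 G2"
  obtain N0 where N0: "finite N0" "\<And>N. finite N \<Longrightarrow> N0 \<subseteq> N \<Longrightarrow> inj_off N ?H \<and> inj_off N G \<and>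
      subdivided N ?H G \<and> covered_off N G ?H"
    by (rule union_subdivided[OF assms(1-5)]) blast
  obtain Mf where Mf: "finite Mf" "\<And>e t. e \<in> edges G \<Longrightarrow> t \<in> {0..elen G e} \<Longrightarrow> emap G e t \<notin> Mf \<Longrightarrow>
    ((\<lambda>s. f (emap G e s)) has_real_derivative edge_deriv G f e t) (at t)"
    by (rule edgewise_poly_smooth_off[OF metrized_graphD(3)[OF G] f]) blast
  obtain Mg where Mg: "finite Mg" "\<And>e t. e \<in> edges G \<Longrightarrow> t \<in> {0..elen G e} \<Longrightarrow> emap G e t \<notin> Mg \<Longrightarrow>
    ((\<lambda>s. g (emap G e s)) has_real_derivative edge_deriv G g e t) (at t)"
    by (rule edgewise_poly_smooth_off[OF metrized_graphD(3)[OF G] g]) blast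
  define N where "N = N0 \<union> Mf \<union> Mg"
  have N: "inj_off N ?H" "inj_off N G" "subdivided N ?H G" "covered_off N G ?H"
    using N0(2)[of N] N0(1) Mf(1) Mg(1) by (auto simp: N_def)
  have K: "edgewise_poly ?H h" if "edgewise_poly G h" for h
    using union_edgewise_poly[OF assms(1-5)] that unfolding edgewise_poly_graph_sum by blast
  have "dirichlet ?H k f g = dirichlet G k f g"
  proof (rule dirichlet_subdivided[OF N(3,1,2,4) _ _ K[OF k] K[OF f] K[OF g]])
    show "edges_ok ?H" "edges_ok G"
      using edges_ok_graph_sum metrized_graph_edges_ok[OF G1] metrized_graph_edges_ok[OF G2] metrized_graph_edges_ok[OF G]
      by blast+
    fix e t assume "e \<in> edges G" "t \<in> {0..elen G e}" "emap G e t \<notin> N"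
    then show "((\<lambda>s. f (emap G e s)) has_real_derivative edge_deriv G f e t) (at t) \<and>
        ((\<lambda>s. g (emap G e s)) has_real_derivative edge_deriv G g e t) (at t)"
      using Mf(2)[of e t] Mg(2)[of e t] by (simp add: N_def)
  qed
  then show ?thesis
    using dirichlet_graph_sum[OF metrized_graphD(3)[OF G1] metrized_graphD(3)[OF G2], of k f g] by simp
qed

section \<open>Resistance and energy in the union\<close>

lemma is_union_sym: "is_union G G1 G2 \<Longrightarrow> is_union G G2 G1"
  unfolding is_union_def by blast

text \<open>
  The current \<open>c = u\<^sub>1(x) / (R\<^sub>1 + R\<^sub>2)\<close> through the second part is determined by matching the two
  potentials at \<open>q\<close>.
\<close>

lemma union_resistance:
  assumes G1: "metrized_graph G1" and G2: "metrized_graph G2" and G: "metrized_graph G"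
    and U: "is_union G G1 G2" and pq: "pts G1 \<inter> pts G2 = {p, q}" "p \<noteq> q" and x: "x \<in> pts G1"
  shows "resistance G x p =
    resistance G1 x p - 1 / (resistance G1 p q + resistance G2 p q) * (voltage G1 p x q * voltage G1 p x q)"
proof -
  have in1: "p \<in> pts G1" "q \<in> pts G1" and in2: "p \<in> pts G2" "q \<in> pts G2" using pq by auto
  have pts: "pts G = pts G1 \<union> pts G2" using U unfolding is_union_def by blast
  have fin: "finite (pts G1 \<inter> pts G2)" using pq by simp
  define R where "R = resistance G1 p q + resistance G2 p q"
  define v u1 u2 where "v = (\<lambda>w. voltage G1 p w x)" and "u1 = (\<lambda>w. voltage G1 p w q)"
    and "u2 = (\<lambda>w. voltage G2 p w q)"
  define c where "c = u1 x / R"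
  have "0 < R" unfolding R_def
    using resistance_pos[OF G1 in1 pq(2)] resistance_pos[OF G2 in2 pq(2)] by simp
  then have cR: "c * R = u1 x" by (simp add: c_def)
  \<comment> \<open>Of the unit current from \<open>x\<close> to \<open>p\<close>, an amount
    \<open>c\<close> leaves the first part at \<open>q\<close>, runs through the second part and
    comes back at \<open>p\<close>. Subtracting \<open>c * u1\<close> takes it out at
    \<open>q\<close> and returns it at \<open>p\<close>; \<open>c * u2\<close> carries it
    across.\<close>
  define F where "F = (\<lambda>w. if w \<in> pts G1 then v w - c * u1 w else c * u2 w)"
  have wv: "weak_potential G1 x p v" and w1: "weak_potential G1 q p u1" and w2: "weak_potential G2 q p u2"
    unfolding v_def u1_def u2_def
    using voltage_weak_potential[OF G1 x in1(1)] voltage_weak_potential[OF G1 in1(2,1)]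
      voltage_weak_potential[OF G2 in2(2,1)] by auto
  then have K: "edgewise_poly G1 v" "edgewise_poly G1 u1" "edgewise_poly G2 u2"
    unfolding weak_potential_def by auto
  have at_p: "v p = 0" "u1 p = 0" "u2 p = 0"
    unfolding v_def u1_def u2_def
    using voltage_base_zero[OF G1] voltage_base_zero[OF G2] x in1 in2 by auto
  \<comment> \<open>The value \<open>v q = u1 x\<close> is reciprocity in the first part.\<close>
  have at_q: "v q = u1 x" "u1 q = resistance G1 p q" "u2 q = resistance G2 p q"
    unfolding v_def u1_def u2_def
    using voltage_sym[OF G1 in1(2) x in1(1)] resistance_sym[OF G1 in1] resistance_sym[OF G2 in2]
    by (auto simp: resistance_def)
  have F1: "F w = v w - c * u1 w" if "w \<in> pts G1" for w using that by (simp add: F_def)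
  have F2: "F w = c * u2 w" if w: "w \<in> pts G2" for w
  proof (cases "w \<in> pts G1")
    case True
    then have "w = p \<or> w = q" using w pq by blast
    moreover have "v q - c * u1 q = c * u2 q"
      using cR unfolding at_q R_def by (simp add: algebra_simps)
    ultimately show ?thesis using F1[OF True] at_p by auto
  qed (simp add: F_def)
  have K1: "edgewise_poly G1 (\<lambda>w. v w - c * u1 w)" by (intro edgewise_poly_intros K)
  have K2: "edgewise_poly G2 (\<lambda>w. c * u2 w)" by (intro edgewise_poly_intros K)
  have KF: "edgewise_poly G F"
    unfolding union_edgewise_poly[OF G1 G2 G U fin]
    using edgewise_poly_cong[OF K1 F1] edgewise_poly_cong[OF K2 F2] by blast
  have "energy G F g = g x - g p" if g: "edgewise_poly G g" for g
  proof -
    have g12: "edgewise_poly G1 g" "edgewise_poly G2 g"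
      using g unfolding union_edgewise_poly[OF G1 G2 G U fin] by auto
    have "energy G1 F g = energy G1 (\<lambda>w. v w - c * u1 w) g"
      by (rule dirichlet_cong) (use F1 in auto)
    also have "\<dots> = energy G1 v g - energy G1 (\<lambda>w. c * u1 w) g"
      by (rule dirichlet_diff[OF metrized_graph_edges_ok[OF G1]]) (intro edgewise_poly_intros K g12)+
    also have "energy G1 (\<lambda>w. c * u1 w) g = c * energy G1 u1 g"
      by (rule dirichlet_cmult[OF metrized_graph_edges_ok[OF G1]]) (intro edgewise_poly_intros K g12)+
    finally have e1: "energy G1 F g = (g x - g p) - c * (g q - g p)"
      using wv w1 g12 unfolding weak_potential_def by simp
    have "energy G2 F g = energy G2 (\<lambda>w. c * u2 w) g"
      by (rule dirichlet_cong) (use F2 in auto)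
    also have "\<dots> = c * energy G2 u2 g"
      by (rule dirichlet_cmult[OF metrized_graph_edges_ok[OF G2]]) (intro edgewise_poly_intros K g12)+
    finally have e2: "energy G2 F g = c * (g q - g p)"
      using w2 g12 unfolding weak_potential_def by simp
    \<comment> \<open>The current \<open>c\<close> exchanged at \<open>q\<close> and
      \<open>p\<close> contributes with opposite signs to the two parts and cancels.\<close>
    show ?thesis
      using union_dirichlet[OF G1 G2 G U fin edgewise_poly_const KF g, of 1] e1 e2 by simp
  qed
  then have "weak_potential G x p F" unfolding weak_potential_def using KF by blast
  then have "resistance G x p = F x - F p"
    unfolding resistance_def by (intro voltage_eq[OF G]) (use x in1 pts in auto)
  also have "\<dots> = resistance G1 x p - c * u1 x"
    using F1[OF x] F1[OF in1(1)] at_p by (simp add: v_def resistance_def)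
  finally show ?thesis unfolding c_def R_def u1_def by simp
qed

text \<open>The energy of \<open>r - k * u^2\<close> is expanded as a quadratic form in
  \<open>k\<close>. The constant term is four times the tau constant, and the other two coefficients
  are the energies computed from \<open>A_const\<close> and the cube of the resistance.\<close>

lemma union_energy_part:
  assumes G: "metrized_graph G" and p: "p \<in> pts G" and q: "q \<in> pts G"
    and \<rho>: "\<And>x. x \<in> pts G \<Longrightarrow> \<rho> x = resistance G x p - k * (voltage G p x q * voltage G p x q)"
  shows "energy G \<rho> \<rho> = 4 * tau G - 2 * k * ((resistance G p q)\<^sup>2 - 2 * A_const p q G) +
    4 / 3 * k\<^sup>2 * resistance G p q ^ 3"
proof -
  note ok = metrized_graph_edges_ok[OF G]
  define r u where "r = (\<lambda>x. resistance G x p)" and "u = (\<lambda>x. voltage G p x q * voltage G p x q)"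
  have K: "edgewise_poly G r" "edgewise_poly G u"
    unfolding r_def u_def
    by (intro edgewise_poly_intros resistance_edgewise_poly[OF G p] voltage_edgewise_poly[OF G q p])+
  have expand: "energy G (\<lambda>x. r x - k * u x) h = energy G r h - k * energy G u h" if h: "edgewise_poly G h" for h
  proof -
    have "energy G (\<lambda>x. r x - k * u x) h = energy G r h - energy G (\<lambda>x. k * u x) h"
      by (rule dirichlet_diff[OF ok]) (intro edgewise_poly_intros K h)+
    also have "energy G (\<lambda>x. k * u x) h = k * energy G u h"
      by (rule dirichlet_cmult[OF ok]) (intro edgewise_poly_intros K h)+
    finally show ?thesis .
  qed
  let ?f = "\<lambda>x. r x - k * u x"
  have Kf: "edgewise_poly G ?f" by (intro edgewise_poly_intros K)
  have "energy G \<rho> \<rho> = energy G ?f ?f"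
    by (rule dirichlet_cong) (use \<rho> in \<open>auto simp: r_def u_def\<close>)
  also have "\<dots> = energy G ?f r - k * energy G ?f u"
    using expand[OF Kf] dirichlet_sym[of G "\<lambda>_. 1" ?f r] dirichlet_sym[of G "\<lambda>_. 1" ?f u] by simp
  also have "\<dots> = energy G r r - 2 * k * energy G r u + k\<^sup>2 * energy G u u"
    unfolding expand[OF K(1)] expand[OF K(2)] dirichlet_sym[of G "\<lambda>_. 1" u r]
    by (simp add: algebra_simps power2_eq_square)
  finally show ?thesis
    using A_const_energy[OF G p q] tau_eq_energy[OF G p] unfolding r_def u_def by simp
qed

theorem theorem5p1:
  fixes G1 :: "('a, 'e1) mgraph" and G2 :: "('a, 'e2) mgraph" and G :: "('a, 'e) mgraph"
    and p q :: 'a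
  assumes "metrized_graph G1" and "metrized_graph G2" and "metrized_graph G"
    and "is_union G G1 G2"
    and "pts G1 \<inter> pts G2 = {p, q}" and "p \<noteq> q"
  shows "tau G = tau G1 + tau G2 - (resistance G1 p q + resistance G2 p q) / 6
           + (A_const p q G1 + A_const p q G2) / (resistance G1 p q + resistance G2 p q)"
proof -
  have in1: "p \<in> pts G1" "q \<in> pts G1" and in2: "p \<in> pts G2" "q \<in> pts G2" using assms(5) by auto
  have pG: "p \<in> pts G" using assms(4) in1 unfolding is_union_def by blast
  have fin: "finite (pts G1 \<inter> pts G2)" using assms(5) by simp
  have pq': "pts G2 \<inter> pts G1 = {p, q}" using assms(5) by blast
  define R1 R2 where "R1 = resistance G1 p q" and "R2 = resistance G2 p q"
  have pos: "0 < R1" "0 < R2"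
    unfolding R1_def R2_def using resistance_pos[OF assms(1) in1 assms(6)] resistance_pos[OF assms(2) in2 assms(6)] .
  define k where "k = 1 / (R1 + R2)"
  let ?\<rho> = "\<lambda>x. resistance G x p"
  have K: "edgewise_poly G ?\<rho>" by (rule resistance_edgewise_poly[OF assms(3) pG])
  have e1: "energy G1 ?\<rho> ?\<rho> = 4 * tau G1 - 2 * k * (R1\<^sup>2 - 2 * A_const p q G1) + 4 / 3 * k\<^sup>2 * R1 ^ 3"
    unfolding R1_def
    by (rule union_energy_part[OF assms(1) in1])
      (use union_resistance[OF assms] in \<open>simp add: k_def R1_def R2_def\<close>)
  have e2: "energy G2 ?\<rho> ?\<rho> = 4 * tau G2 - 2 * k * (R2\<^sup>2 - 2 * A_const p q G2) + 4 / 3 * k\<^sup>2 * R2 ^ 3"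
    unfolding R2_def
    by (rule union_energy_part[OF assms(2) in2])
      (use union_resistance[OF assms(2,1,3) is_union_sym[OF assms(4)] pq' assms(6)]
        in \<open>simp add: k_def R1_def R2_def add.commute\<close>)
  have "tau G = (energy G1 ?\<rho> ?\<rho> + energy G2 ?\<rho> ?\<rho>) / 4"
    using tau_eq_energy[OF assms(3) pG]
      union_dirichlet[OF assms(1-4) fin edgewise_poly_const K K, of 1] by simp
  also have "\<dots> = tau G1 + tau G2 - k / 2 * (R1\<^sup>2 + R2\<^sup>2) + k * (A_const p q G1 + A_const p q G2) +
      k\<^sup>2 / 3 * (R1 ^ 3 + R2 ^ 3)"
    unfolding e1 e2 by (simp add: field_simps)
  \<comment> \<open>The sum of cubes contains the factor \<open>R1 + R2\<close>, which absorbs one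
    factor \<open>k\<close>.\<close>
  also have "k\<^sup>2 / 3 * (R1 ^ 3 + R2 ^ 3) = k / 3 * (R1\<^sup>2 - R1 * R2 + R2\<^sup>2)"
  proof -
    have "R1 ^ 3 + R2 ^ 3 = (R1 + R2) * (R1\<^sup>2 - R1 * R2 + R2\<^sup>2)"
      by (simp add: power2_eq_square power3_eq_cube algebra_simps)
    moreover have "k * (R1 + R2) = 1" using pos by (simp add: k_def)
    ultimately show ?thesis by (simp add: power2_eq_square)
  qed
  \<comment> \<open>The squares combine with \<open>- 1/2 + 1/3 = - 1/6\<close> and the mixed term
    with \<open>- 1/3\<close>, which completes the square \<open>- (R1 + R2)^2 / 6\<close>.\<close>
  also have "tau G1 + tau G2 - k / 2 * (R1\<^sup>2 + R2\<^sup>2) + k * (A_const p q G1 + A_const p q G2) +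
      k / 3 * (R1\<^sup>2 - R1 * R2 + R2\<^sup>2) =
      tau G1 + tau G2 - k * (R1 + R2) * (R1 + R2) / 6 + k * (A_const p q G1 + A_const p q G2)"
    by (simp add: power2_eq_square field_simps)
  also have "k * (R1 + R2) = 1" using pos by (simp add: k_def)
  finally show ?thesis unfolding k_def R1_def[symmetric] R2_def[symmetric] by simp
qed

end
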